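(* Let $A$ and $B$ be measurable subsets of $\mathbb R^N$ of finite Lebesgue measure, and let $m\ge3$ be an integer. Let $(v_i)_{1\le i\le m-2}$ be functions in $L^2(\mathbb R^N)$ with (pairwise) disjoint supports $(C_i)_{1\le i\le m-2}$ such that $$(\forall i\in\{1,\ldots,m-2\})\quad\mu(C_i)<+\infty\quad\text{and}\quad\mu(C_i\cap\complement A)>0.$$ Then, for all functions $v_m$ and $v_{m-1}$ in $L^2(\mathbb R^N)$ and every $(\eta_i)_{1\le i\le m-2}\in\mathbb R^{m-2}$, there exists a function $x\in L^2(\mathbb R^N)$ such that $$(\forall i\in\{1,\ldots,m-2\})\quad\int_{C_i}x(t)\overline{v_i(t)}\,dt=\eta_i,\qquad x|_A=v_{m-1}|_A,\qquad\text{and}\qquad\widehat{x}|_B=\widehat{v}_m|_B.$$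
   Context: $\mu$ is Lebesgue measure on $\mathbb R^N$, $N\ge1$. $L^2(\mathbb R^N)$ is the space of (real- or complex-valued) square-integrable functions on $\mathbb R^N$, $\widehat{x}$ is the Fourier transform of $x$, and $\complement A=\mathbb R^N\smallsetminus A$. The support $C_i$ of $v_i$ is understood in the measure-theoretic sense $C_i=\{t\in\mathbb R^N : v_i(t)\neq0\}$ (up to null sets). Equalities of restrictions are understood almost everywhere. *)

theory Defs
  imports "HOL-Analysis.Analysis"
begin

text \<open>
  Scalar-valued functions are complex-valued functions with values in a scalar field \<open>K\<close>, where
  \<open>K = UNIV\<close> gives the complex and \<open>K = \<real>\<close> the real \<open>L\<^sup>2\<close> space. Elements of \<open>L\<^sup>2\<close> are represented
  by functions that are measurable for the Lebesgue sigma-algebra; classes modulo null sets are not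
  formed, so statements about elements of \<open>L\<^sup>2\<close> are made almost everywhere.
\<close>

definition L2 :: "complex set \<Rightarrow> (real ^ 'n \<Rightarrow> complex) set" where
  "L2 K = {f. f \<in> borel_measurable lebesgue \<and> range f \<subseteq> K \<and>
              integrable lebesgue (\<lambda>t. (cmod (f t))\<^sup>2)}"

definition support :: "(real ^ 'n \<Rightarrow> complex) \<Rightarrow> (real ^ 'n) set" where
  "support f = {t. f t \<noteq> 0}"

definition fourier_L1 :: "(real ^ 'n \<Rightarrow> complex) \<Rightarrow> real ^ 'n \<Rightarrow> complex" where
  "fourier_L1 f \<xi> = (\<integral>t. exp (- (2 * pi * \<i> * complex_of_real (\<xi> \<bullet> t))) * f t \<partial>lebesgue)"

text \<open>
  The extended nonnegative integral is used because it is infinite, rather than 0, when the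
  difference is not square-integrable.
\<close>

definition L2_tendsto ::
    "(nat \<Rightarrow> real ^ 'n \<Rightarrow> complex) \<Rightarrow> (real ^ 'n \<Rightarrow> complex) \<Rightarrow> bool" where
  "L2_tendsto f g \<longleftrightarrow>
     (\<lambda>k. \<integral>\<^sup>+t. ennreal ((cmod (f k t - g t))\<^sup>2) \<partial>lebesgue) \<longlonglongrightarrow> 0"

text \<open>
  The Fourier transform on \<open>L\<^sup>2\<close> is the continuous extension of the integral transform from
  \<open>L\<^sup>1 \<inter> L\<^sup>2\<close>. By Plancherel's theorem the relation below determines \<open>g\<close> from \<open>f \<in> L2 UNIV\<close> up to a
  null set, and \<open>fourier f\<close> is a representative.
\<close>

definition is_fourier :: "(real ^ 'n \<Rightarrow> complex) \<Rightarrow> (real ^ 'n \<Rightarrow> complex) \<Rightarrow> bool" where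
  "is_fourier f g \<longleftrightarrow> g \<in> L2 UNIV \<and>
     (\<exists>\<phi>. (\<forall>k. \<phi> k \<in> L2 UNIV \<and> integrable lebesgue (\<phi> k)) \<and>
          L2_tendsto \<phi> f \<and> L2_tendsto (\<lambda>k. fourier_L1 (\<phi> k)) g)"

definition fourier :: "(real ^ 'n \<Rightarrow> complex) \<Rightarrow> real ^ 'n \<Rightarrow> complex" where
  "fourier f = (SOME g. is_fourier f g)"

end

theory Submission
  imports Defs "HOL-Probability.Characteristic_Functions" "HOL-Complex_Analysis.Great_Picard"
    "HOL-Real_Asymp.Real_Asymp"
begin

text \<open>
  The values of \<open>x\<close> on a set of finite measure and the values of its Fourier transform on a set of
  finite measure are independent of each other. Let \<open>S = A \<union> \<Union>\<^sub>i C\<^sub>i\<close>. The aim is a function \<open>f\<close> on \<open>S\<close> that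
  equals \<open>v\<^bsub>m-1\<^esub>\<close> on \<open>A\<close> and \<open>c\<^sub>i v\<^sub>i\<close> on \<open>C\<^sub>i - A\<close>. As \<open>\<integral>\<bar>v\<^sub>i\<bar>\<^sup>2\<close> over \<open>C\<^sub>i - A\<close> is positive, and the \<open>C\<^sub>i\<close> are
  disjoint up to null sets, the constants \<open>c\<^sub>i\<close> can be chosen to give the inner products \<open>\<eta>\<^sub>i\<close>. It then suffices to find
  \<open>x\<^sub>0 = f - v\<^sub>m\<close> on \<open>S\<close> whose Fourier transform vanishes on \<open>B\<close>, and to take \<open>x = x\<^sub>0 + v\<^sub>m\<close>.

  Let \<open>Q\<close> be the projection onto the functions with spectrum in \<open>B\<close>. If \<open>y\<close> lives on \<open>S\<close> and solves
  \<open>y = h + 1\<^sub>S Q y\<close>, with \<open>h\<close> the function prescribed on \<open>S\<close>, then \<open>y - Q y\<close> equals \<open>h\<close> on \<open>S\<close> and has no spectrum in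
  \<open>B\<close>. The equation is solved by iteration (\<open>prescribe_on_set_and_spectrum\<close>), because
  \<open>1\<^sub>S Q\<close> is a strict contraction on the functions that live on \<open>S\<close>: this is \<open>strong_annihilation\<close>.

  Strong annihilation follows by compactness from a qualitative uncertainty principle. The Fourier
  transforms of unit functions on \<open>S\<close> are bounded and equicontinuous. If such functions had all but
  a vanishing part of their spectrum in \<open>B\<close>, then a subsequence would converge to a nonzero function
  that lives on \<open>S\<close> and has its spectrum in \<open>B\<close>. There is none (\<open>Amrein_Berthier\<close>): suitable translations
  of such a function would produce arbitrarily many orthonormal functions with spectrum in \<open>B\<close> that live on
  a set of measure at most \<open>\<mu>(S) + 1\<close>, but a set of measure \<open>s\<close> carries at most \<open>\<mu>(B) s\<close> of them
  (\<open>orthonormal_concentrated_count\<close>).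

  The Plancherel theory that this needs is derived from Gaussian means: contractivity on
  \<open>L\<^sup>1 \<inter> L\<^sup>2\<close> gives existence and uniqueness of the Fourier transform on \<open>L\<^sup>2\<close>, and the isometry for bounded integrable
  functions gives the inversion theorem for them.
\<close>

section \<open>The Hilbert space of square-integrable functions\<close>

definition l2norm :: "(real ^ 'n \<Rightarrow> complex) \<Rightarrow> real" where
  "l2norm f = sqrt (\<integral>t. (cmod (f t))\<^sup>2 \<partial>lebesgue)"

definition l2inner :: "(real ^ 'n \<Rightarrow> complex) \<Rightarrow> (real ^ 'n \<Rightarrow> complex) \<Rightarrow> complex" where
  "l2inner f g = (\<integral>t. f t * cnj (g t) \<partial>lebesgue)"

lemma L2_measurable [measurable_dest]: "f \<in> L2 K \<Longrightarrow> f \<in> borel_measurable lebesgue"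
  by (simp add: L2_def)

lemma L2_integrable: "f \<in> L2 K \<Longrightarrow> integrable lebesgue (\<lambda>t. (cmod (f t))\<^sup>2)"
  by (simp add: L2_def)

lemma L2_UNIV_I:
  "f \<in> borel_measurable lebesgue \<Longrightarrow> integrable lebesgue (\<lambda>t. (cmod (f t))\<^sup>2) \<Longrightarrow> f \<in> L2 UNIV"
  by (simp add: L2_def)

lemma L2_subset_UNIV: "f \<in> L2 K \<Longrightarrow> f \<in> L2 UNIV"
  by (simp add: L2_def)

lemma L2_dominated:
  assumes "f \<in> L2 K" and "g \<in> borel_measurable lebesgue" and "AE t in lebesgue. cmod (g t) \<le> c * cmod (f t)"
  shows "g \<in> L2 UNIV"
proof (rule L2_UNIV_I[OF assms(2)])
  have [measurable]: "g \<in> borel_measurable lebesgue" "f \<in> borel_measurable lebesgue"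
    using assms L2_measurable by auto
  show "integrable lebesgue (\<lambda>t. (cmod (g t))\<^sup>2)"
  proof (rule Bochner_Integration.integrable_bound)
    show "integrable lebesgue (\<lambda>t. c\<^sup>2 * (cmod (f t))\<^sup>2)"
      using L2_integrable[OF assms(1)] by simp
    show "AE t in lebesgue. norm ((cmod (g t))\<^sup>2) \<le> norm (c\<^sup>2 * (cmod (f t))\<^sup>2)"
      using assms(3)
    proof eventually_elim
      case (elim t)
      have "(cmod (g t))\<^sup>2 \<le> (c * cmod (f t))\<^sup>2"
        by (rule power_mono[OF elim]) simp
      thus ?case by (simp add: power_mult_distrib)
    qed
  qed measurable
qed

lemma sq_norm_add_le: "(cmod (a + b))\<^sup>2 \<le> 2 * (cmod a)\<^sup>2 + 2 * (cmod b)\<^sup>2"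
proof -
  have "(cmod (a + b))\<^sup>2 \<le> (cmod a + cmod b)\<^sup>2"
    by (rule power_mono[OF norm_triangle_ineq]) simp
  also have "\<dots> \<le> 2 * (cmod a)\<^sup>2 + 2 * (cmod b)\<^sup>2"
    using sum_squares_bound[of "cmod a" "cmod b"] by (simp add: power2_sum)
  finally show ?thesis .
qed

lemma L2_add [intro]:
  assumes "f \<in> L2 UNIV" "g \<in> L2 UNIV" shows "(\<lambda>t. f t + g t) \<in> L2 UNIV"
proof (rule L2_UNIV_I)
  note [measurable] = assms[THEN L2_measurable]
  show "(\<lambda>t. f t + g t) \<in> borel_measurable lebesgue" by measurable
  show "integrable lebesgue (\<lambda>t. (cmod (f t + g t))\<^sup>2)"
  proof (rule Bochner_Integration.integrable_bound)
    show "integrable lebesgue (\<lambda>t. 2 * (cmod (f t))\<^sup>2 + 2 * (cmod (g t))\<^sup>2)"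
      using assms[THEN L2_integrable] by simp
  qed (use sq_norm_add_le in \<open>auto\<close>)
qed

lemma L2_cmult [intro]: "f \<in> L2 UNIV \<Longrightarrow> (\<lambda>t. c * f t) \<in> L2 UNIV"
  by (rule L2_dominated[where c = "cmod c"]) (auto simp: norm_mult L2_measurable)

lemma L2_diff [intro]: "f \<in> L2 UNIV \<Longrightarrow> g \<in> L2 UNIV \<Longrightarrow> (\<lambda>t. f t - g t) \<in> L2 UNIV"
  using L2_add[of f "\<lambda>t. (-1) * g t"] L2_cmult[of g "-1"] by simp

lemma measurable_cnj [measurable]: "cnj \<in> borel_measurable borel"
  by (intro borel_measurable_continuous_onI continuous_intros)

lemma L2_cnj [intro]: "f \<in> L2 UNIV \<Longrightarrow> (\<lambda>t. cnj (f t)) \<in> L2 UNIV"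
  by (rule L2_dominated[where c = 1]) (auto intro: L2_measurable measurable_compose[OF _ measurable_cnj])

lemma L2_zero [simp]: "(\<lambda>t. 0) \<in> L2 UNIV"
  by (simp add: L2_def)

lemma L2_sum [intro]: "(\<And>i. i \<in> I \<Longrightarrow> f i \<in> L2 UNIV) \<Longrightarrow> (\<lambda>t. \<Sum>i\<in>I. f i t) \<in> L2 UNIV"
  by (induction I rule: infinite_finite_induct) auto

lemma L2_restrict [intro]:
  assumes "f \<in> L2 UNIV" "S \<in> sets lebesgue"
  shows "(\<lambda>t. indicator S t * f t) \<in> L2 UNIV"
  using assms(2) L2_measurable[OF assms(1)]
  by (intro L2_dominated[OF assms(1), where c = 1]) (auto simp: indicator_def)

lemma L2_mult_integrable:
  assumes "f \<in> L2 UNIV" "g \<in> L2 UNIV"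
  shows "integrable lebesgue (\<lambda>t. f t * g t)"
proof (rule Bochner_Integration.integrable_bound)
  note [measurable] = assms[THEN L2_measurable]
  show "integrable lebesgue (\<lambda>t. (cmod (f t))\<^sup>2 + (cmod (g t))\<^sup>2)"
    using assms[THEN L2_integrable] by simp
  have "norm (f t * g t) \<le> norm ((cmod (f t))\<^sup>2 + (cmod (g t))\<^sup>2)" for t
  proof -
    have "cmod (f t) * cmod (g t) \<le> (cmod (f t))\<^sup>2 + (cmod (g t))\<^sup>2"
      using sum_squares_bound[of "cmod (f t)" "cmod (g t)"] mult_nonneg_nonneg[OF norm_ge_zero[of "f t"] norm_ge_zero[of "g t"]]
      by linarith
    also have "\<dots> \<le> norm ((cmod (f t))\<^sup>2 + (cmod (g t))\<^sup>2)" by simp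
    finally show ?thesis by (simp only: norm_mult)
  qed
  thus "AE t in lebesgue. norm (f t * g t) \<le> norm ((cmod (f t))\<^sup>2 + (cmod (g t))\<^sup>2)"
    by simp
  show "(\<lambda>t. f t * g t) \<in> borel_measurable lebesgue" by measurable
qed

lemma L2_inner_integrable:
  "f \<in> L2 UNIV \<Longrightarrow> g \<in> L2 UNIV \<Longrightarrow> integrable lebesgue (\<lambda>t. f t * cnj (g t))"
  by (rule L2_mult_integrable) auto

lemma l2norm_nonneg [simp]: "0 \<le> l2norm f"
  by (simp add: l2norm_def)

lemma l2norm_sq: "(l2norm f)\<^sup>2 = (\<integral>t. (cmod (f t))\<^sup>2 \<partial>lebesgue)"
  by (simp add: l2norm_def)

lemma l2inner_self: "l2inner f f = complex_of_real ((l2norm f)\<^sup>2)"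
  by (simp add: l2inner_def l2norm_sq complex_norm_square[symmetric] flip: integral_complex_of_real of_real_power)

lemma l2inner_add_left: "f \<in> L2 UNIV \<Longrightarrow> g \<in> L2 UNIV \<Longrightarrow> h \<in> L2 UNIV \<Longrightarrow>
   l2inner (\<lambda>t. f t + g t) h = l2inner f h + l2inner g h"
  by (simp add: l2inner_def ring_distribs L2_inner_integrable)

lemma l2inner_diff_left: "f \<in> L2 UNIV \<Longrightarrow> g \<in> L2 UNIV \<Longrightarrow> h \<in> L2 UNIV \<Longrightarrow>
   l2inner (\<lambda>t. f t - g t) h = l2inner f h - l2inner g h"
  by (simp add: l2inner_def ring_distribs L2_inner_integrable)

lemma l2inner_cmult_left: "l2inner (\<lambda>t. c * f t) h = c * l2inner f h"
  by (simp add: l2inner_def mult.assoc)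

lemma l2inner_commute: "l2inner g f = cnj (l2inner f g)"
  unfolding l2inner_def Bochner_Integration.integral_cnj[symmetric] by (simp add: mult.commute)

lemma l2inner_sum_left: 
  assumes "\<And>i. i \<in> I \<Longrightarrow> f i \<in> L2 UNIV" "h \<in> L2 UNIV"
  shows "l2inner (\<lambda>t. \<Sum>i\<in>I. c i * f i t) h = (\<Sum>i\<in>I. c i * l2inner (f i) h)"
  unfolding l2inner_def sum_distrib_right
  by (subst Bochner_Integration.integral_sum)
     (use assms in \<open>auto intro!: L2_inner_integrable sum.cong simp: mult.assoc\<close>)

lemma l2norm_add_sq:
  assumes "f \<in> L2 UNIV" "g \<in> L2 UNIV"
  shows "(l2norm (\<lambda>t. f t + g t))\<^sup>2 = (l2norm f)\<^sup>2 + (l2norm g)\<^sup>2 + 2 * Re (l2inner f g)"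
proof -
  have eq: "(cmod (a + b))\<^sup>2 = (cmod a)\<^sup>2 + (cmod b)\<^sup>2 + 2 * Re (a * cnj b)" for a b
    unfolding cmod_power2 by (simp add: power2_eq_square algebra_simps)
  have "integrable lebesgue (\<lambda>t. Re (f t * cnj (g t)))"
    using L2_inner_integrable[OF assms] by (rule integrable_Re)
  moreover have "(\<integral>t. Re (f t * cnj (g t)) \<partial>lebesgue) = Re (l2inner f g)"
    unfolding l2inner_def by (rule integral_Re[OF L2_inner_integrable[OF assms]])
  ultimately show ?thesis
    unfolding l2norm_sq eq using assms[THEN L2_integrable] by (simp del: times_complex.sel)
qed

lemma l2norm_cmult: "l2norm (\<lambda>t. c * f t) = cmod c * l2norm f"
  by (simp add: l2norm_def norm_mult power_mult_distrib real_sqrt_mult)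

lemma l2norm_diff_sq:
  assumes "f \<in> L2 UNIV" "g \<in> L2 UNIV"
  shows "(l2norm (\<lambda>t. f t - g t))\<^sup>2 = (l2norm f)\<^sup>2 + (l2norm g)\<^sup>2 - 2 * Re (l2inner f g)"
proof -
  have "l2inner f (\<lambda>t. (-1) * g t) = - l2inner f g"
    by (simp add: l2inner_def)
  thus ?thesis
    using l2norm_add_sq[OF assms(1) L2_cmult[OF assms(2), of "-1"]] l2norm_cmult[of "-1" g] by simp
qed

lemma l2norm_eq_0_iff:
  assumes "f \<in> L2 UNIV" shows "l2norm f = 0 \<longleftrightarrow> (AE t in lebesgue. f t = 0)"
  using integral_nonneg_eq_0_iff_AE[OF L2_integrable[OF assms]] by (simp add: l2norm_def)

lemma l2norm_cong_AE:
  assumes "f \<in> borel_measurable lebesgue" "g \<in> borel_measurable lebesgue" "AE t in lebesgue. f t = g t"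
  shows "l2norm f = l2norm g"
  unfolding l2norm_def using assms
  by (intro arg_cong[where f=sqrt] integral_cong_AE) (auto elim: eventually_mono)

lemma Cauchy_Schwarz_l2:
  assumes "f \<in> L2 UNIV" "g \<in> L2 UNIV"
  shows "cmod (l2inner f g) \<le> l2norm f * l2norm g"
proof (cases "l2norm g = 0")
  case True
  hence "AE t in lebesgue. f t * cnj (g t) = 0"
    using l2norm_eq_0_iff[OF assms(2)] by auto
  hence "l2inner f g = 0"
    unfolding l2inner_def by (rule integral_eq_zero_AE)
  thus ?thesis by simp
next
  case False
  define c where "c = l2inner f g / complex_of_real ((l2norm g)\<^sup>2)"
  have pos: "(l2norm g)\<^sup>2 > 0" using False by simp
  have "l2inner f (\<lambda>t. c * g t) = cnj c * l2inner f g"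
    by (subst l2inner_commute, simp add: l2inner_cmult_left, metis l2inner_commute)
  also have "\<dots> = complex_of_real ((cmod (l2inner f g))\<^sup>2 / (l2norm g)\<^sup>2)"
    using complex_norm_square[of "l2inner f g"] by (simp add: c_def mult.commute)
  finally have 1: "Re (l2inner f (\<lambda>t. c * g t)) = (cmod (l2inner f g))\<^sup>2 / (l2norm g)\<^sup>2"
    by (simp only: Re_complex_of_real)
  have "(l2norm (\<lambda>t. c * g t))\<^sup>2 = (cmod (l2inner f g))\<^sup>2 / (l2norm g)\<^sup>2"
  proof -
    have "cmod c = cmod (l2inner f g) / (l2norm g)\<^sup>2"
      by (simp add: c_def norm_divide norm_power)
    moreover have "(a / b\<^sup>2 * b)\<^sup>2 = a\<^sup>2 / b\<^sup>2" if "b \<noteq> 0" for a b :: real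
      using that by (simp add: power2_eq_square)
    ultimately show ?thesis unfolding l2norm_cmult using False by metis
  qed
  moreover have "0 \<le> (l2norm (\<lambda>t. f t - c * g t))\<^sup>2" by simp
  ultimately have "(cmod (l2inner f g))\<^sup>2 / (l2norm g)\<^sup>2 \<le> (l2norm f)\<^sup>2"
    using l2norm_diff_sq[OF assms(1) L2_cmult[OF assms(2), of c]] 1 by simp
  hence "(cmod (l2inner f g))\<^sup>2 \<le> (l2norm f * l2norm g)\<^sup>2"
    using pos by (simp add: divide_le_eq power_mult_distrib)
  thus ?thesis by (rule power2_le_imp_le) (intro mult_nonneg_nonneg l2norm_nonneg)
qed

lemma l2norm_triangle:
  assumes "f \<in> L2 UNIV" "g \<in> L2 UNIV"
  shows "l2norm (\<lambda>t. f t + g t) \<le> l2norm f + l2norm g"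
proof (rule power2_le_imp_le)
  have "Re (l2inner f g) \<le> l2norm f * l2norm g"
    by (rule order_trans[OF complex_Re_le_cmod Cauchy_Schwarz_l2[OF assms]])
  thus "(l2norm (\<lambda>t. f t + g t))\<^sup>2 \<le> (l2norm f + l2norm g)\<^sup>2"
    using l2norm_add_sq[OF assms] power2_sum[of "l2norm f" "l2norm g"] by linarith
  show "0 \<le> l2norm f + l2norm g" using l2norm_nonneg[of f] l2norm_nonneg[of g] by linarith
qed

lemma l2norm_diff_triangle:
  assumes "f \<in> L2 UNIV" "g \<in> L2 UNIV" "h \<in> L2 UNIV"
  shows "l2norm (\<lambda>t. f t - h t) \<le> l2norm (\<lambda>t. f t - g t) + l2norm (\<lambda>t. g t - h t)"
  using l2norm_triangle[OF L2_diff[OF assms(1,2)] L2_diff[OF assms(2,3)]] by simp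

lemma l2norm_minus_commute: "l2norm (\<lambda>t. f t - g t) = l2norm (\<lambda>t. g t - f t)"
  by (simp add: l2norm_def norm_minus_commute)

lemma l2norm_reverse_triangle:
  assumes "f \<in> L2 UNIV" "g \<in> L2 UNIV"
  shows "\<bar>l2norm f - l2norm g\<bar> \<le> l2norm (\<lambda>t. f t - g t)"
  using l2norm_triangle[OF L2_diff[OF assms] assms(2)] l2norm_triangle[OF L2_diff[OF assms(2,1)] assms(1)]
  by (simp add: l2norm_minus_commute[of f g])

lemma l2norm_mono:
  assumes "g \<in> L2 UNIV" and "f \<in> borel_measurable lebesgue" and "\<And>t. cmod (f t) \<le> cmod (g t)"
  shows "l2norm f \<le> l2norm g"
  unfolding l2norm_def
  by (intro real_sqrt_le_mono integral_mono L2_integrable[OF assms(1)] power_mono assms(3) norm_ge_zero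
     L2_integrable[OF L2_dominated[OF assms(1,2), of 1]]) (simp add: assms(3))

lemma nn_integral_l2norm:
  "f \<in> L2 UNIV \<Longrightarrow> (\<integral>\<^sup>+t. ennreal ((cmod (f t))\<^sup>2) \<partial>lebesgue) = ennreal ((l2norm f)\<^sup>2)"
  by (simp add: l2norm_sq nn_integral_eq_integral L2_integrable)

lemma L2_of_nn_integral_le:
  assumes [measurable]: "f \<in> borel_measurable lebesgue"
    and "(\<integral>\<^sup>+t. ennreal ((cmod (f t))\<^sup>2) \<partial>lebesgue) \<le> ennreal (c\<^sup>2)" "0 \<le> c"
  shows "f \<in> L2 UNIV" "l2norm f \<le> c"
proof -
  show "f \<in> L2 UNIV"
    using assms(2) by (intro L2_UNIV_I integrableI_bounded) (auto intro: le_less_trans)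
  hence "(l2norm f)\<^sup>2 \<le> c\<^sup>2"
    using assms(2) by (simp add: nn_integral_l2norm)
  thus "l2norm f \<le> c" using assms(3) by (rule power2_le_imp_le)
qed

text \<open>
  The bridge from the extended nonnegative integral, in which convergence is defined, to a real norm.
\<close>

lemma L2_tendsto_iff:
  assumes "\<And>k. f k \<in> L2 UNIV" "g \<in> L2 UNIV"
  shows "L2_tendsto f g \<longleftrightarrow> (\<lambda>k. l2norm (\<lambda>t. f k t - g t)) \<longlonglongrightarrow> 0"
proof -
  have "L2_tendsto f g \<longleftrightarrow> (\<lambda>k. ennreal ((l2norm (\<lambda>t. f k t - g t))\<^sup>2)) \<longlonglongrightarrow> ennreal 0"
    unfolding L2_tendsto_def using nn_integral_l2norm[OF L2_diff[OF assms]] by simp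
  also have "\<dots> \<longleftrightarrow> (\<lambda>k. (l2norm (\<lambda>t. f k t - g t))\<^sup>2) \<longlonglongrightarrow> 0"
    by (rule tendsto_ennreal_iff) auto
  also have "\<dots> \<longleftrightarrow> (\<lambda>k. l2norm (\<lambda>t. f k t - g t)) \<longlonglongrightarrow> 0"
    using tendsto_power[of "\<lambda>k. l2norm (\<lambda>t. f k t - g t)" 0 sequentially 2]
      tendsto_real_sqrt[of "\<lambda>k. (l2norm (\<lambda>t. f k t - g t))\<^sup>2" 0 sequentially] by auto
  finally show ?thesis .
qed

lemma l2inner_tendsto:
  assumes "\<And>k. f k \<in> L2 UNIV" "f' \<in> L2 UNIV" "g \<in> L2 UNIV"
    and "(\<lambda>k. l2norm (\<lambda>t. f k t - f' t)) \<longlonglongrightarrow> 0"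
  shows "(\<lambda>k. l2inner (f k) g) \<longlonglongrightarrow> l2inner f' g"
proof -
  have "(\<lambda>k. l2inner (f k) g - l2inner f' g) \<longlonglongrightarrow> 0"
  proof (rule Lim_null_comparison)
    show "(\<lambda>k. l2norm (\<lambda>t. f k t - f' t) * l2norm g) \<longlonglongrightarrow> 0"
      using tendsto_mult_right[OF assms(4), of "l2norm g"] by simp
    show "\<forall>\<^sub>F k in sequentially. norm (l2inner (f k) g - l2inner f' g) \<le> l2norm (\<lambda>t. f k t - f' t) * l2norm g"
      using Cauchy_Schwarz_l2[OF L2_diff[OF assms(1,2)] assms(3)]
      by (simp add: l2inner_diff_left[OF assms(1-3)])
  qed
  thus ?thesis by (simp add: LIM_zero_iff)
qed

lemma l2norm_tendsto:
  assumes "\<And>k. f k \<in> L2 UNIV" "f' \<in> L2 UNIV"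
    and "(\<lambda>k. l2norm (\<lambda>t. f k t - f' t)) \<longlonglongrightarrow> 0"
  shows "(\<lambda>k. l2norm (f k)) \<longlonglongrightarrow> l2norm f'"
proof -
  have "(\<lambda>k. l2norm (f k) - l2norm f') \<longlonglongrightarrow> 0"
    by (rule Lim_null_comparison[OF _ assms(3)])
      (use l2norm_reverse_triangle[OF assms(1,2)] in auto)
  thus ?thesis by (simp add: LIM_zero_iff)
qed

lemma l2norm_tendsto_dominated:
  fixes f :: "nat \<Rightarrow> real ^ 'n \<Rightarrow> complex"
  assumes [measurable]: "\<And>k. f k \<in> borel_measurable lebesgue" "g \<in> borel_measurable lebesgue"
    and w: "w \<in> L2 UNIV"
    and lim: "\<And>t. (\<lambda>k. f k t) \<longlonglongrightarrow> g t"
    and le: "\<And>k t. cmod (f k t - g t) \<le> cmod (w t)"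
  shows "(\<lambda>k. l2norm (\<lambda>t. f k t - g t)) \<longlonglongrightarrow> 0"
proof -
  have "(\<lambda>k. (l2norm (\<lambda>t. f k t - g t))\<^sup>2) \<longlonglongrightarrow> integral\<^sup>L lebesgue (\<lambda>t::real^'n. 0::real)"
    unfolding l2norm_sq
  proof (rule integral_dominated_convergence[OF _ _ L2_integrable[OF w]])
    show "AE t in lebesgue. (\<lambda>k. (cmod (f k t - g t))\<^sup>2) \<longlonglongrightarrow> 0"
    proof (rule AE_I2)
      fix t
      have "(\<lambda>k. (cmod (f k t - g t))\<^sup>2) \<longlonglongrightarrow> (cmod (g t - g t))\<^sup>2"
        by (intro tendsto_intros lim)
      thus "(\<lambda>k. (cmod (f k t - g t))\<^sup>2) \<longlonglongrightarrow> 0" by simp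
    qed
    show "AE t in lebesgue. norm ((cmod (f k t - g t))\<^sup>2) \<le> (cmod (w t))\<^sup>2" for k
      using le by (intro AE_I2) (simp add: power_mono)
  qed measurable
  hence "(\<lambda>k. sqrt ((l2norm (\<lambda>t. f k t - g t))\<^sup>2)) \<longlonglongrightarrow> sqrt 0"
    by (intro tendsto_real_sqrt) simp
  thus ?thesis by simp
qed

text \<open>
  A subsequence that is Cauchy at a geometric rate converges almost everywhere, and Fatou's lemma
  turns its pointwise limit into a limit in norm of the whole sequence.
\<close>

theorem Riesz_Fischer:
  fixes f :: "nat \<Rightarrow> real ^ 'n \<Rightarrow> complex"
  assumes f: "\<And>k. f k \<in> L2 UNIV"
    and Cauchy: "\<And>e. e > 0 \<Longrightarrow> \<exists>N. \<forall>i\<ge>N. \<forall>j\<ge>N. l2norm (\<lambda>t. f i t - f j t) < e"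
  obtains g where "g \<in> L2 UNIV" "(\<lambda>k. l2norm (\<lambda>t. f k t - g t)) \<longlonglongrightarrow> 0"
proof -
  note [measurable] = L2_measurable[OF f]
  obtain N where N: "\<And>k i j. i \<ge> N k \<Longrightarrow> j \<ge> N k \<Longrightarrow> l2norm (\<lambda>t. f i t - f j t) < (1/4)^k"
    using Cauchy[of "(1/4)^_"] by (metis zero_less_power zero_less_divide_1_iff zero_less_numeral)
  define r where "r = (\<lambda>k. k + (\<Sum>i\<le>k. N i))"
  have rN: "r j \<ge> N k" if "j \<ge> k" for j k
    using member_le_sum[of k "{..j}" N] that by (simp add: r_def)
  define d where "d = (\<lambda>k t. cmod (f (r (Suc k)) t - f (r k) t))"
  have d_meas [measurable]: "d k \<in> borel_measurable lebesgue" for k unfolding d_def by measurable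
  \<comment> \<open>The weights \<open>4^k\<close> still leave a convergent sum, and a bound on \<open>4^k (d\<^sub>k)\<^sup>2\<close> makes \<open>d\<^sub>k\<close>
    decay like \<open>2^-k\<close>, so that the increments are summable at almost every point.\<close>
  have int_d: "(\<integral>\<^sup>+t. ennreal (4^k * (d k t)\<^sup>2) \<partial>lebesgue) \<le> ennreal ((1/4)^k)" for k
  proof -
    have "(\<integral>\<^sup>+t. ennreal (4^k * (d k t)\<^sup>2) \<partial>lebesgue) = ennreal (4^k) * ennreal ((l2norm (\<lambda>t. f (r (Suc k)) t - f (r k) t))\<^sup>2)"
      by (subst nn_integral_l2norm[symmetric]) (auto simp: f ennreal_mult nn_integral_cmult d_def)
    also have "\<dots> \<le> ennreal (4^k) * ennreal (((1/4)^k)\<^sup>2)"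
      using N[of k "r (Suc k)" "r k"] rN[of k k] rN[of k "Suc k"]
      by (intro mult_left_mono ennreal_leI power_mono) auto
    also have "\<dots> = ennreal ((1/4)^k)"
      by (simp add: power2_eq_square power_divide flip: ennreal_mult)
    finally show ?thesis .
  qed
  have "(\<integral>\<^sup>+t. (\<Sum>k. ennreal (4^k * (d k t)\<^sup>2)) \<partial>lebesgue) = (\<Sum>k. \<integral>\<^sup>+t. ennreal (4^k * (d k t)\<^sup>2) \<partial>lebesgue)"
    by (rule nn_integral_suminf) simp
  also have "\<dots> \<le> (\<Sum>k. ennreal ((1/4)^k))"
    by (intro suminf_le int_d) auto
  also have "\<dots> = ennreal (\<Sum>k. (1/4)^k)"
    by (rule suminf_ennreal2) (auto intro: summable_geometric)
  also have "\<dots> < \<infinity>" by simp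
  finally have "AE t in lebesgue. (\<Sum>k. ennreal (4^k * (d k t)\<^sup>2)) \<noteq> \<infinity>"
    by (intro nn_integral_noteq_infinite) auto
  hence conv: "AE t in lebesgue. convergent (\<lambda>k. f (r k) t)"
  proof eventually_elim
    case (elim t)
    have "summable (\<lambda>k. 4^k * (d k t)\<^sup>2)"
      by (rule summable_suminf_not_top) (use elim in \<open>auto simp: top.not_eq_extremum\<close>)
    from summable_imp_Bseq[OF this] obtain C where C': "\<forall>k. norm (4^k * (d k t)\<^sup>2) \<le> C"
      by (auto simp: Bseq_def)
    have C: "4^k * (d k t)\<^sup>2 \<le> C" for k
      using C'[rule_format, of k] by simp
    have "d k t \<le> sqrt C * (1/2)^k" for k
    proof (rule power2_le_imp_le)
      have "C \<ge> 0" using order_trans[OF _ C[of 0]] by simp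
      have "(d k t)\<^sup>2 \<le> C / 4^k" using C[of k] by (simp add: field_simps)
      also have "\<dots> = (sqrt C * (1/2)^k)\<^sup>2"
      proof -
        have "((1/2::real)^k)\<^sup>2 = 1 / 4^k"
          by (simp add: power_divide flip: power_mult power_mult_distrib) (simp add: power_mult mult.commute[of k])
        thus ?thesis using \<open>C \<ge> 0\<close> by (simp only: power_mult_distrib real_sqrt_pow2 times_divide_eq_right mult_1_right)
      qed
      finally show "(d k t)\<^sup>2 \<le> (sqrt C * (1/2)^k)\<^sup>2" .
      show "0 \<le> sqrt C * (1/2)^k" using \<open>C \<ge> 0\<close> by simp
    qed
    hence "\<And>k. norm (f (r (Suc k)) t - f (r k) t) \<le> sqrt C * (1/2)^k"
      by (simp add: d_def)
    moreover have "summable (\<lambda>k. sqrt C * (1/2)^k)"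
      by (rule summable_mult, rule summable_geometric) simp
    ultimately have "summable (\<lambda>k. f (r (Suc k)) t - f (r k) t)"
      by (rule summable_comparison_test'[where N = 0, rotated])
    hence "convergent (\<lambda>n. \<Sum>k<n. f (r (Suc k)) t - f (r k) t)"
      by (simp only: summable_iff_convergent)
    hence "convergent (\<lambda>n. f (r n) t - f (r 0) t)"
      unfolding sum_lessThan_telescope[of "\<lambda>k. f (r k) t"] .
    thus "convergent (\<lambda>k. f (r k) t)"
      unfolding convergent_diff_const_right_iff .
  qed
  define g where "g = (\<lambda>t. lim (\<lambda>k. f (r k) t))"
  have [measurable]: "g \<in> borel_measurable lebesgue"
    unfolding g_def by measurable
  have bound: "(\<integral>\<^sup>+t. ennreal ((cmod (f i t - g t))\<^sup>2) \<partial>lebesgue) \<le> ennreal (((1/4)^k)\<^sup>2)" if "i \<ge> N k" for i k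
  proof -
    have "(\<integral>\<^sup>+t. ennreal ((cmod (f i t - g t))\<^sup>2) \<partial>lebesgue) = 
       (\<integral>\<^sup>+t. liminf (\<lambda>j. ennreal ((cmod (f i t - f (r j) t))\<^sup>2)) \<partial>lebesgue)"
    proof (rule nn_integral_cong_AE, use conv in eventually_elim)
      case (elim t)
      hence "(\<lambda>j. f (r j) t) \<longlonglongrightarrow> g t" by (simp add: g_def convergent_LIMSEQ_iff)
      hence "(\<lambda>j. ennreal ((cmod (f i t - f (r j) t))\<^sup>2)) \<longlonglongrightarrow> ennreal ((cmod (f i t - g t))\<^sup>2)"
        by (intro tendsto_intros)
      thus ?case by (rule lim_imp_Liminf[OF trivial_limit_sequentially, symmetric])
    qed
    also have "\<dots> \<le> liminf (\<lambda>j. \<integral>\<^sup>+t. ennreal ((cmod (f i t - f (r j) t))\<^sup>2) \<partial>lebesgue)"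
      by (rule nn_integral_liminf) simp
    also have "\<dots> \<le> liminf (\<lambda>j. ennreal (((1/4)^k)\<^sup>2))"
    proof (rule Liminf_mono, rule eventually_sequentiallyI)
      fix j assume "j \<ge> k"
      show "(\<integral>\<^sup>+t. ennreal ((cmod (f i t - f (r j) t))\<^sup>2) \<partial>lebesgue) \<le> ennreal (((1/4)^k)\<^sup>2)"
        using N[OF that rN[OF \<open>j \<ge> k\<close>]]
        by (subst nn_integral_l2norm) (auto intro!: f ennreal_leI power_mono)
    qed
    also have "\<dots> = ennreal (((1/4)^k)\<^sup>2)" by (simp add: Liminf_const)
    finally show ?thesis .
  qed
  have fg: "(\<lambda>t. f i t - g t) \<in> L2 UNIV" "l2norm (\<lambda>t. f i t - g t) \<le> (1/4)^k" if "i \<ge> N k" for i k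
    using L2_of_nn_integral_le[OF _ bound[OF that]] by auto
  have "(\<lambda>t. f (N 0) t - (f (N 0) t - g t)) \<in> L2 UNIV"
    by (rule L2_diff[OF f fg(1)[where k = 0]]) simp
  hence "g \<in> L2 UNIV" by simp
  moreover have "(\<lambda>k. l2norm (\<lambda>t. f k t - g t)) \<longlonglongrightarrow> 0"
  proof (rule LIMSEQ_I)
    fix e :: real assume "e > 0"
    then obtain k where k: "(1/4::real)^k < e"
      using real_arch_pow_inv[of e "1/4"] by auto
    thus "\<exists>no. \<forall>n\<ge>no. norm (l2norm (\<lambda>t. f n t - g t) - 0) < e"
      using fg(2)[of k] by (intro exI[of _ "N k"]) (force)
  qed
  ultimately show ?thesis by (rule that)
qed

section \<open>Translations and reflections of Lebesgue measure\<close>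

lemma sigma_finite_lebesgue: "sigma_finite_measure (lebesgue :: 'a::euclidean_space measure)"
proof
  obtain A :: "'a set set" where "countable A" "A \<subseteq> sets lborel" "\<Union>A = space lborel"
    "\<forall>a\<in>A. emeasure lborel a \<noteq> \<infinity>"
    using lborel.sigma_finite_countable by auto
  thus "\<exists>A::'a set set. countable A \<and> A \<subseteq> sets lebesgue \<and> \<Union>A = space lebesgue \<and> (\<forall>a\<in>A. emeasure lebesgue a \<noteq> \<infinity>)"
    by (intro exI[of _ A]) auto
qed

interpretation lebesgue: sigma_finite_measure "lebesgue :: 'a::euclidean_space measure"
  by (rule sigma_finite_lebesgue)

interpretation lebesgue_pair: pair_sigma_finite "lebesgue :: 'a::euclidean_space measure" "lebesgue :: 'b::euclidean_space measure"
  ..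

lemma borel_imp_lebesgue_measurable: "f \<in> borel_measurable borel \<Longrightarrow> f \<in> borel_measurable lebesgue"
  by (simp add: measurable_completion)

lemma fst_lebesgue_borel [measurable]:
  "fst \<in> borel_measurable ((lebesgue :: 'a::euclidean_space measure) \<Otimes>\<^sub>M N)"
  by (rule measurable_compose[OF measurable_fst]) (auto simp: measurable_completion)

lemma snd_lebesgue_borel [measurable]:
  "snd \<in> borel_measurable (N \<Otimes>\<^sub>M (lebesgue :: 'a::euclidean_space measure))"
  by (rule measurable_compose[OF measurable_snd]) (auto simp: measurable_completion)

lemma
  fixes t :: "'a::euclidean_space" and c :: real
  assumes "\<bar>c\<bar> = 1"
  shows lebesgue_isometry_measurable: "(\<lambda>x. t + c *\<^sub>R x) \<in> lebesgue \<rightarrow>\<^sub>M lebesgue"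
    and lebesgue_isometry: "distr lebesgue lebesgue (\<lambda>x. t + c *\<^sub>R x) = lebesgue"
proof -
  have eq: "(\<lambda>x. t + c *\<^sub>R x) = (\<lambda>x. t + (\<Sum>j\<in>Basis. (c * (x \<bullet> j)) *\<^sub>R j))"
    by (simp add: scaleR_sum_right[symmetric] euclidean_representation flip: scaleR_scaleR)
  have c: "\<And>j::'a. j \<in> Basis \<Longrightarrow> c \<noteq> 0" using assms by auto
  show "(\<lambda>x. t + c *\<^sub>R x) \<in> lebesgue \<rightarrow>\<^sub>M lebesgue"
    unfolding eq by (rule lebesgue_affine_measurable[of "\<lambda>_. c"]) (rule c)
  show "distr lebesgue lebesgue (\<lambda>x. t + c *\<^sub>R x) = lebesgue"
    using lebesgue_affine_euclidean[of "\<lambda>_. c" t, OF c] assms unfolding eq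
    by (simp add: density_1)
qed

lemma 
  fixes f :: "'a::euclidean_space \<Rightarrow> 'b::{banach,second_countable_topology}"
  assumes f: "f \<in> borel_measurable lebesgue"
  shows lebesgue_reflect_measurable: "(\<lambda>x. f (- x)) \<in> borel_measurable lebesgue"
    and lebesgue_integral_shift: "(\<integral>x. f (t + x) \<partial>lebesgue) = (\<integral>x. f x \<partial>lebesgue)"
    and lebesgue_integral_reflect: "(\<integral>x. f (- x) \<partial>lebesgue) = (\<integral>x. f x \<partial>lebesgue)"
    and lebesgue_integrable_shift: "integrable lebesgue (\<lambda>x. f (t + x)) = integrable lebesgue f"
    and lebesgue_integrable_reflect: "integrable lebesgue (\<lambda>x. f (- x)) = integrable lebesgue f"
proof -
  have 1: "\<bar>1::real\<bar> = 1" "\<bar>- 1::real\<bar> = 1" by simp_all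
  note m = lebesgue_isometry_measurable[OF 1(1), of t] lebesgue_isometry_measurable[OF 1(2), of "0::'a"]
  show "(\<lambda>x. f (- x)) \<in> borel_measurable lebesgue"
    using measurable_compose[OF m(2) f] by simp
  show "(\<integral>x. f (t + x) \<partial>lebesgue) = (\<integral>x. f x \<partial>lebesgue)" "(\<integral>x. f (- x) \<partial>lebesgue) = (\<integral>x. f x \<partial>lebesgue)"
    using integral_distr[OF m(1) f] integral_distr[OF m(2) f]
    unfolding lebesgue_isometry[OF 1(1)] lebesgue_isometry[OF 1(2)] by simp_all
  show "integrable lebesgue (\<lambda>x. f (t + x)) = integrable lebesgue f" "integrable lebesgue (\<lambda>x. f (- x)) = integrable lebesgue f"
    using integrable_distr_eq[OF m(1) f] integrable_distr_eq[OF m(2) f]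
    unfolding lebesgue_isometry[OF 1(1)] lebesgue_isometry[OF 1(2)] by simp_all
qed

text \<open>
  Enclose \<open>E\<close> in an open set \<open>U\<close> of little more measure. Most points of \<open>E\<close> have a ball of a common
  radius around them inside \<open>U\<close>, and a shorter translation moves these points within \<open>U\<close>.
\<close>

lemma translate_diff_small:
  fixes E :: "'a::euclidean_space set"
  assumes E: "E \<in> lmeasurable" and "e > 0"
  obtains d where "d > 0" "\<And>a. norm a < d \<Longrightarrow> measure lebesgue ((+) a ` E - E) < e"
proof -
  obtain U where U: "open U" "E \<subseteq> U" "U - E \<in> lmeasurable" "emeasure lebesgue (U - E) < ennreal (e/2)"
    using sets_lebesgue_outer_open[of E "e/2"] E \<open>e > 0\<close> by (auto simp: fmeasurable_def)
  have mU: "measure lebesgue (U - E) < e/2"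
    using U(4) \<open>e > 0\<close> by (simp add: emeasure_eq_measure2[OF U(3)] ennreal_less_iff)
  \<comment> \<open>The points that stay in \<open>U\<close> under every translation shorter than \<open>1 / (k + 1)\<close>; a closed set.\<close>
  define C where "C k = {x. ball x (1 / real (Suc k)) \<subseteq> U}" for k
  have "C k = - (\<Union>y\<in>-U. ball y (1 / real (Suc k)))" for k
    by (auto simp: C_def dist_commute)
  moreover have "closed (- (\<Union>y\<in>-U. ball y (1 / real (Suc k))))" for k
    by (intro closed_Compl open_UN ballI open_ball)
  ultimately have "closed (C k)" for k by metis
  hence C_sets: "C k \<in> sets lebesgue" for k by (simp add: borel_closed)
  have "(\<lambda>k. measure lebesgue (E - C k)) \<longlonglongrightarrow> measure lebesgue (\<Inter>k. E - C k)"
  proof (rule Lim_measure_decseq)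
    show "range (\<lambda>k. E - C k) \<subseteq> sets lebesgue"
      using C_sets E by (auto simp: fmeasurable_def)
    show "decseq (\<lambda>k. E - C k)"
    proof (intro decseq_SucI subsetI)
      fix k x assume x: "x \<in> E - C (Suc k)"
      have "ball x (1 / real (Suc (Suc k))) \<subseteq> ball x (1 / real (Suc k))"
        by (intro subset_ball) (simp add: field_simps)
      thus "x \<in> E - C k" using x by (auto simp: C_def)
    qed
    show "emeasure lebesgue (E - C k) \<noteq> \<infinity>" for k
      using fmeasurableD2[OF fmeasurable_Diff[OF E C_sets[of k]]] by simp
  qed
  moreover have "(\<Inter>k. E - C k) = {}"
  proof -
    have "\<exists>k. x \<in> C k" if x: "x \<in> E" for x
    proof -
      obtain r where r: "r > 0" "ball x r \<subseteq> U"
        using U x open_contains_ball by blast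
      then obtain k where "1 / real (Suc k) < r"
        using reals_Archimedean[of r] by (auto simp: inverse_eq_divide)
      thus ?thesis using r subset_ball[of "1 / real (Suc k)" r x] by (auto simp: C_def)
    qed
    thus ?thesis by auto
  qed
  ultimately have "(\<lambda>k. measure lebesgue (E - C k)) \<longlonglongrightarrow> 0" by (simp only: measure_empty)
  then obtain k where k: "measure lebesgue (E - C k) < e/2"
    using \<open>e > 0\<close> LIMSEQ_D[of _ 0 "e/2"] by fastforce
  show ?thesis
  proof (rule that)
    show "1 / real (Suc k) > 0" by simp
    fix a :: 'a assume a: "norm a < 1 / real (Suc k)"
    have EC: "E - C k \<in> lmeasurable" using E C_sets by (simp add: fmeasurable_Diff)
    have "(+) a ` E - E \<subseteq> (+) a ` (E - C k) \<union> (U - E)"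
    proof
      fix y assume y: "y \<in> (+) a ` E - E"
      then obtain x where x: "x \<in> E" "y = a + x" by auto
      have "y \<in> U" if "x \<in> C k"
        using that a x unfolding C_def by (auto simp: subset_iff dist_norm)
      thus "y \<in> (+) a ` (E - C k) \<union> (U - E)" using x y by auto
    qed
    hence "measure lebesgue ((+) a ` E - E) \<le> measure lebesgue ((+) a ` (E - C k) \<union> (U - E))"
      by (rule measure_mono_fmeasurable)
        (intro fmeasurableD fmeasurable.Diff fmeasurable.Un measurable_translation EC E U(3))+
    also have "\<dots> \<le> measure lebesgue ((+) a ` (E - C k)) + measure lebesgue (U - E)"
      by (intro measure_Un_le fmeasurableD measurable_translation EC U(3))
    also have "\<dots> < e" using k mU by (simp add: measure_translation)
    finally show "measure lebesgue ((+) a ` E - E) < e" .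
  qed
qed

text \<open>
  For indicators this is \<open>translate_diff_small\<close>, applied to \<open>a\<close> and to \<open>- a\<close>; translation preserves the
  norm, so the property passes to sums and to limits in \<open>L\<^sup>1\<close>.
\<close>

lemma L1_translation_continuous:
  fixes f :: "'a::euclidean_space \<Rightarrow> 'b::{banach,second_countable_topology}"
  assumes "integrable lebesgue f" and "e > 0"
  shows "\<exists>d>0. \<forall>a. norm a < d \<longrightarrow> (\<integral>x. norm (f (a + x) - f x) \<partial>lebesgue) < e"
  using assms
proof (induction f arbitrary: e rule: integrable_induct)
  case (base E c)
  have E: "E \<in> lmeasurable" using base by (auto simp: fmeasurable_def)
  define e' where "e' = e / (2 * (norm c + 1))"
  have pos: "norm c + 1 > 0" using norm_ge_zero[of c] by linarith
  hence "e' > 0" using base by (simp add: e'_def)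
  obtain d where d: "d > 0" "\<And>a. norm a < d \<Longrightarrow> measure lebesgue ((+) a ` E - E) < e'"
    using translate_diff_small[OF E \<open>e' > 0\<close>] by blast
  let ?D = "\<lambda>a x. norm (indicator E (a + x) *\<^sub>R c - indicator E x *\<^sub>R c)"
  have "(\<integral>x. ?D a x \<partial>lebesgue) < e" if a: "norm a < d" for a
  proof -
    define P where "P = (+) (-a) ` E - E"
    define Q where "Q = (+) a ` E - E"
    have inE: "(a + x \<in> E) = (x \<in> (+) (-a) ` E)" for x
      by (auto simp: image_iff) (metis add_minus_cancel uminus_add_conv_diff)
    have PQ: "P \<in> lmeasurable" "Q \<in> lmeasurable"
      unfolding P_def Q_def by (intro fmeasurable.Diff measurable_translation E)+
    define R where "R = (+) (-a) ` Q"
    have R: "R \<in> lmeasurable" "measure lebesgue R = measure lebesgue Q"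
      unfolding R_def by (rule measurable_translation[OF PQ(2)], rule measure_translation)
    have inP: "x \<in> P \<longleftrightarrow> a + x \<in> E \<and> x \<notin> E" for x
      by (simp add: P_def inE)
    have inQ: "x \<in> R \<longleftrightarrow> x \<in> E \<and> a + x \<notin> E" for x
    proof -
      have "x \<in> R \<longleftrightarrow> a + x \<in> Q"
        by (force simp: image_iff R_def)
      also have "\<dots> \<longleftrightarrow> x \<in> E \<and> a + x \<notin> E"
        by (auto simp: Q_def)
      finally show ?thesis .
    qed
    have "indicator E (a + x) *\<^sub>R c - indicator E x *\<^sub>R c
       = (indicator P x - indicator (R) x) *\<^sub>R c" for x
      unfolding indicator_def inP inQ by auto
    hence "?D a x
       \<le> (indicator P x + indicator (R) x) * norm c" for x
      by (auto simp: indicator_def)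
    hence "(\<integral>x. ?D a x \<partial>lebesgue) \<le> 
       (\<integral>x. (indicator P x + indicator (R) x) * norm c \<partial>lebesgue)"
      using PQ R by (intro integral_mono') (auto simp: fmeasurable_def intro!: integrable_real_indicator)
    also have "\<dots> = (measure lebesgue P + measure lebesgue Q) * norm c"
    proof -
      have "integrable lebesgue (indicat_real P)" "integrable lebesgue (indicat_real R)"
        using PQ(1) R(1) by (auto simp: fmeasurable_def intro!: integrable_real_indicator)
      thus ?thesis
        unfolding integral_mult_left_zero by (subst Bochner_Integration.integral_add) (simp_all add: R(2))
    qed
    also have "\<dots> \<le> (e' + e') * norm c"
      using d(2)[of a] d(2)[of "-a"] a by (intro mult_right_mono) (auto simp: P_def Q_def)
    also have "\<dots> < e"
    proof -
      have "e' + e' = e / (norm c + 1)" 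
        unfolding e'_def using pos by (cases "norm c + 1 = 0") (simp_all add: divide_simps)
      moreover have "e * norm c < e * (norm c + 1)" using base by simp
      ultimately show ?thesis using pos by (simp add: divide_less_eq)
    qed
    finally show ?thesis .
  qed
  with d(1) show ?case by blast
next
  case (add f g)
  obtain d1 where d1: "d1 > 0" "\<And>a. norm a < d1 \<Longrightarrow> (\<integral>x. norm (f (a + x) - f x) \<partial>lebesgue) < e/2"
    using add.IH(1)[of "e/2"] add.prems by auto
  obtain d2 where d2: "d2 > 0" "\<And>a. norm a < d2 \<Longrightarrow> (\<integral>x. norm (g (a + x) - g x) \<partial>lebesgue) < e/2"
    using add.IH(2)[of "e/2"] add.prems by auto
  note [measurable] = borel_measurable_integrable[OF add.hyps(1)] borel_measurable_integrable[OF add.hyps(2)]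
  have i: "integrable lebesgue (\<lambda>x. f (a + x))" "integrable lebesgue (\<lambda>x. g (a + x))" for a
    using add.hyps by (simp_all add: lebesgue_integrable_shift)
  have "(\<integral>x. norm (f (a + x) + g (a + x) - (f x + g x)) \<partial>lebesgue) < e" if "norm a < min d1 d2" for a
  proof -
    have "(\<integral>x. norm (f (a + x) + g (a + x) - (f x + g x)) \<partial>lebesgue)
        \<le> (\<integral>x. norm (f (a + x) - f x) + norm (g (a + x) - g x) \<partial>lebesgue)"
      using i add.hyps by (intro integral_mono) (auto simp: add_diff_add intro: norm_triangle_ineq)
    also have "\<dots> = (\<integral>x. norm (f (a + x) - f x) \<partial>lebesgue) + (\<integral>x. norm (g (a + x) - g x) \<partial>lebesgue)"
      using i add.hyps by (intro Bochner_Integration.integral_add) auto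
    also have "\<dots> < e" using d1(2)[of a] d2(2)[of a] that by auto
    finally show ?thesis .
  qed
  thus ?case using d1(1) d2(1) by (intro exI[of _ "min d1 d2"]) auto
next
  case (lim f s)
  note [measurable] = borel_measurable_integrable[OF lim.hyps(1)] borel_measurable_integrable[OF lim.hyps(4)]
  have "(\<lambda>i. \<integral>x. norm (s i x - f x) \<partial>lebesgue) \<longlonglongrightarrow> integral\<^sup>L lebesgue (\<lambda>x::'a. 0::real)"
  proof (rule integral_dominated_convergence[where w = "\<lambda>x. 3 * norm (f x)"])
    show "AE x in lebesgue. (\<lambda>i. norm (s i x - f x)) \<longlonglongrightarrow> 0"
      using lim.hyps(2) by (auto intro!: tendsto_norm_zero simp: LIM_zero_iff)
    show "AE x in lebesgue. norm (norm (s i x - f x)) \<le> 3 * norm (f x)" for i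
    proof (rule AE_I2)
      fix x :: 'a
      have "norm (s i x - f x) \<le> 2 * norm (f x) + norm (f x)"
        by (rule order_trans[OF norm_triangle_ineq4 add_right_mono[OF lim.hyps(3)]]) simp
      thus "norm (norm (s i x - f x)) \<le> 3 * norm (f x)" by simp
    qed
  qed (use lim.hyps in auto)
  then obtain i where i: "(\<integral>x. norm (s i x - f x) \<partial>lebesgue) < e/3"
    using lim.prems LIMSEQ_D[of _ 0 "e/3"] by fastforce
  obtain d where d: "d > 0" "\<And>a. norm a < d \<Longrightarrow> (\<integral>x. norm (s i (a + x) - s i x) \<partial>lebesgue) < e/3"
    using lim.IH[of "e/3" i] lim.prems by auto
  have si: "integrable lebesgue (\<lambda>x. f (a + x))" "integrable lebesgue (\<lambda>x. s i (a + x))" for a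
    using lim.hyps by (simp_all add: lebesgue_integrable_shift)
  have "(\<integral>x. norm (f (a + x) - f x) \<partial>lebesgue) < e" if "norm a < d" for a
  proof -
    have "(\<integral>x. norm (f (a + x) - f x) \<partial>lebesgue)
       \<le> (\<integral>x. norm (s i (a + x) - f (a + x)) + norm (s i (a + x) - s i x) + norm (s i x - f x) \<partial>lebesgue)"
    proof (rule integral_mono)
      show "norm (f (a + x) - f x) \<le> norm (s i (a + x) - f (a + x)) + norm (s i (a + x) - s i x) + norm (s i x - f x)" for x
        using norm_triangle_ineq[of "f (a + x) - s i (a + x)" "s i (a + x) - f x"]
          norm_triangle_ineq[of "s i (a + x) - s i x" "s i x - f x"] by (simp add: norm_minus_commute)
    qed (use si lim.hyps in auto)
    also have "\<dots> = (\<integral>x. norm (s i (a + x) - f (a + x)) \<partial>lebesgue) + (\<integral>x. norm (s i (a + x) - s i x) \<partial>lebesgue) + (\<integral>x. norm (s i x - f x) \<partial>lebesgue)"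
      using si lim.hyps by simp
    also have "(\<integral>x. norm (s i (a + x) - f (a + x)) \<partial>lebesgue) = (\<integral>x. norm (s i x - f x) \<partial>lebesgue)"
      by (rule lebesgue_integral_shift[of "\<lambda>x. norm (s i x - f x)"]) measurable
    finally show ?thesis using d(2)[OF that] i by simp
  qed
  with d(1) show ?case by blast
qed

section \<open>The Fourier transform of integrable functions and of Gaussians\<close>

lemma gaussian_char_1d:
  "(\<integral>x. cis (t * x) * exp (- x\<^sup>2 / 2) \<partial>lborel) = complex_of_real (sqrt (2 * pi) * exp (- t\<^sup>2 / 2))"
  "integrable lborel (\<lambda>x::real. cis (t * x) * exp (- x\<^sup>2 / 2))"
proof -
  have "integrable lborel std_normal_density"
    by simp
  hence "integrable lborel (\<lambda>x::real. sqrt (2 * pi) * std_normal_density x)" by (rule integrable_mult_right)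
  hence i: "integrable lborel (\<lambda>x::real. exp (- x\<^sup>2 / 2))"
    by (simp add: std_normal_density_def)
  thus int: "integrable lborel (\<lambda>x::real. cis (t * x) * exp (- x\<^sup>2 / 2))"
    by (rule Bochner_Integration.integrable_bound) (auto simp: norm_mult cis_conv_exp)
  have "complex_of_real (exp (- (t^2) / 2)) = char std_normal_distribution t"
    by (simp add: char_std_normal_distribution)
  also have "\<dots> = (\<integral>x. std_normal_density x *\<^sub>R iexp (t * x) \<partial>lborel)"
    unfolding char_def by (subst integral_density) (auto simp: normal_density_nonneg)
  also have "\<dots> = (\<integral>x. (cis (t * x) * exp (- x\<^sup>2 / 2)) * complex_of_real (1 / sqrt (2 * pi)) \<partial>lborel)"
    by (intro Bochner_Integration.integral_cong refl)
       (simp add: std_normal_density_def cis_conv_exp scaleR_conv_of_real mult_ac)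
  also have "\<dots> = (\<integral>x. (cis (t * x) * exp (- x\<^sup>2 / 2)) \<partial>lborel) * complex_of_real (1 / sqrt (2 * pi))"
    by (rule integral_mult_left_zero)
  finally show "(\<integral>x. cis (t * x) * exp (- x\<^sup>2 / 2) \<partial>lborel) = complex_of_real (sqrt (2 * pi) * exp (- t\<^sup>2 / 2))"
    by (simp add: field_simps)
qed

lemma prod_cis: "finite I \<Longrightarrow> (\<Prod>i\<in>I. cis (f i)) = cis (\<Sum>i\<in>I. f i)"
  by (induction I rule: finite_induct) (auto simp: cis_mult)

lemma gaussian_char:
  fixes t :: "'a::euclidean_space"
  shows "(\<integral>x. cis (t \<bullet> x) * exp (- (norm x)\<^sup>2 / 2) \<partial>lborel) = complex_of_real (sqrt (2 * pi) ^ DIM('a) * exp (- (norm t)\<^sup>2 / 2))"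
    and "integrable lborel (\<lambda>x. cis (t \<bullet> x) * exp (- (norm x)\<^sup>2 / 2))"
proof -
  interpret product_sigma_finite "\<lambda>_::'a. lborel :: real measure" ..
  let ?T = "\<lambda>f. \<Sum>b\<in>Basis. f b *\<^sub>R (b::'a)"
  let ?h = "\<lambda>b x. cis (t \<bullet> b * x) * exp (- x\<^sup>2 / 2)"
  have T [measurable]: "?T \<in> borel_measurable (\<Pi>\<^sub>M b\<in>Basis. lborel)" by measurable
  have eq: "cis (t \<bullet> ?T f) * exp (- (norm (?T f))\<^sup>2 / 2) = (\<Prod>b\<in>Basis. ?h b (f b))" for f
  proof -
    have "t \<bullet> ?T f = (\<Sum>b\<in>Basis. t \<bullet> b * f b)"
      by (simp add: inner_sum_right mult.commute)
    moreover have "(norm (?T f))\<^sup>2 = (\<Sum>b\<in>Basis. (f b)\<^sup>2)"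
      unfolding power2_norm_eq_inner by (subst euclidean_inner) (simp add: power2_eq_square)
    moreover have "complex_of_real (exp (- (\<Sum>b\<in>(Basis::'a set). (f b)\<^sup>2) / 2)) = (\<Prod>b\<in>(Basis::'a set). complex_of_real (exp (- (f b)\<^sup>2 / 2)))"
      by (simp add: exp_sum[symmetric] sum_negf sum_divide_distrib flip: of_real_prod)
    ultimately show ?thesis by (simp add: prod_cis prod.distrib)
  qed
  have m: "(\<lambda>x. cis (t \<bullet> x) * exp (- (norm x)\<^sup>2 / 2)) \<in> borel_measurable (borel :: 'a measure)"
    by (intro borel_measurable_continuous_onI) (auto simp: cis_conv_exp intro!: continuous_intros)
  have "(\<integral>x. cis (t \<bullet> x) * exp (- (norm x)\<^sup>2 / 2) \<partial>lborel) = (\<integral>f. (\<Prod>b\<in>Basis. ?h b (f b)) \<partial>(\<Pi>\<^sub>M b\<in>Basis. lborel))"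
    by (subst lborel_eq, subst integral_distr[OF T m]) (simp only: eq)
  also have "\<dots> = (\<Prod>b\<in>Basis. \<integral>x. ?h b x \<partial>lborel)"
    by (rule product_integral_prod[OF finite_Basis gaussian_char_1d(2)])
  also have "\<dots> = (\<Prod>b\<in>Basis. complex_of_real (sqrt (2 * pi) * exp (- (t \<bullet> b)\<^sup>2 / 2)))"
    by (simp only: gaussian_char_1d)
  also have "\<dots> = complex_of_real (sqrt (2 * pi) ^ DIM('a) * (\<Prod>b\<in>Basis. exp (- (t \<bullet> b)\<^sup>2 / 2)))"
    by (simp add: prod.distrib)
  also have "(\<Prod>b\<in>Basis. exp (- (t \<bullet> b)\<^sup>2 / 2)) = exp (- (norm t)\<^sup>2 / 2)"
    unfolding power2_norm_eq_inner by (subst euclidean_inner) (simp add: exp_sum[symmetric] sum_negf sum_divide_distrib power2_eq_square)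
  finally show "(\<integral>x. cis (t \<bullet> x) * exp (- (norm x)\<^sup>2 / 2) \<partial>lborel) = complex_of_real (sqrt (2 * pi) ^ DIM('a) * exp (- (norm t)\<^sup>2 / 2))" .
  show "integrable lborel (\<lambda>x. cis (t \<bullet> x) * exp (- (norm x)\<^sup>2 / 2))"
    by (subst lborel_eq, subst integrable_distr_eq[OF T m], simp only: eq, rule product_integrable_prod[OF finite_Basis gaussian_char_1d(2)])
qed

lemma fourier_L1_cis: "fourier_L1 f \<xi> = (\<integral>t. cis (- (2 * pi * (\<xi> \<bullet> t))) * f t \<partial>lebesgue)"
  unfolding fourier_L1_def cis_conv_exp
  by (intro Bochner_Integration.integral_cong refl) (simp add: mult_ac)

lemma cis_measurable [measurable]: "cis \<in> borel_measurable borel"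
  unfolding cis_conv_exp[abs_def] by (intro borel_measurable_continuous_onI continuous_intros)

lemma cis_mult_integrable:
  fixes f :: "'a::euclidean_space \<Rightarrow> complex"
  assumes "integrable lebesgue f" "h \<in> borel_measurable borel"
  shows "integrable lebesgue (\<lambda>t. cis (h t) * f t)"
proof (rule Bochner_Integration.integrable_bound[OF assms(1)])
  note [measurable] = borel_measurable_integrable[OF assms(1)] borel_imp_lebesgue_measurable[OF assms(2)]
  show "(\<lambda>t. cis (h t) * f t) \<in> borel_measurable lebesgue" by measurable
qed (simp add: norm_mult)

lemma fourier_L1_integrable: "integrable lebesgue f \<Longrightarrow> integrable lebesgue (\<lambda>t. cis (- (2 * pi * (\<xi> \<bullet> t))) * f t)"
  by (rule cis_mult_integrable) auto

lemma fourier_L1_add: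
  "integrable lebesgue f \<Longrightarrow> integrable lebesgue g \<Longrightarrow>
   fourier_L1 (\<lambda>t. f t + g t) \<xi> = fourier_L1 f \<xi> + fourier_L1 g \<xi>"
  by (simp add: fourier_L1_cis ring_distribs fourier_L1_integrable)

lemma fourier_L1_diff:
  "integrable lebesgue f \<Longrightarrow> integrable lebesgue g \<Longrightarrow>
   fourier_L1 (\<lambda>t. f t - g t) \<xi> = fourier_L1 f \<xi> - fourier_L1 g \<xi>"
  by (simp add: fourier_L1_cis ring_distribs fourier_L1_integrable)

lemma fourier_L1_cmult: "fourier_L1 (\<lambda>t. c * f t) \<xi> = c * fourier_L1 f \<xi>"
  by (simp add: fourier_L1_cis mult.left_commute)

lemma fourier_L1_sum:
  "(\<And>i. i \<in> I \<Longrightarrow> integrable lebesgue (f i)) \<Longrightarrow>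
   fourier_L1 (\<lambda>t. \<Sum>i\<in>I. f i t) \<xi> = (\<Sum>i\<in>I. fourier_L1 (f i) \<xi>)"
  by (simp add: fourier_L1_cis sum_distrib_left Bochner_Integration.integral_sum fourier_L1_integrable)

lemma fourier_L1_cnj: "fourier_L1 (\<lambda>t. cnj (f t)) \<xi> = cnj (fourier_L1 f (- \<xi>))"
  unfolding fourier_L1_cis Bochner_Integration.integral_cnj[symmetric] by (simp add: cis_cnj)

lemma fourier_L1_modulate:
  "fourier_L1 (\<lambda>t. cis (- (2 * pi * (a \<bullet> t))) * f t) \<xi> = fourier_L1 f (\<xi> + a)"
  unfolding fourier_L1_cis
proof (intro Bochner_Integration.integral_cong refl)
  fix t
  have "- (2 * pi * (\<xi> \<bullet> t)) + - (2 * pi * (a \<bullet> t)) = - (2 * pi * ((\<xi> + a) \<bullet> t))"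
    by (simp add: inner_add_left distrib_left)
  thus "cis (- (2 * pi * (\<xi> \<bullet> t))) * (cis (- (2 * pi * (a \<bullet> t))) * f t) = cis (- (2 * pi * ((\<xi> + a) \<bullet> t))) * f t"
    by (simp only: mult.assoc[symmetric] cis_mult)
qed

lemma fourier_L1_cong_AE:
  assumes "f \<in> borel_measurable lebesgue" "g \<in> borel_measurable lebesgue" "AE t in lebesgue. f t = g t"
  shows "fourier_L1 f \<xi> = fourier_L1 g \<xi>"
  unfolding fourier_L1_cis
proof (rule integral_cong_AE)
  have [measurable]: "(\<lambda>t. cis (- (2 * pi * (\<xi> \<bullet> t)))) \<in> borel_measurable lebesgue"
    by (rule borel_imp_lebesgue_measurable) measurable
  note [measurable] = assms(1,2)
  show "(\<lambda>t. cis (- (2 * pi * (\<xi> \<bullet> t))) * f t) \<in> borel_measurable lebesgue"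
    "(\<lambda>t. cis (- (2 * pi * (\<xi> \<bullet> t))) * g t) \<in> borel_measurable lebesgue" by measurable
qed (use assms(3) in auto)

lemma fourier_L1_bound: 
  "cmod (fourier_L1 f \<xi>) \<le> (\<integral>t. cmod (f t) \<partial>lebesgue)"
  unfolding fourier_L1_cis
  by (rule order_trans[OF integral_norm_bound]) (simp add: norm_mult)

lemma fourier_L1_continuous:
  fixes f :: "real ^ 'n \<Rightarrow> complex"
  assumes "integrable lebesgue f" shows "continuous_on UNIV (fourier_L1 f)"
  unfolding continuous_on_sequentially
proof (intro allI ballI impI)
  fix X :: "nat \<Rightarrow> real ^ 'n" and a assume "(\<forall>n. X n \<in> UNIV) \<and> X \<longlonglongrightarrow> a"
  hence X: "X \<longlonglongrightarrow> a" by simp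
  note [measurable] = borel_measurable_integrable[OF assms]
  show "(fourier_L1 f \<circ> X) \<longlonglongrightarrow> fourier_L1 f a"
    unfolding comp_def fourier_L1_cis
  proof (rule integral_dominated_convergence[where w = "\<lambda>t. cmod (f t)"])
    show "AE t in lebesgue. (\<lambda>i. cis (- (2 * pi * (X i \<bullet> t))) * f t) \<longlonglongrightarrow> cis (- (2 * pi * (a \<bullet> t))) * f t"
      unfolding cis_conv_exp using X by (intro AE_I2 tendsto_intros)
  qed (use assms in \<open>auto simp: norm_mult intro!: borel_measurable_integrable[OF fourier_L1_integrable]\<close>)
qed

lemma fourier_L1_measurable_borel: "integrable lebesgue f \<Longrightarrow> fourier_L1 f \<in> borel_measurable borel"
  by (intro borel_measurable_continuous_onI fourier_L1_continuous)

lemma fourier_L1_measurable: "integrable lebesgue f \<Longrightarrow> fourier_L1 f \<in> borel_measurable lebesgue"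
  by (intro borel_imp_lebesgue_measurable fourier_L1_measurable_borel)

lemma bounded_mult_integrable:
  fixes f g :: "'a \<Rightarrow> complex"
  assumes "integrable M f" "g \<in> borel_measurable M" "\<And>x. cmod (g x) \<le> C"
  shows "integrable M (\<lambda>x. g x * f x)" "integrable M (\<lambda>x. f x * g x)"
proof -
  note [measurable] = borel_measurable_integrable[OF assms(1)] assms(2)
  show "integrable M (\<lambda>x. g x * f x)"
  proof (rule Bochner_Integration.integrable_bound)
    show "integrable M (\<lambda>x. complex_of_real C * f x)" using assms(1) by simp
    show "AE x in M. norm (g x * f x) \<le> norm (complex_of_real C * f x)"
      using order_trans[OF assms(3) abs_ge_self] by (intro AE_I2) (simp add: norm_mult mult_right_mono)
  qed measurable
  thus "integrable M (\<lambda>x. f x * g x)" by (simp add: mult.commute)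
qed

text \<open>
  Fubini's theorem, the source of every duality argument below.
\<close>

lemma fourier_L1_multiplication_formula:
  assumes f: "integrable lebesgue f" and g: "integrable lebesgue g"
  shows "(\<integral>\<xi>. fourier_L1 f \<xi> * g \<xi> \<partial>lebesgue) = (\<integral>t. f t * fourier_L1 g t \<partial>lebesgue)"
proof -
  note [measurable] = borel_measurable_integrable[OF f] borel_measurable_integrable[OF g]
  let ?F = "\<lambda>\<xi> t. cis (- (2 * pi * (\<xi> \<bullet> t))) * f t * g \<xi>"
  have "integrable (lebesgue \<Otimes>\<^sub>M lebesgue) (\<lambda>(\<xi>, t). g \<xi> * f t)"
    using lebesgue_pair.Fubini_integrable[of "\<lambda>(\<xi>, t). g \<xi> * f t"] f g by (simp add: norm_mult)
  hence int: "integrable (lebesgue \<Otimes>\<^sub>M lebesgue) (case_prod ?F)"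
    by (rule Bochner_Integration.integrable_bound)
       (auto simp: norm_mult split_beta split: prod.splits)
  have "(\<integral>\<xi>. fourier_L1 f \<xi> * g \<xi> \<partial>lebesgue) = (\<integral>\<xi>. (\<integral>t. ?F \<xi> t \<partial>lebesgue) \<partial>lebesgue)"
    by (simp add: fourier_L1_cis)
  also have "\<dots> = (\<integral>t. (\<integral>\<xi>. ?F \<xi> t \<partial>lebesgue) \<partial>lebesgue)"
    by (rule lebesgue_pair.Fubini_integral[OF int, symmetric])
  also have "\<dots> = (\<integral>t. f t * fourier_L1 g t \<partial>lebesgue)"
    unfolding fourier_L1_cis integral_mult_right_zero[symmetric]
    by (intro Bochner_Integration.integral_cong refl) (simp add: inner_commute mult_ac)
  finally show ?thesis .
qed

text \<open>
  The probability density of the centred normal distribution on \<open>\<real>\<^sup>n\<close> whose coordinates are independent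
  with standard deviation \<open>1 / r\<close>; it concentrates at 0 as \<open>r\<close> grows.
\<close>

definition gauss_kernel :: "real \<Rightarrow> real ^ 'n \<Rightarrow> real" where
  "gauss_kernel r u = (r / sqrt (2 * pi)) ^ CARD('n) * exp (- (r * norm u)\<^sup>2 / 2)"

lemma gauss_kernel_nonneg: "r \<ge> 0 \<Longrightarrow> 0 \<le> gauss_kernel r u"
  by (simp add: gauss_kernel_def)

lemma gauss_kernel_measurable [measurable]: "gauss_kernel r \<in> borel_measurable borel"
  unfolding gauss_kernel_def[abs_def] by (intro borel_measurable_continuous_onI continuous_intros) auto

lemma gauss_kernel_minus: "gauss_kernel r (- u) = gauss_kernel r u"
  by (simp add: gauss_kernel_def)

lemma lborel_scale:
  fixes f :: "'a::euclidean_space \<Rightarrow> 'b::{banach,second_countable_topology}"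
  assumes "f \<in> borel_measurable borel" "c > 0"
  shows "integrable lborel f \<longleftrightarrow> integrable lborel (\<lambda>x. f (c *\<^sub>R x))"
    and "(\<integral>x. f x \<partial>lborel) = c ^ DIM('a) *\<^sub>R (\<integral>x. f (c *\<^sub>R x) \<partial>lborel)"
proof -
  have lb: "lborel = density (distr lborel borel (\<lambda>x::'a. 0 + c *\<^sub>R x)) (\<lambda>_. ennreal (\<bar>c\<bar>^DIM('a)))"
    using assms(2) by (intro lborel_affine) simp
  show "integrable lborel f \<longleftrightarrow> integrable lborel (\<lambda>x. f (c *\<^sub>R x))"
  proof -
    have "integrable lborel f \<longleftrightarrow> integrable lborel (\<lambda>x. c ^ DIM('a) *\<^sub>R f (c *\<^sub>R x))"
      using assms by (subst lb) (simp add: integrable_density integrable_distr_eq)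
    moreover have "integrable lborel (\<lambda>x. c ^ DIM('a) *\<^sub>R g x) \<longleftrightarrow> integrable lborel g"
      for g :: "'a \<Rightarrow> 'b"
    proof
      assume "integrable lborel (\<lambda>x. c ^ DIM('a) *\<^sub>R g x)"
      hence "integrable lborel (\<lambda>x. (1 / c ^ DIM('a)) *\<^sub>R c ^ DIM('a) *\<^sub>R g x)"
        by (rule integrable_scaleR_right)
      thus "integrable lborel g" using assms(2) by simp
    qed (rule integrable_scaleR_right)
    ultimately show ?thesis by simp
  qed
  show "(\<integral>x. f x \<partial>lborel) = c ^ DIM('a) *\<^sub>R (\<integral>x. f (c *\<^sub>R x) \<partial>lborel)"
    using assms by (subst lb) (simp add: integral_density integral_distr)
qed

lemma gauss_kernel_fourier:
  fixes u :: "real ^ 'n"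
  assumes "\<epsilon> > 0"
  shows "integrable lebesgue (\<lambda>\<xi>::real^'n. complex_of_real (exp (- (\<epsilon> * norm \<xi>)\<^sup>2 / 2)))"
    and "fourier_L1 (\<lambda>\<xi>. complex_of_real (exp (- (\<epsilon> * norm \<xi>)\<^sup>2 / 2))) u = gauss_kernel (2 * pi / \<epsilon>) u"
proof -
  define t where "t = (- (2 * pi / \<epsilon>)) *\<^sub>R u"
  let ?f = "\<lambda>t x. cis (t \<bullet> x) * complex_of_real (exp (- (norm x)\<^sup>2 / 2))"
  have f [measurable]: "?f t \<in> borel_measurable borel" for t :: "real ^ 'n" by measurable
  have scale: "?f t (\<epsilon> *\<^sub>R x) = cis (\<epsilon> * (t \<bullet> x)) * complex_of_real (exp (- (\<epsilon> * norm x)\<^sup>2 / 2))" for x t :: "real ^ 'n"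
    using assms by simp
  have "integrable lborel (\<lambda>x::real^'n. ?f 0 (\<epsilon> *\<^sub>R x))"
    by (rule lborel_scale(1)[OF f assms, THEN iffD1, OF gaussian_char(2)])
  thus "integrable lebesgue (\<lambda>\<xi>::real^'n. complex_of_real (exp (- (\<epsilon> * norm \<xi>)\<^sup>2 / 2)))"
    unfolding scale by (subst integrable_completion) auto
  have "fourier_L1 (\<lambda>\<xi>. complex_of_real (exp (- (\<epsilon> * norm \<xi>)\<^sup>2 / 2))) u 
     = (\<integral>x. ?f t (\<epsilon> *\<^sub>R x) \<partial>lborel)"
    unfolding fourier_L1_cis scale using assms by (subst integral_completion) (simp_all add: t_def)
  also have "\<dots> = complex_of_real (1 / \<epsilon> ^ CARD('n)) * (\<integral>x. ?f t x \<partial>lborel)"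
    using lborel_scale(2)[OF f assms, of t] assms
    by (simp add: scaleR_conv_of_real field_simps)
  also have "\<dots> = gauss_kernel (2 * pi / \<epsilon>) u"
  proof -
    have "2 * pi / \<epsilon> / sqrt (2 * pi) = sqrt (2 * pi) / \<epsilon>"
      using assms by (simp add: field_simps)
    thus ?thesis
      unfolding gaussian_char(1) gauss_kernel_def of_real_mult[symmetric]
      by (simp add: t_def power_mult_distrib power_divide)
  qed
  finally show "fourier_L1 (\<lambda>\<xi>. complex_of_real (exp (- (\<epsilon> * norm \<xi>)\<^sup>2 / 2))) u = gauss_kernel (2 * pi / \<epsilon>) u" .
qed

lemma gauss_kernel_integral:
  assumes "r > 0"
  shows "integrable lebesgue (gauss_kernel r :: real^'n \<Rightarrow> real)"
    and "integral\<^sup>L lebesgue (gauss_kernel r :: real^'n \<Rightarrow> real) = 1"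
proof -
  have i: "integrable lebesgue (\<lambda>\<xi>::real^'n. complex_of_real (exp (- (r * norm \<xi>)\<^sup>2 / 2)))"
    using assms by (rule gauss_kernel_fourier)
  have i': "integrable lebesgue (\<lambda>\<xi>::real^'n. (exp (- (r * norm \<xi>)\<^sup>2 / 2)))"
    using i by (subst (asm) complex_of_real_integrable_eq)
  thus "integrable lebesgue (gauss_kernel r :: real^'n \<Rightarrow> real)"
    unfolding gauss_kernel_def by (rule integrable_mult_right)
  have "complex_of_real (integral\<^sup>L lebesgue (\<lambda>\<xi>::real^'n. exp (- (r * norm \<xi>)\<^sup>2 / 2))) = 
     fourier_L1 (\<lambda>\<xi>::real^'n. complex_of_real (exp (- (r * norm \<xi>)\<^sup>2 / 2))) 0"
    by (simp add: fourier_L1_cis flip: integral_complex_of_real)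
  also have "\<dots> = complex_of_real ((sqrt (2 * pi) / r) ^ CARD('n))"
  proof -
    have "2 * pi / r / sqrt (2 * pi) = sqrt (2 * pi) / r"
      using assms by (simp add: field_simps)
    thus ?thesis unfolding gauss_kernel_fourier(2)[OF assms] gauss_kernel_def by simp
  qed
  finally have "integral\<^sup>L lebesgue (\<lambda>\<xi>::real^'n. exp (- (r * norm \<xi>)\<^sup>2 / 2)) = (sqrt (2 * pi) / r) ^ CARD('n)"
    by (simp only: of_real_eq_iff)
  thus "integral\<^sup>L lebesgue (gauss_kernel r :: real^'n \<Rightarrow> real) = 1"
    unfolding gauss_kernel_def integral_mult_right_zero using assms
    by (simp flip: power_mult_distrib)
qed


section \<open>Plancherel for integrable functions\<close>

text \<open>
  Two applications of the multiplication formula. The Gaussian weight makes the integral over \<open>\<xi>\<close>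
  converge absolutely, and its Fourier transform is an approximate identity on the right-hand side.
\<close>

lemma gauss_mean_fourier_sq:
  fixes f :: "real ^ 'n \<Rightarrow> complex"
  assumes f: "integrable lebesgue f" and e: "\<epsilon> > 0"
  shows "complex_of_real (\<integral>\<xi>. (cmod (fourier_L1 f \<xi>))\<^sup>2 * exp (- (\<epsilon> * norm \<xi>)\<^sup>2 / 2) \<partial>lebesgue)
     = (\<integral>s. f s * (\<integral>t. cnj (f t) * gauss_kernel (2 * pi / \<epsilon>) (t - s) \<partial>lebesgue) \<partial>lebesgue)"
proof -
  define w where "w = (\<lambda>\<xi>::real^'n. complex_of_real (exp (- (\<epsilon> * norm \<xi>)\<^sup>2 / 2)))"
  define g where "g = (\<lambda>\<xi>. cnj (fourier_L1 f \<xi>) * w \<xi>)"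
  have w: "integrable lebesgue w" unfolding w_def by (rule gauss_kernel_fourier(1)[OF e])
  note [measurable] = fourier_L1_measurable[OF f]
  have g: "integrable lebesgue g"
    unfolding g_def using fourier_L1_bound[of f]
    by (intro bounded_mult_integrable[OF w, where C = "\<integral>t. cmod (f t) \<partial>lebesgue"]) auto
  have ghat: "fourier_L1 g s = (\<integral>t. cnj (f t) * gauss_kernel (2 * pi / \<epsilon>) (t - s) \<partial>lebesgue)" for s
  proof -
    define k where "k = (\<lambda>\<xi>. cis (- (2 * pi * (s \<bullet> \<xi>))) * w \<xi>)"
    have k: "integrable lebesgue k" unfolding k_def by (rule fourier_L1_integrable[OF w])
    have k': "fourier_L1 (\<lambda>\<xi>. cnj (k \<xi>)) t = gauss_kernel (2 * pi / \<epsilon>) (t - s)" for t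
    proof -
      have "fourier_L1 (\<lambda>\<xi>. cnj (k \<xi>)) t = cnj (fourier_L1 w (- t + s))"
        unfolding fourier_L1_cnj k_def fourier_L1_modulate ..
      also have "\<dots> = gauss_kernel (2 * pi / \<epsilon>) (- (t - s))"
        unfolding w_def gauss_kernel_fourier(2)[OF e] by simp
      finally show ?thesis by (simp only: gauss_kernel_minus)
    qed
    have "fourier_L1 g s = (\<integral>\<xi>. cnj (fourier_L1 f \<xi> * cnj (k \<xi>)) \<partial>lebesgue)"
      unfolding fourier_L1_cis[of g] by (simp add: g_def k_def mult_ac)
    also have "\<dots> = cnj (\<integral>\<xi>. fourier_L1 f \<xi> * cnj (k \<xi>) \<partial>lebesgue)"
      by (rule Bochner_Integration.integral_cnj)
    also have "\<dots> = cnj (\<integral>t. f t * fourier_L1 (\<lambda>\<xi>. cnj (k \<xi>)) t \<partial>lebesgue)"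
      using k by (subst fourier_L1_multiplication_formula[OF f]) auto
    also have "\<dots> = (\<integral>t. cnj (f t) * gauss_kernel (2 * pi / \<epsilon>) (t - s) \<partial>lebesgue)"
      unfolding k' Bochner_Integration.integral_cnj[symmetric] by simp
    finally show ?thesis .
  qed
  have "complex_of_real (\<integral>\<xi>. (cmod (fourier_L1 f \<xi>))\<^sup>2 * exp (- (\<epsilon> * norm \<xi>)\<^sup>2 / 2) \<partial>lebesgue)
     = (\<integral>\<xi>. fourier_L1 f \<xi> * g \<xi> \<partial>lebesgue)"
    unfolding integral_complex_of_real[symmetric] g_def w_def
    by (intro Bochner_Integration.integral_cong refl) (simp only: of_real_mult complex_norm_square mult.assoc)
  also have "\<dots> = (\<integral>s. f s * fourier_L1 g s \<partial>lebesgue)"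
    by (rule fourier_L1_multiplication_formula[OF f g])
  finally show ?thesis unfolding ghat .
qed

lemma nn_integral_gauss_kernel:
  assumes "r > 0"
  shows "(\<integral>\<^sup>+t. ennreal (gauss_kernel r (t - s)) \<partial>lebesgue) = 1"
    and "(\<integral>\<^sup>+s. ennreal (gauss_kernel r (t - s)) \<partial>lebesgue) = 1"
proof -
  have *: "(\<integral>\<^sup>+t. ennreal (gauss_kernel r (t - s)) \<partial>lebesgue) = 1" for s :: "real ^ 'n"
  proof -
    have m: "gauss_kernel r \<in> borel_measurable lebesgue"
      by (rule borel_imp_lebesgue_measurable) measurable
    have "integrable lebesgue (\<lambda>t. gauss_kernel r (- s + t))"
      using gauss_kernel_integral(1)[OF assms] lebesgue_integrable_shift[OF m, of "- s"] by blast
    hence "(\<integral>\<^sup>+t. ennreal (gauss_kernel r (- s + t)) \<partial>lebesgue) = ennreal (\<integral>t. gauss_kernel r (- s + t) \<partial>lebesgue)"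
      using assms by (intro nn_integral_eq_integral) (auto simp: gauss_kernel_nonneg)
    also have "\<dots> = 1"
      unfolding lebesgue_integral_shift[OF m, of "- s"] gauss_kernel_integral(2)[OF assms] by simp
    finally show ?thesis by simp
  qed
  show "(\<integral>\<^sup>+t. ennreal (gauss_kernel r (t - s)) \<partial>lebesgue) = 1" by (rule *)
  have "gauss_kernel r (t - s) = gauss_kernel r (s - t)" for s
    using gauss_kernel_minus[of r "t - s"] by simp
  thus "(\<integral>\<^sup>+s. ennreal (gauss_kernel r (t - s)) \<partial>lebesgue) = 1" using * by simp
qed

text \<open>
  Schur's test: \<open>2 \<bar>f s\<bar> \<bar>f t\<bar> \<le> \<bar>f s\<bar>\<^sup>2 + \<bar>f t\<bar>\<^sup>2\<close>, and the kernel has mass 1 in each variable.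
\<close>

lemma gauss_mean_fourier_sq_le:
  fixes f :: "real ^ 'n \<Rightarrow> complex"
  assumes f: "integrable lebesgue f" and f2: "f \<in> L2 UNIV" and e: "\<epsilon> > 0"
  shows "(\<integral>\<xi>. (cmod (fourier_L1 f \<xi>))\<^sup>2 * exp (- (\<epsilon> * norm \<xi>)\<^sup>2 / 2) \<partial>lebesgue) \<le> (l2norm f)\<^sup>2"
    (is "?I \<le> _")
proof -
  define r where "r = 2 * pi / \<epsilon>"
  have r: "r > 0" using e by (simp add: r_def)
  have rn: "0 \<le> gauss_kernel r x" for x :: "real ^ 'n" using r by (simp add: gauss_kernel_nonneg)
  note [measurable] = L2_measurable[OF f2]
  have [measurable]: "(\<lambda>p. gauss_kernel r (snd p - fst p)) \<in> borel_measurable (lebesgue \<Otimes>\<^sub>M lebesgue)"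
    by measurable
  have [measurable]: "(\<lambda>t. gauss_kernel r (t - s)) \<in> borel_measurable lebesgue"
     "(\<lambda>s. gauss_kernel r (t - s)) \<in> borel_measurable lebesgue" for s t :: "real ^ 'n"
    by (rule borel_imp_lebesgue_measurable, measurable)+
  have mass: "(\<integral>\<^sup>+t. ennreal (c * gauss_kernel r (t - s)) \<partial>lebesgue) = ennreal c"
    "(\<integral>\<^sup>+s. ennreal (c * gauss_kernel r (t - s)) \<partial>lebesgue) = ennreal c" if "c \<ge> 0" for c and s t :: "real ^ 'n"
    by (simp_all add: ennreal_mult[OF that rn] nn_integral_cmult nn_integral_gauss_kernel[OF r])
  let ?a = "\<lambda>s t. ennreal (((cmod (f s))\<^sup>2 / 2) * gauss_kernel r (t - s))"
  let ?b = "\<lambda>s t. ennreal (((cmod (f t))\<^sup>2 / 2) * gauss_kernel r (t - s))"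
  let ?N = "\<lambda>s. (\<integral>\<^sup>+t. ennreal (cmod (f t) * gauss_kernel r (t - s)) \<partial>lebesgue)"
  let ?h = "\<lambda>s. \<integral>t. cnj (f t) * gauss_kernel r (t - s) \<partial>lebesgue"
  have h: "ennreal (cmod (?h s)) \<le> ?N s" for s
  proof (cases "integrable lebesgue (\<lambda>t. cnj (f t) * gauss_kernel r (t - s))")
    case True
    from integral_norm_bound_ennreal[OF True] show ?thesis using rn by (simp add: norm_mult)
  qed (simp add: not_integrable_integral_eq)
  have "ennreal ?I = ennreal (cmod (\<integral>s. f s * ?h s \<partial>lebesgue))"
    unfolding gauss_mean_fourier_sq[OF f e, folded r_def, symmetric] by simp
  also have "\<dots> \<le> (\<integral>\<^sup>+s. ennreal (cmod (f s * ?h s)) \<partial>lebesgue)"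
  proof (cases "integrable lebesgue (\<lambda>s. f s * ?h s)")
    case True
    from integral_norm_bound_ennreal[OF True] show ?thesis .
  qed (simp add: not_integrable_integral_eq)
  also have "\<dots> \<le> (\<integral>\<^sup>+s. ennreal (cmod (f s)) * ?N s \<partial>lebesgue)"
    using h by (intro nn_integral_mono) (simp add: norm_mult ennreal_mult mult_left_mono)
  also have "\<dots> \<le> (\<integral>\<^sup>+s. (\<integral>\<^sup>+t. ?a s t + ?b s t \<partial>lebesgue) \<partial>lebesgue)"
  proof (rule nn_integral_mono)
    fix s :: "real ^ 'n"
    have "ennreal (cmod (f s)) * ?N s
       = (\<integral>\<^sup>+t. ennreal (cmod (f s)) * ennreal (cmod (f t) * gauss_kernel r (t - s)) \<partial>lebesgue)"
      by (rule nn_integral_cmult[symmetric]) measurable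
    also have "\<dots> \<le> (\<integral>\<^sup>+t. ?a s t + ?b s t \<partial>lebesgue)"
    proof (rule nn_integral_mono)
      fix t
      have "cmod (f s) * cmod (f t) \<le> (cmod (f s))\<^sup>2 / 2 + (cmod (f t))\<^sup>2 / 2"
        using sum_squares_bound[of "cmod (f s)" "cmod (f t)"] by simp
      hence "cmod (f s) * cmod (f t) * gauss_kernel r (t - s) \<le> ((cmod (f s))\<^sup>2 / 2 + (cmod (f t))\<^sup>2 / 2) * gauss_kernel r (t - s)"
        by (rule mult_right_mono[OF _ rn])
      thus "ennreal (cmod (f s)) * ennreal (cmod (f t) * gauss_kernel r (t - s)) \<le> ?a s t + ?b s t"
      proof -
        assume *: "cmod (f s) * cmod (f t) * gauss_kernel r (t - s) \<le> ((cmod (f s))\<^sup>2 / 2 + (cmod (f t))\<^sup>2 / 2) * gauss_kernel r (t - s)"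
        have "ennreal (cmod (f s)) * ennreal (cmod (f t) * gauss_kernel r (t - s)) = ennreal (cmod (f s) * cmod (f t) * gauss_kernel r (t - s))"
          by (subst ennreal_mult[symmetric]) (simp_all add: rn mult.assoc)
        also have "\<dots> \<le> ennreal (((cmod (f s))\<^sup>2 / 2 + (cmod (f t))\<^sup>2 / 2) * gauss_kernel r (t - s))"
          by (rule ennreal_leI[OF *])
        also have "\<dots> = ?a s t + ?b s t"
          unfolding distrib_right by (rule ennreal_plus) (simp_all add: rn)
        finally show ?thesis .
      qed
    qed
    finally show "ennreal (cmod (f s)) * ?N s \<le> \<dots>" .
  qed
  also have "\<dots> = (\<integral>\<^sup>+s. (\<integral>\<^sup>+t. ?a s t \<partial>lebesgue) \<partial>lebesgue)
      + (\<integral>\<^sup>+s. (\<integral>\<^sup>+t. ?b s t \<partial>lebesgue) \<partial>lebesgue)"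
    by (subst nn_integral_add[symmetric]) (auto simp: nn_integral_add intro!: nn_integral_cong nn_integral_add[symmetric])
  also have "(\<integral>\<^sup>+s. (\<integral>\<^sup>+t. ?b s t \<partial>lebesgue) \<partial>lebesgue)
     = (\<integral>\<^sup>+t. (\<integral>\<^sup>+s. ?b s t \<partial>lebesgue) \<partial>lebesgue)"
    by (rule lebesgue_pair.Fubini'[symmetric]) measurable
  also have "\<dots> = (\<integral>\<^sup>+t. ennreal ((cmod (f t))\<^sup>2 / 2) \<partial>lebesgue)"
    by (intro nn_integral_cong mass) simp
  also have "(\<integral>\<^sup>+s. (\<integral>\<^sup>+t. ?a s t \<partial>lebesgue) \<partial>lebesgue)
     = (\<integral>\<^sup>+t. ennreal ((cmod (f t))\<^sup>2 / 2) \<partial>lebesgue)"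
    by (intro nn_integral_cong mass) simp
  also have "(\<integral>\<^sup>+t. ennreal ((cmod (f t))\<^sup>2 / 2) \<partial>lebesgue) + (\<integral>\<^sup>+t. ennreal ((cmod (f t))\<^sup>2 / 2) \<partial>lebesgue) = (\<integral>\<^sup>+t. ennreal ((cmod (f t))\<^sup>2) \<partial>lebesgue)"
    by (subst nn_integral_add[symmetric]) (auto simp flip: ennreal_plus)
  also have "\<dots> = ennreal ((l2norm f)\<^sup>2)" by (rule nn_integral_l2norm[OF f2])
  finally show ?thesis by simp
qed

lemma gauss_weight_tendsto: "(\<lambda>k. exp (- (1 / real (Suc k) * a)\<^sup>2 / 2)) \<longlonglongrightarrow> 1"
proof -
  have "(\<lambda>k. exp (- (1 / real (Suc k) * a)\<^sup>2 / 2)) \<longlonglongrightarrow> exp (- (0 * a)\<^sup>2 / 2)"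
    by (intro tendsto_intros LIMSEQ_Suc[OF lim_1_over_n]) auto
  thus ?thesis by simp
qed

text \<open>
  The Gaussian weights increase to 1; apply Fatou to the previous bound.
\<close>

theorem
  fixes f :: "real ^ 'n \<Rightarrow> complex"
  assumes f: "integrable lebesgue f" and f2: "f \<in> L2 UNIV"
  shows fourier_L1_in_L2: "fourier_L1 f \<in> L2 UNIV" 
    and fourier_L1_contractive: "l2norm (fourier_L1 f) \<le> l2norm f"
proof -
  note [measurable] = fourier_L1_measurable[OF f]
  let ?F = "\<lambda>\<xi>. (cmod (fourier_L1 f \<xi>))\<^sup>2" and ?c = "\<integral>t. cmod (f t) \<partial>lebesgue"
  let ?w = "\<lambda>k (\<xi>::real^'n). exp (- (1 / real (Suc k) * norm \<xi>)\<^sup>2 / 2)"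
  have [measurable]: "?w k \<in> borel_measurable lebesgue" for k
    by (rule borel_imp_lebesgue_measurable) measurable
  have int: "integrable lebesgue (\<lambda>\<xi>. ?F \<xi> * ?w k \<xi>)" for k
  proof (rule Bochner_Integration.integrable_bound)
    show "integrable lebesgue (\<lambda>\<xi>. complex_of_real (?c\<^sup>2) * complex_of_real (?w k \<xi>))"
    proof -
      have "integrable lebesgue (\<lambda>\<xi>::real^'n. complex_of_real (?w k \<xi>))"
        by (rule gauss_kernel_fourier(1)) simp
      thus ?thesis by (intro integrable_mult_right)
    qed
    have "?F \<xi> \<le> ?c\<^sup>2" for \<xi>
      by (rule power_mono[OF fourier_L1_bound]) simp
    thus "AE \<xi> in lebesgue. norm (?F \<xi> * ?w k \<xi>) \<le> norm (complex_of_real (?c\<^sup>2) * complex_of_real (?w k \<xi>))"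
      by (intro AE_I2) (simp add: norm_mult norm_power mult_right_mono)
  qed measurable
  have "(\<integral>\<^sup>+\<xi>. ennreal (?F \<xi>) \<partial>lebesgue) = (\<integral>\<^sup>+\<xi>. liminf (\<lambda>k. ennreal (?F \<xi> * ?w k \<xi>)) \<partial>lebesgue)"
  proof (rule nn_integral_cong)
    fix \<xi>
    have "(\<lambda>k. ?F \<xi> * ?w k \<xi>) \<longlonglongrightarrow> ?F \<xi> * 1"
      by (intro tendsto_mult tendsto_const gauss_weight_tendsto)
    hence "(\<lambda>k. ennreal (?F \<xi> * ?w k \<xi>)) \<longlonglongrightarrow> ennreal (?F \<xi>)"
      by (intro tendsto_ennrealI) (simp only: mult_1_right)
    thus "ennreal (?F \<xi>) = liminf (\<lambda>k. ennreal (?F \<xi> * ?w k \<xi>))"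
      by (rule lim_imp_Liminf[OF trivial_limit_sequentially, symmetric])
  qed
  also have "\<dots> \<le> liminf (\<lambda>k. \<integral>\<^sup>+\<xi>. ennreal (?F \<xi> * ?w k \<xi>) \<partial>lebesgue)"
    by (rule nn_integral_liminf) measurable
  also have "\<dots> \<le> liminf (\<lambda>k. ennreal ((l2norm f)\<^sup>2))"
  proof (intro Liminf_mono always_eventually allI)
    fix k
    have "(\<integral>\<^sup>+\<xi>. ennreal (?F \<xi> * ?w k \<xi>) \<partial>lebesgue) = ennreal (\<integral>\<xi>. ?F \<xi> * ?w k \<xi> \<partial>lebesgue)"
      by (rule nn_integral_eq_integral[OF int]) auto
    also have "\<dots> \<le> ennreal ((l2norm f)\<^sup>2)"
      by (intro ennreal_leI gauss_mean_fourier_sq_le f f2) simp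
    finally show "(\<integral>\<^sup>+\<xi>. ennreal (?F \<xi> * ?w k \<xi>) \<partial>lebesgue) \<le> ennreal ((l2norm f)\<^sup>2)" .
  qed
  also have "\<dots> = ennreal ((l2norm f)\<^sup>2)" by (simp add: Liminf_const)
  finally have "(\<integral>\<^sup>+\<xi>. ennreal (?F \<xi>) \<partial>lebesgue) \<le> ennreal ((l2norm f)\<^sup>2)" .
  from L2_of_nn_integral_le[OF _ this] show "fourier_L1 f \<in> L2 UNIV" "l2norm (fourier_L1 f) \<le> l2norm f"
    by auto
qed

lemma bounded_L1_in_L2:
  assumes f: "integrable lebesgue f" and b: "\<And>t. cmod (f t) \<le> M"
  shows "f \<in> L2 UNIV"
proof (rule L2_UNIV_I)
  note [measurable] = borel_measurable_integrable[OF f]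
  show "f \<in> borel_measurable lebesgue" by measurable
  show "integrable lebesgue (\<lambda>t. (cmod (f t))\<^sup>2)"
  proof (rule Bochner_Integration.integrable_bound)
    show "integrable lebesgue (\<lambda>t. complex_of_real M * f t)" using f by simp
    have "(cmod (f t))\<^sup>2 \<le> \<bar>M\<bar> * cmod (f t)" for t
      unfolding power2_eq_square by (rule mult_right_mono) (use b[of t] in auto)
    thus "AE t in lebesgue. norm ((cmod (f t))\<^sup>2) \<le> norm (complex_of_real M * f t)"
      by (simp add: norm_mult)
  qed measurable
qed

lemma complex_lebesgue_borel_representative:
  fixes f :: "'a::euclidean_space \<Rightarrow> complex"
  assumes f: "f \<in> borel_measurable lebesgue"
  obtains g where "g \<in> borel_measurable borel" "AE t in lebesgue. f t = g t"
proof -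
  have re: "(\<lambda>t. Re (f t)) \<in> borel_measurable lebesgue" and im: "(\<lambda>t. Im (f t)) \<in> borel_measurable lebesgue"
    using f by simp_all
  obtain u where u: "u \<in> borel_measurable lborel" "AE t in lborel. Re (f t) = u t"
    using completion_ex_borel_measurable_real[OF re] by blast
  obtain v where v: "v \<in> borel_measurable lborel" "AE t in lborel. Im (f t) = v t"
    using completion_ex_borel_measurable_real[OF im] by blast
  show ?thesis
  proof (rule that)
    show "(\<lambda>t. Complex (u t) (v t)) \<in> borel_measurable borel"
      using u(1) v(1) by (simp add: Complex_eq)
    have "AE t in lborel. f t = Complex (u t) (v t)"
      using u(2) v(2) by eventually_elim (simp add: complex_eq_iff)
    thus "AE t in lebesgue. f t = Complex (u t) (v t)" by (rule AE_completion)
  qed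
qed

text \<open>
  The substitution \<open>t = s + v / r\<close> moves the parameter from the kernel to the function, so that dominated
  convergence applies with one fixed kernel.
\<close>

lemma gauss_kernel_mean_rescale:
  fixes f :: "real ^ 'n \<Rightarrow> complex"
  assumes [measurable]: "f \<in> borel_measurable borel" and r: "r > 0"
  shows "(\<integral>t. f t * gauss_kernel r (t - s) \<partial>lebesgue) = (\<integral>v. f (s + (1 / r) *\<^sub>R v) * gauss_kernel 1 v \<partial>lebesgue)"
proof -
  have m: "(\<lambda>t. f t * gauss_kernel r (t - s)) \<in> borel_measurable borel" by measurable
  have m': "(\<lambda>u. f (s + u) * gauss_kernel r u) \<in> borel_measurable borel" by measurable
  have m'': "(\<lambda>v. f (s + (1 / r) *\<^sub>R v) * gauss_kernel 1 v) \<in> borel_measurable borel" by measurable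
  have "(\<integral>t. f t * gauss_kernel r (t - s) \<partial>lebesgue) = (\<integral>u. f (s + u) * gauss_kernel r u \<partial>lebesgue)"
    using lebesgue_integral_shift[OF borel_imp_lebesgue_measurable[OF m], of s] by simp
  also have "\<dots> = (\<integral>u. f (s + u) * gauss_kernel r u \<partial>lborel)"
    using m' by (simp add: integral_completion)
  also have "\<dots> = (1 / r) ^ DIM(real ^ 'n) *\<^sub>R (\<integral>v. f (s + (1 / r) *\<^sub>R v) * gauss_kernel r ((1 / r) *\<^sub>R v) \<partial>lborel)"
    using lborel_scale(2)[OF m', of "1 / r"] r by simp
  also have "\<dots> = (\<integral>v. (1 / r) ^ DIM(real ^ 'n) *\<^sub>R (f (s + (1 / r) *\<^sub>R v) * gauss_kernel r ((1 / r) *\<^sub>R v)) \<partial>lborel)"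
    by (rule integral_scaleR_right[symmetric])
  also have "\<dots> = (\<integral>v. f (s + (1 / r) *\<^sub>R v) * gauss_kernel 1 v \<partial>lborel)"
  proof (intro Bochner_Integration.integral_cong refl)
    fix v :: "real ^ 'n"
    have "(1 / r) ^ DIM(real ^ 'n) * gauss_kernel r ((1 / r) *\<^sub>R v) = gauss_kernel 1 v"
      using r by (simp add: gauss_kernel_def power_divide)
    thus "(1 / r) ^ DIM(real ^ 'n) *\<^sub>R (f (s + (1 / r) *\<^sub>R v) * gauss_kernel r ((1 / r) *\<^sub>R v)) = f (s + (1 / r) *\<^sub>R v) * gauss_kernel 1 v"
      unfolding scaleR_conv_of_real by (metis mult.left_commute of_real_mult)
  qed
  also have "\<dots> = (\<integral>v. f (s + (1 / r) *\<^sub>R v) * gauss_kernel 1 v \<partial>lebesgue)"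
    using m'' by (simp add: integral_completion)
  finally show ?thesis .
qed

lemma L1_translation_le:
  fixes f :: "'a::euclidean_space \<Rightarrow> complex"
  assumes f: "integrable lebesgue f"
  shows "(\<integral>x. cmod (f (a + x) - f x) \<partial>lebesgue) \<le> 2 * (\<integral>x. cmod (f x) \<partial>lebesgue)"
proof -
  have m: "(\<lambda>x. cmod (f x)) \<in> borel_measurable lebesgue" using borel_measurable_integrable[OF f] by measurable
  have i: "integrable lebesgue (\<lambda>x. f (a + x))" 
    using f lebesgue_integrable_shift[OF borel_measurable_integrable[OF f], of a] by simp
  have "(\<integral>x. cmod (f (a + x) - f x) \<partial>lebesgue) \<le> (\<integral>x. cmod (f (a + x)) + cmod (f x) \<partial>lebesgue)"
    using f i by (intro integral_mono) (auto intro: norm_triangle_ineq4)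
  also have "\<dots> = (\<integral>x. cmod (f (a + x)) \<partial>lebesgue) + (\<integral>x. cmod (f x) \<partial>lebesgue)"
    using f i by simp
  also have "\<dots> = 2 * (\<integral>x. cmod (f x) \<partial>lebesgue)"
    using lebesgue_integral_shift[OF m, of a] by simp
  finally show ?thesis .
qed

text \<open>
  Dominated convergence: \<open>\<omega>\<close> is bounded, and it tends to 0 at 0 by continuity of translation.
\<close>

lemma gauss_mean_error_tendsto_0:
  fixes f :: "real ^ 'n \<Rightarrow> complex"
  assumes f: "integrable lebesgue f"
    and r: "\<And>k. r k > (0::real)" "filterlim r at_top sequentially"
  defines "\<omega> \<equiv> \<lambda>a. (\<integral>x. cmod (f (a + x) - f x) \<partial>lebesgue)"
  assumes [measurable]: "\<omega> \<in> borel_measurable borel"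
  shows "(\<lambda>k. \<integral>v. \<omega> ((1 / r k) *\<^sub>R v) * gauss_kernel 1 v \<partial>lebesgue) \<longlonglongrightarrow> 0"
proof -
  have \<omega>_le: "\<omega> a \<le> 2 * (\<integral>x. cmod (f x) \<partial>lebesgue)" for a
    unfolding \<omega>_def by (rule L1_translation_le[OF f])
  have \<omega>_nn: "\<omega> a \<ge> 0" for a unfolding \<omega>_def by simp
  have "(\<lambda>k. \<integral>v. \<omega> ((1 / r k) *\<^sub>R v) * gauss_kernel 1 v \<partial>lebesgue) \<longlonglongrightarrow> integral\<^sup>L lebesgue (\<lambda>v::real^'n. 0::real)"
  proof (rule integral_dominated_convergence[where w = "\<lambda>v. 2 * (\<integral>x. cmod (f x) \<partial>lebesgue) * gauss_kernel 1 v"])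
    show "integrable lebesgue (\<lambda>v::real^'n. 2 * (\<integral>x. cmod (f x) \<partial>lebesgue) * gauss_kernel 1 v)"
      by (intro integrable_mult_right gauss_kernel_integral) simp
    show "AE v in lebesgue. (\<lambda>k. \<omega> ((1 / r k) *\<^sub>R v) * gauss_kernel 1 v) \<longlonglongrightarrow> 0"
    proof (rule AE_I2)
      fix v :: "real ^ 'n"
      have "(\<lambda>k. \<omega> ((1 / r k) *\<^sub>R v)) \<longlonglongrightarrow> 0"
      proof (rule LIMSEQ_I)
        fix e :: real assume "e > 0"
        then obtain d where d: "d > 0" "\<And>a. norm a < d \<Longrightarrow> \<omega> a < e"
          using L1_translation_continuous[OF f] unfolding \<omega>_def by blast
        have "(\<lambda>k. (1 / r k) *\<^sub>R v) \<longlonglongrightarrow> 0 *\<^sub>R v"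
          using tendsto_divide_0[OF tendsto_const filterlim_at_top_imp_at_infinity[OF r(2)], of 1]
          by (intro tendsto_scaleR tendsto_const)
        then obtain N where "\<And>k. k \<ge> N \<Longrightarrow> norm ((1 / r k) *\<^sub>R v - 0) < d"
          using LIMSEQ_D[of "\<lambda>k. (1 / r k) *\<^sub>R v" 0 d] d(1) by auto
        thus "\<exists>N. \<forall>k\<ge>N. norm (\<omega> ((1 / r k) *\<^sub>R v) - 0) < e"
          using d(2) \<omega>_nn by (intro exI[of _ N]) auto
      qed
      thus "(\<lambda>k. \<omega> ((1 / r k) *\<^sub>R v) * gauss_kernel 1 v) \<longlonglongrightarrow> 0"
        by (rule tendsto_mult_left_zero)
    qed
    show "AE v in lebesgue. norm (\<omega> ((1 / r k) *\<^sub>R v) * gauss_kernel 1 v) \<le> 2 * (\<integral>x. cmod (f x) \<partial>lebesgue) * gauss_kernel 1 v" for k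
      using \<omega>_le \<omega>_nn by (intro AE_I2) (auto simp: abs_mult gauss_kernel_nonneg intro!: mult_right_mono)
    show "(\<lambda>v::real^'n. \<omega> ((1 / r k) *\<^sub>R v) * gauss_kernel 1 v) \<in> borel_measurable lebesgue" for k
      by (rule borel_imp_lebesgue_measurable) measurable
  qed simp
  thus "(\<lambda>k. \<integral>v. \<omega> ((1 / r k) *\<^sub>R v) * gauss_kernel 1 v \<partial>lebesgue) \<longlonglongrightarrow> 0" by simp
qed

text \<open>
  Only \<open>l2norm f \<le> l2norm (fourier_L1 f)\<close> is new. The Gaussian mean \<open>I k\<close> is at most
  \<open>(l2norm (fourier_L1 f))\<^sup>2\<close>, and it differs from \<open>(l2norm f)\<^sup>2\<close> by at most \<open>M\<close> times an average of the \<open>L\<^sup>1\<close>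
  modulus of continuity \<open>\<omega>\<close> of \<open>f\<close>, which tends to 0. Borel measurability of \<open>f\<close> makes
  \<open>f (s + v)\<close> jointly measurable in \<open>s\<close> and \<open>v\<close>.
\<close>

lemma Plancherel_borel_bounded:
  fixes f :: "real ^ 'n \<Rightarrow> complex"
  assumes f: "integrable lebesgue f" and b: "\<And>t. cmod (f t) \<le> M" and [measurable]: "f \<in> borel_measurable borel"
  shows "l2norm (fourier_L1 f) = l2norm f"
proof (rule antisym)
  have f2: "f \<in> L2 UNIV" by (rule bounded_L1_in_L2[OF f b])
  show "l2norm (fourier_L1 f) \<le> l2norm f" by (rule fourier_L1_contractive[OF f f2])
  have F2: "fourier_L1 f \<in> L2 UNIV" by (rule fourier_L1_in_L2[OF f f2])
  define \<epsilon> where "\<epsilon> = (\<lambda>k. 1 / real (Suc k))"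
  have \<epsilon>: "\<epsilon> k > 0" for k by (simp add: \<epsilon>_def)
  define r where "r = (\<lambda>k. 2 * pi / \<epsilon> k)"
  have r: "r k > 0" for k using \<epsilon>[of k] by (simp add: r_def)
  have r_lim: "filterlim r at_top sequentially"
    unfolding r_def \<epsilon>_def by real_asymp
  define \<omega> where "\<omega> = (\<lambda>a. (\<integral>x. cmod (f (a + x) - f x) \<partial>lebesgue))"
  have \<omega>_meas [measurable]: "\<omega> \<in> borel_measurable borel"
    unfolding \<omega>_def by measurable
  define I where "I = (\<lambda>k. \<integral>\<xi>. (cmod (fourier_L1 f \<xi>))\<^sup>2 * exp (- (\<epsilon> k * norm \<xi>)\<^sup>2 / 2) \<partial>lebesgue)"
  note [measurable] = fourier_L1_measurable[OF f]
  have M: "M \<ge> 0" using order_trans[OF norm_ge_zero b] .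
  have I_le: "I k \<le> (l2norm (fourier_L1 f))\<^sup>2" for k
    unfolding I_def l2norm_sq
    by (rule integral_mono'[OF L2_integrable[OF F2]]) (auto intro: mult_left_le)
  have gk [simp]: "gauss_kernel 1 v \<ge> 0" for v :: "real ^ 'n" by (simp add: gauss_kernel_nonneg)
  have gk_leb [measurable]: "(gauss_kernel 1 :: real^'n \<Rightarrow> real) \<in> borel_measurable lebesgue"
    by (rule borel_imp_lebesgue_measurable) measurable
  have f_leb [measurable]: "f \<in> borel_measurable lebesgue" using f by simp
  have f_shift [measurable]: "(\<lambda>x. f (a + x)) \<in> borel_measurable lebesgue" for a
    by (rule borel_imp_lebesgue_measurable) measurable
  let ?E = "\<lambda>k. \<integral>v. \<omega> ((1 / r k) *\<^sub>R v) * gauss_kernel 1 v \<partial>lebesgue"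
  have error: "cmod (complex_of_real (I k) - complex_of_real ((l2norm f)\<^sup>2)) \<le> M * ?E k" for k
  proof -
    define G where "G = (\<lambda>s v. cmod (f (s + (1 / r k) *\<^sub>R v) - f s) * gauss_kernel 1 v)"
    have [measurable]: "(\<lambda>p. G (fst p) (snd p)) \<in> borel_measurable (lebesgue \<Otimes>\<^sub>M lebesgue)"
      unfolding G_def by measurable
    have fi: "integrable lebesgue (\<lambda>x. f (a + x) - f x)" for a
      using f lebesgue_integrable_shift[OF f_leb, of a] by simp
    have wi: "integrable lebesgue (\<lambda>v. \<omega> ((1 / r k) *\<^sub>R v) * gauss_kernel 1 v)"
    proof (rule Bochner_Integration.integrable_bound)
      show "integrable lebesgue (\<lambda>v::real^'n. 2 * (\<integral>x. cmod (f x) \<partial>lebesgue) * gauss_kernel 1 v)"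
        by (intro integrable_mult_right gauss_kernel_integral) simp
      show "(\<lambda>v::real^'n. \<omega> ((1 / r k) *\<^sub>R v) * gauss_kernel 1 v) \<in> borel_measurable lebesgue"
        by (rule borel_imp_lebesgue_measurable) measurable
      have "\<omega> a \<le> 2 * (\<integral>x. cmod (f x) \<partial>lebesgue)" "\<omega> a \<ge> 0" for a
        using L1_translation_le[OF f, of a] by (auto simp: \<omega>_def)
      thus "AE v in lebesgue. norm (\<omega> ((1 / r k) *\<^sub>R v) * gauss_kernel 1 v) \<le> norm (2 * (\<integral>x. cmod (f x) \<partial>lebesgue) * gauss_kernel 1 v)"
        by (intro AE_I2) (auto simp: abs_mult intro!: mult_right_mono)
    qed
    have inner: "(\<integral>s. G s v \<partial>lebesgue) = \<omega> ((1 / r k) *\<^sub>R v) * gauss_kernel 1 v" for v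
      unfolding G_def \<omega>_def by (simp add: add.commute)
    have int: "integrable (lebesgue \<Otimes>\<^sub>M lebesgue) (\<lambda>(v, s). G s v)"
    proof (rule lebesgue_pair.Fubini_integrable)
      show "(\<lambda>(v, s). G s v) \<in> borel_measurable (lebesgue \<Otimes>\<^sub>M lebesgue)" unfolding G_def by measurable
      have "norm (G s v) = G s v" for s v by (simp add: G_def abs_mult)
      thus "integrable lebesgue (\<lambda>v. \<integral>s. norm (case (v, s) of (v, s) \<Rightarrow> G s v) \<partial>lebesgue)"
        using wi by (simp add: inner)
      show "AE v in lebesgue. integrable lebesgue (\<lambda>s. case (v, s) of (v, s) \<Rightarrow> G s v)"
      proof (rule AE_I2)
        fix v :: "real ^ 'n"
        have "integrable lebesgue (\<lambda>s. f (s + (1 / r k) *\<^sub>R v) - f s)"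
          using fi[of "(1 / r k) *\<^sub>R v"] by (simp only: add.commute)
        hence "integrable lebesgue (\<lambda>s. cmod (f (s + (1 / r k) *\<^sub>R v) - f s))"
          by (rule integrable_norm)
        thus "integrable lebesgue (\<lambda>s. case (v, s) of (v, s) \<Rightarrow> G s v)"
          by (simp add: G_def)
      qed
    qed
    have fub: "(\<integral>s. (\<integral>v. G s v \<partial>lebesgue) \<partial>lebesgue) = ?E k"
      unfolding inner[symmetric] by (rule lebesgue_pair.Fubini_integral[OF int])
    have G_int: "integrable lebesgue (\<lambda>s. \<integral>v. G s v \<partial>lebesgue)"
      using lebesgue_pair.integrable_snd[OF int] .
    let ?p = "\<lambda>s v. cnj (f (s + (1 / r k) *\<^sub>R v)) * gauss_kernel 1 v"
    define h where "h = (\<lambda>s. \<integral>v. ?p s v \<partial>lebesgue)"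
    have gki: "integrable lebesgue (\<lambda>v::real^'n. complex_of_real (gauss_kernel 1 v))"
      by (intro integrable_of_real gauss_kernel_integral) simp
    have hi: "integrable lebesgue (\<lambda>v. ?p s v)" for s
      by (rule bounded_mult_integrable(1)[OF gki, where C = M], rule borel_imp_lebesgue_measurable) (use b in auto)
    have h_diff: "cmod (h s - cnj (f s)) \<le> (\<integral>v. G s v \<partial>lebesgue)" for s
    proof -
      have "h s - cnj (f s) = (\<integral>v. ?p s v \<partial>lebesgue) - integral\<^sup>L lebesgue (\<lambda>v::real^'n. cnj (f s) * gauss_kernel 1 v)"
        by (simp add: h_def gauss_kernel_integral integral_complex_of_real)
      also have "\<dots> = (\<integral>v. ?p s v - cnj (f s) * gauss_kernel 1 v \<partial>lebesgue)"
        by (rule Bochner_Integration.integral_diff[symmetric]) (use hi gki in auto)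
      also have "cmod \<dots> \<le> (\<integral>v. cmod (?p s v - cnj (f s) * gauss_kernel 1 v) \<partial>lebesgue)"
        by (rule integral_norm_bound)
      also have "\<dots> = (\<integral>v. G s v \<partial>lebesgue)"
        unfolding left_diff_distrib[symmetric] norm_mult G_def
        by (simp flip: complex_cnj_diff)
      finally show ?thesis .
    qed
    have Ih: "complex_of_real (I k) = (\<integral>s. f s * h s \<partial>lebesgue)"
      unfolding I_def h_def gauss_mean_fourier_sq[OF f \<epsilon>] r_def[symmetric]
      by (subst gauss_kernel_mean_rescale) (use r in \<open>auto simp: r_def\<close>)
    have [measurable]: "h \<in> borel_measurable lebesgue"
      unfolding h_def by measurable
    have h_le: "cmod (h s) \<le> M" for s
    proof -
      have "cmod (h s) \<le> (\<integral>v. cmod (?p s v) \<partial>lebesgue)"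
        unfolding h_def by (rule integral_norm_bound)
      also have "\<dots> \<le> integral\<^sup>L lebesgue (\<lambda>v::real^'n. M * gauss_kernel 1 v)"
        by (intro integral_mono integrable_norm hi integrable_mult_right gauss_kernel_integral(1))
           (auto simp: norm_mult intro!: mult_right_mono b)
      also have "\<dots> = M" by (simp add: gauss_kernel_integral)
      finally show ?thesis .
    qed
    have fh: "integrable lebesgue (\<lambda>s. f s * h s)"
      by (rule bounded_mult_integrable(2)[OF f, where C = M]) (use h_le in auto)
    have "complex_of_real (I k) - complex_of_real ((l2norm f)\<^sup>2) = (\<integral>s. f s * h s \<partial>lebesgue) - (\<integral>s. f s * cnj (f s) \<partial>lebesgue)"
      unfolding Ih l2inner_self[symmetric] l2inner_def ..
    also have "\<dots> = (\<integral>s. f s * h s - f s * cnj (f s) \<partial>lebesgue)"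
      by (rule Bochner_Integration.integral_diff[symmetric]) (use fh L2_inner_integrable[OF f2 f2] in auto)
    also have "cmod \<dots> \<le> (\<integral>s. M * (\<integral>v. G s v \<partial>lebesgue) \<partial>lebesgue)"
    proof (rule order_trans[OF integral_norm_bound integral_mono])
      show "integrable lebesgue (\<lambda>s. cmod (f s * h s - f s * cnj (f s)))"
        using fh L2_inner_integrable[OF f2 f2] by auto
      show "integrable lebesgue (\<lambda>s. M * (\<integral>v. G s v \<partial>lebesgue))" using G_int by simp
      show "cmod (f s * h s - f s * cnj (f s)) \<le> M * (\<integral>v. G s v \<partial>lebesgue)" for s
        unfolding right_diff_distrib[symmetric] norm_mult
        by (intro mult_mono b h_diff M norm_ge_zero)
    qed
    also have "\<dots> = M * ?E k"
      by (simp add: fub)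
    finally show ?thesis .
  qed
  have "(\<lambda>k. M * ?E k) \<longlonglongrightarrow> 0"
    using gauss_mean_error_tendsto_0[OF f r r_lim] \<omega>_meas unfolding \<omega>_def
    by (intro tendsto_mult_right_zero) auto
  hence "(\<lambda>k. complex_of_real (I k) - complex_of_real ((l2norm f)\<^sup>2)) \<longlonglongrightarrow> 0"
    by (rule Lim_null_comparison[rotated]) (use error in auto)
  hence "(\<lambda>k. complex_of_real (I k)) \<longlonglongrightarrow> complex_of_real ((l2norm f)\<^sup>2)"
    by (simp only: LIM_zero_iff)
  hence "I \<longlonglongrightarrow> (l2norm f)\<^sup>2" by (simp only: tendsto_of_real_iff)
  hence "(l2norm f)\<^sup>2 \<le> (l2norm (fourier_L1 f))\<^sup>2"
    by (rule LIMSEQ_le_const2) (use I_le in auto)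
  thus "l2norm f \<le> l2norm (fourier_L1 f)" by (rule power2_le_imp_le) simp
qed

theorem Plancherel_bounded:
  fixes f :: "real ^ 'n \<Rightarrow> complex"
  assumes f: "integrable lebesgue f" and b: "\<And>t. cmod (f t) \<le> M"
  shows "l2norm (fourier_L1 f) = l2norm f"
proof -
  obtain g where g [measurable]: "g \<in> borel_measurable borel" and fg: "AE t in lebesgue. f t = g t"
    using complex_lebesgue_borel_representative[OF borel_measurable_integrable[OF f]] .
  define g' where "g' = (\<lambda>t. if cmod (g t) \<le> M then g t else 0)"
  have [measurable]: "g' \<in> borel_measurable borel" unfolding g'_def by measurable
  have g'_leb: "g' \<in> borel_measurable lebesgue" by (rule borel_imp_lebesgue_measurable) measurable
  have f_leb: "f \<in> borel_measurable lebesgue" using f by simp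
  have fg': "AE t in lebesgue. f t = g' t"
    using fg
  proof eventually_elim
    case (elim t)
    thus ?case using b[of t] by (simp add: g'_def)
  qed
  have M: "M \<ge> 0" using order_trans[OF norm_ge_zero b] .
  have "integrable lebesgue g'"
    using f integrable_cong_AE[OF f_leb g'_leb fg'] by simp
  hence "l2norm (fourier_L1 g') = l2norm g'"
    by (rule Plancherel_borel_bounded[where M = M]) (use M in \<open>auto simp: g'_def\<close>)
  moreover have "fourier_L1 f = fourier_L1 g'"
    by (rule ext, rule fourier_L1_cong_AE[OF f_leb g'_leb fg'])
  moreover have "l2norm f = l2norm g'" by (rule l2norm_cong_AE[OF f_leb g'_leb fg'])
  ultimately show ?thesis by simp
qed

section \<open>The Fourier transform on square-integrable functions\<close>

lemma indicator_in_L2: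
  assumes "S \<in> lmeasurable" shows "(\<lambda>t. indicator S t :: complex) \<in> L2 UNIV"
proof (rule bounded_L1_in_L2[where M = 1])
  have "integrable lebesgue (indicator S :: _ \<Rightarrow> real)"
    using assms by (auto simp: fmeasurable_def intro!: integrable_real_indicator)
  hence "integrable lebesgue (\<lambda>t. complex_of_real (indicator S t))" by (rule integrable_of_real)
  thus "integrable lebesgue (\<lambda>t. indicator S t :: complex)" by (simp add: of_real_indicator)
qed (simp add: indicator_def)

lemma L2_integrable_restrict:
  assumes "S \<in> lmeasurable" "f \<in> L2 UNIV"
  shows "integrable lebesgue (\<lambda>t. indicator S t * f t)"
  by (rule L2_mult_integrable[OF indicator_in_L2[OF assms(1)] assms(2)])

lemma L2_reflect:
  fixes f :: "real ^ 'n \<Rightarrow> complex"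
  assumes "f \<in> L2 UNIV"
  shows "(\<lambda>t. f (- t)) \<in> L2 UNIV" "l2norm (\<lambda>t. f (- t)) = l2norm f"
proof -
  have m: "f \<in> borel_measurable lebesgue" using assms by (rule L2_measurable)
  have m2: "(\<lambda>t. (cmod (f t))\<^sup>2) \<in> borel_measurable lebesgue" using m by measurable
  show "(\<lambda>t. f (- t)) \<in> L2 UNIV"
    using lebesgue_reflect_measurable[OF m] lebesgue_integrable_reflect[OF m2] L2_integrable[OF assms]
    by (intro L2_UNIV_I) auto
  show "l2norm (\<lambda>t. f (- t)) = l2norm f"
    unfolding l2norm_def using lebesgue_integral_reflect[OF m2] by simp
qed

lemma L2_approx_L1:
  fixes f :: "real ^ 'n \<Rightarrow> complex"
  assumes f: "f \<in> L2 UNIV"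
  obtains \<phi> where "\<And>k. \<phi> k \<in> L2 UNIV" "\<And>k. integrable lebesgue (\<phi> k)"
    "(\<lambda>k. l2norm (\<lambda>t. \<phi> k t - f t)) \<longlonglongrightarrow> 0"
proof
  define \<phi> where "\<phi> = (\<lambda>k::nat. \<lambda>t. indicator (cball 0 (real k)) t * f t)"
  note [measurable] = L2_measurable[OF f]
  show \<phi>: "\<phi> k \<in> L2 UNIV" for k unfolding \<phi>_def using f by (intro L2_restrict) auto
  show "integrable lebesgue (\<phi> k)" for k unfolding \<phi>_def by (intro L2_integrable_restrict f) simp
  note [measurable] = L2_measurable[OF \<phi>]
  show "(\<lambda>k. l2norm (\<lambda>t. \<phi> k t - f t)) \<longlonglongrightarrow> 0"
  proof (rule l2norm_tendsto_dominated[OF _ _ f])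
    fix t :: "real ^ 'n"
    obtain N :: nat where "norm t \<le> N" using real_arch_simple by blast
    hence "\<forall>\<^sub>F k in sequentially. \<phi> k t = f t"
      by (intro eventually_sequentiallyI[of N]) (auto simp: \<phi>_def)
    thus "(\<lambda>k. \<phi> k t) \<longlonglongrightarrow> f t" by (rule tendsto_eventually)
    show "cmod (\<phi> k t - f t) \<le> cmod (f t)" for k
      by (auto simp: \<phi>_def indicator_def)
  qed measurable
qed

lemma is_fourierI:
  assumes "f \<in> L2 UNIV" "g \<in> L2 UNIV" "\<And>k. \<phi> k \<in> L2 UNIV" "\<And>k. integrable lebesgue (\<phi> k)"
    "(\<lambda>k. l2norm (\<lambda>t. \<phi> k t - f t)) \<longlonglongrightarrow> 0"
    "(\<lambda>k. l2norm (\<lambda>t. fourier_L1 (\<phi> k) t - g t)) \<longlonglongrightarrow> 0"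
  shows "is_fourier f g"
  unfolding is_fourier_def
  using assms by (auto intro!: exI[of _ \<phi>] simp: L2_tendsto_iff fourier_L1_in_L2)

lemma is_fourierE:
  assumes "is_fourier f g" "f \<in> L2 UNIV"
  obtains \<phi> where "\<And>k. \<phi> k \<in> L2 UNIV" "\<And>k. integrable lebesgue (\<phi> k)"
    "(\<lambda>k. l2norm (\<lambda>t. \<phi> k t - f t)) \<longlonglongrightarrow> 0"
    "(\<lambda>k. l2norm (\<lambda>t. fourier_L1 (\<phi> k) t - g t)) \<longlonglongrightarrow> 0"
proof -
  from assms(1) obtain \<phi> where \<phi>: "\<And>k. \<phi> k \<in> L2 UNIV" "\<And>k. integrable lebesgue (\<phi> k)" 
      "L2_tendsto \<phi> f" "L2_tendsto (\<lambda>k. fourier_L1 (\<phi> k)) g" and g: "g \<in> L2 UNIV"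
    unfolding is_fourier_def by blast
  show ?thesis
    using \<phi>(3,4) L2_tendsto_iff[OF \<phi>(1) assms(2)] L2_tendsto_iff[OF fourier_L1_in_L2[OF \<phi>(2,1)] g]
    by (intro that[OF \<phi>(1,2)]) auto
qed

lemma is_fourier_L2: "is_fourier f g \<Longrightarrow> g \<in> L2 UNIV"
  by (simp add: is_fourier_def)

text \<open>
  Truncations of \<open>f\<close> to balls form a Cauchy sequence, hence so do their transforms, by contractivity.
\<close>

theorem is_fourier_exists:
  assumes f: "f \<in> L2 UNIV" shows "\<exists>g. is_fourier f g"
proof -
  obtain \<phi> where \<phi>: "\<And>k. \<phi> k \<in> L2 UNIV" "\<And>k. integrable lebesgue (\<phi> k)"
    "(\<lambda>k. l2norm (\<lambda>t. \<phi> k t - f t)) \<longlonglongrightarrow> 0"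
    by (rule L2_approx_L1[OF f]) (rule that)
  note F = fourier_L1_in_L2[OF \<phi>(2,1)]
  have le: "l2norm (\<lambda>t. fourier_L1 (\<phi> i) t - fourier_L1 (\<phi> j) t) \<le> l2norm (\<lambda>t. \<phi> i t - f t) + l2norm (\<lambda>t. \<phi> j t - f t)" for i j
  proof -
    have "l2norm (\<lambda>t. fourier_L1 (\<phi> i) t - fourier_L1 (\<phi> j) t) = l2norm (fourier_L1 (\<lambda>t. \<phi> i t - \<phi> j t))"
      unfolding fourier_L1_diff[OF \<phi>(2) \<phi>(2), abs_def, symmetric] ..
    also have "\<dots> \<le> l2norm (\<lambda>t. \<phi> i t - \<phi> j t)"
      using \<phi> by (intro fourier_L1_contractive) auto
    also have "\<dots> \<le> l2norm (\<lambda>t. \<phi> i t - f t) + l2norm (\<lambda>t. f t - \<phi> j t)"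
      by (rule l2norm_diff_triangle[OF \<phi>(1) f \<phi>(1)])
    finally show ?thesis by (simp only: l2norm_minus_commute)
  qed
  have Cauchy: "\<exists>N. \<forall>i\<ge>N. \<forall>j\<ge>N. l2norm (\<lambda>t. fourier_L1 (\<phi> i) t - fourier_L1 (\<phi> j) t) < e" if "e > 0" for e
  proof -
    obtain N where N: "\<And>k. k \<ge> N \<Longrightarrow> l2norm (\<lambda>t. \<phi> k t - f t) < e/2"
      using LIMSEQ_D[OF \<phi>(3), of "e/2"] \<open>e > 0\<close> by auto
    show ?thesis
    proof (intro exI[of _ N] allI impI)
      fix i j assume "i \<ge> N" "j \<ge> N"
      thus "l2norm (\<lambda>t. fourier_L1 (\<phi> i) t - fourier_L1 (\<phi> j) t) < e"
        using le[of i j] N[of i] N[of j] by linarith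
    qed
  qed
  obtain g where g: "g \<in> L2 UNIV" "(\<lambda>k. l2norm (\<lambda>t. fourier_L1 (\<phi> k) t - g t)) \<longlonglongrightarrow> 0"
    by (rule Riesz_Fischer[OF F Cauchy])
  show ?thesis by (intro exI[of _ g] is_fourierI[OF f g(1) \<phi> g(2)])
qed

lemma fourier_is_fourier: "f \<in> L2 UNIV \<Longrightarrow> is_fourier f (fourier f)"
  unfolding fourier_def by (rule someI_ex[OF is_fourier_exists])

lemma is_fourier_contractive:
  assumes "is_fourier f g" "f \<in> L2 UNIV" shows "l2norm g \<le> l2norm f"
proof -
  obtain \<phi> where \<phi>: "\<And>k. \<phi> k \<in> L2 UNIV" "\<And>k. integrable lebesgue (\<phi> k)"
    "(\<lambda>k. l2norm (\<lambda>t. \<phi> k t - f t)) \<longlonglongrightarrow> 0"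
    "(\<lambda>k. l2norm (\<lambda>t. fourier_L1 (\<phi> k) t - g t)) \<longlonglongrightarrow> 0"
    by (rule is_fourierE[OF assms]) (rule that)
  have "(\<lambda>k. l2norm (fourier_L1 (\<phi> k))) \<longlonglongrightarrow> l2norm g"
    by (rule l2norm_tendsto[OF fourier_L1_in_L2[OF \<phi>(2,1)] is_fourier_L2[OF assms(1)] \<phi>(4)])
  moreover have "(\<lambda>k. l2norm (\<phi> k)) \<longlonglongrightarrow> l2norm f"
    by (rule l2norm_tendsto[OF \<phi>(1) assms(2) \<phi>(3)])
  ultimately show ?thesis
    by (rule LIMSEQ_le) (use fourier_L1_contractive[OF \<phi>(2,1)] in auto)
qed

lemma is_fourier_add:
  assumes "is_fourier f g" "f \<in> L2 UNIV" "is_fourier f' g'" "f' \<in> L2 UNIV"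
  shows "is_fourier (\<lambda>t. f t + f' t) (\<lambda>t. g t + g' t)"
proof -
  obtain \<phi> where \<phi>: "\<And>k. \<phi> k \<in> L2 UNIV" "\<And>k. integrable lebesgue (\<phi> k)"
    "(\<lambda>k. l2norm (\<lambda>t. \<phi> k t - f t)) \<longlonglongrightarrow> 0"
    "(\<lambda>k. l2norm (\<lambda>t. fourier_L1 (\<phi> k) t - g t)) \<longlonglongrightarrow> 0"
    by (rule is_fourierE[OF assms(1,2)]) (rule that)
  obtain \<psi> where \<psi>: "\<And>k. \<psi> k \<in> L2 UNIV" "\<And>k. integrable lebesgue (\<psi> k)"
    "(\<lambda>k. l2norm (\<lambda>t. \<psi> k t - f' t)) \<longlonglongrightarrow> 0"
    "(\<lambda>k. l2norm (\<lambda>t. fourier_L1 (\<psi> k) t - g' t)) \<longlonglongrightarrow> 0"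
    by (rule is_fourierE[OF assms(3,4)]) (rule that)
  note g = is_fourier_L2[OF assms(1)] is_fourier_L2[OF assms(3)]
  note F = fourier_L1_in_L2[OF \<phi>(2,1)] fourier_L1_in_L2[OF \<psi>(2,1)]
  show ?thesis
  proof (rule is_fourierI)
    show "(\<lambda>k. l2norm (\<lambda>t. \<phi> k t + \<psi> k t - (f t + f' t))) \<longlonglongrightarrow> 0"
    proof (rule Lim_null_comparison)
      show "(\<lambda>k. l2norm (\<lambda>t. \<phi> k t - f t) + l2norm (\<lambda>t. \<psi> k t - f' t)) \<longlonglongrightarrow> 0"
        using tendsto_add[OF \<phi>(3) \<psi>(3)] by simp
      show "\<forall>\<^sub>F k in sequentially. norm (l2norm (\<lambda>t. \<phi> k t + \<psi> k t - (f t + f' t))) \<le> l2norm (\<lambda>t. \<phi> k t - f t) + l2norm (\<lambda>t. \<psi> k t - f' t)"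
        using l2norm_triangle[OF L2_diff[OF \<phi>(1) assms(2)] L2_diff[OF \<psi>(1) assms(4)]]
        by (simp add: add_diff_add)
    qed
    show "(\<lambda>k. l2norm (\<lambda>t. fourier_L1 (\<lambda>t. \<phi> k t + \<psi> k t) t - (g t + g' t))) \<longlonglongrightarrow> 0"
    proof (rule Lim_null_comparison)
      show "(\<lambda>k. l2norm (\<lambda>t. fourier_L1 (\<phi> k) t - g t) + l2norm (\<lambda>t. fourier_L1 (\<psi> k) t - g' t)) \<longlonglongrightarrow> 0"
        using tendsto_add[OF \<phi>(4) \<psi>(4)] by simp
      show "\<forall>\<^sub>F k in sequentially. norm (l2norm (\<lambda>t. fourier_L1 (\<lambda>t. \<phi> k t + \<psi> k t) t - (g t + g' t))) \<le> l2norm (\<lambda>t. fourier_L1 (\<phi> k) t - g t) + l2norm (\<lambda>t. fourier_L1 (\<psi> k) t - g' t)"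
        using l2norm_triangle[OF L2_diff[OF F(1) g(1)] L2_diff[OF F(2) g(2)]]
        by (simp add: fourier_L1_add[OF \<phi>(2) \<psi>(2)] add_diff_add)
    qed
  qed (use assms g \<phi> \<psi> in auto)
qed

lemma is_fourier_cmult:
  assumes "is_fourier f g" "f \<in> L2 UNIV"
  shows "is_fourier (\<lambda>t. c * f t) (\<lambda>t. c * g t)"
proof -
  obtain \<phi> where \<phi>: "\<And>k. \<phi> k \<in> L2 UNIV" "\<And>k. integrable lebesgue (\<phi> k)"
    "(\<lambda>k. l2norm (\<lambda>t. \<phi> k t - f t)) \<longlonglongrightarrow> 0"
    "(\<lambda>k. l2norm (\<lambda>t. fourier_L1 (\<phi> k) t - g t)) \<longlonglongrightarrow> 0"
    by (rule is_fourierE[OF assms(1,2)]) (rule that)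
  show ?thesis
  proof (rule is_fourierI)
    show "(\<lambda>k. l2norm (\<lambda>t. c * \<phi> k t - c * f t)) \<longlonglongrightarrow> 0"
      unfolding right_diff_distrib[symmetric] l2norm_cmult by (rule tendsto_mult_right_zero[OF \<phi>(3)])
    show "(\<lambda>k. l2norm (\<lambda>t. fourier_L1 (\<lambda>t. c * \<phi> k t) t - c * g t)) \<longlonglongrightarrow> 0"
      unfolding fourier_L1_cmult right_diff_distrib[symmetric] l2norm_cmult by (rule tendsto_mult_right_zero[OF \<phi>(4)])
  qed (use assms is_fourier_L2[OF assms(1)] \<phi> in auto)
qed

lemma is_fourier_cnj:
  fixes f :: "real ^ 'n \<Rightarrow> complex"
  assumes "is_fourier f g" "f \<in> L2 UNIV"
  shows "is_fourier (\<lambda>t. cnj (f t)) (\<lambda>\<xi>. cnj (g (- \<xi>)))"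
proof -
  obtain \<phi> where \<phi>: "\<And>k. \<phi> k \<in> L2 UNIV" "\<And>k. integrable lebesgue (\<phi> k)"
    "(\<lambda>k. l2norm (\<lambda>t. \<phi> k t - f t)) \<longlonglongrightarrow> 0"
    "(\<lambda>k. l2norm (\<lambda>t. fourier_L1 (\<phi> k) t - g t)) \<longlonglongrightarrow> 0"
    by (rule is_fourierE[OF assms(1,2)]) (rule that)
  note g = is_fourier_L2[OF assms(1)]
  have cnj_norm: "l2norm (\<lambda>t. cnj (h t)) = l2norm h" for h :: "real ^ 'n \<Rightarrow> complex"
    by (simp add: l2norm_def)
  show ?thesis
  proof (rule is_fourierI)
    show "(\<lambda>k. l2norm (\<lambda>t. cnj (\<phi> k t) - cnj (f t))) \<longlonglongrightarrow> 0"
      using \<phi>(3) unfolding complex_cnj_diff[symmetric] cnj_norm .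
    show "(\<lambda>k. l2norm (\<lambda>t. fourier_L1 (\<lambda>t. cnj (\<phi> k t)) t - cnj (g (- t)))) \<longlonglongrightarrow> 0"
      unfolding fourier_L1_cnj complex_cnj_diff[symmetric] cnj_norm
      using \<phi>(4) L2_reflect(2)[OF L2_diff[OF fourier_L1_in_L2[OF \<phi>(2,1)] g]] by simp
  qed (use assms \<phi> L2_reflect(1)[OF g] in auto)
qed

lemma is_fourier_L1: "integrable lebesgue f \<Longrightarrow> f \<in> L2 UNIV \<Longrightarrow> is_fourier f (fourier_L1 f)"
  by (rule is_fourierI[where \<phi> = "\<lambda>_. f"]) (auto simp: fourier_L1_in_L2 l2norm_def)

lemma is_fourier_unique:
  assumes "is_fourier f g" "is_fourier f g'" "f \<in> L2 UNIV"
  shows "AE t in lebesgue. g t = g' t"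
proof -
  note g = is_fourier_L2[OF assms(1)] is_fourier_L2[OF assms(2)]
  have "is_fourier (\<lambda>t. f t + (-1) * f t) (\<lambda>t. g t + (-1) * g' t)"
    by (intro is_fourier_add is_fourier_cmult L2_cmult assms)
  hence "l2norm (\<lambda>t. g t - g' t) \<le> l2norm (\<lambda>t. f t - f t)"
    using is_fourier_contractive[OF _ L2_add[OF assms(3) L2_cmult[OF assms(3)]], of "-1"] by simp
  hence "l2norm (\<lambda>t. g t - g' t) = 0"
  proof -
    assume *: "l2norm (\<lambda>t. g t - g' t) \<le> l2norm (\<lambda>t. f t - f t)"
    have "l2norm (\<lambda>t. f t - f t) = 0" by (simp add: l2norm_def)
    thus ?thesis using * by (intro antisym[OF _ l2norm_nonneg]) simp
  qed
  thus ?thesis using l2norm_eq_0_iff[OF L2_diff[OF g]] by simp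
qed

lemma is_fourier_cong_AE:
  assumes "is_fourier f g" "f \<in> L2 UNIV" "g' \<in> L2 UNIV" "AE t in lebesgue. g t = g' t"
  shows "is_fourier f g'"
proof -
  obtain \<phi> where \<phi>: "\<And>k. \<phi> k \<in> L2 UNIV" "\<And>k. integrable lebesgue (\<phi> k)"
    "(\<lambda>k. l2norm (\<lambda>t. \<phi> k t - f t)) \<longlonglongrightarrow> 0"
    "(\<lambda>k. l2norm (\<lambda>t. fourier_L1 (\<phi> k) t - g t)) \<longlonglongrightarrow> 0"
    by (rule is_fourierE[OF assms(1,2)]) (rule that)
  have "l2norm (\<lambda>t. fourier_L1 (\<phi> k) t - g t) = l2norm (\<lambda>t. fourier_L1 (\<phi> k) t - g' t)" for k
    using fourier_L1_in_L2[OF \<phi>(2,1), of k] is_fourier_L2[OF assms(1)] assms(3,4)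
    by (intro l2norm_cong_AE) (auto intro: L2_measurable elim: eventually_mono)
  thus ?thesis using \<phi>(4) by (intro is_fourierI[OF assms(2,3) \<phi>(1-3)]) simp
qed

text \<open>
  For integrable \<open>u\<close> this is the multiplication formula, and both sides are continuous in \<open>u\<close>.
\<close>

lemma fourier_adjoint:
  assumes "is_fourier u U" "u \<in> L2 UNIV" and g: "integrable lebesgue g" "g \<in> L2 UNIV"
  shows "l2inner U g = l2inner u (\<lambda>s. fourier_L1 g (- s))"
proof -
  obtain \<phi> where \<phi>: "\<And>k. \<phi> k \<in> L2 UNIV" "\<And>k. integrable lebesgue (\<phi> k)"
    "(\<lambda>k. l2norm (\<lambda>t. \<phi> k t - u t)) \<longlonglongrightarrow> 0"
    "(\<lambda>k. l2norm (\<lambda>t. fourier_L1 (\<phi> k) t - U t)) \<longlonglongrightarrow> 0"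
    by (rule is_fourierE[OF assms(1,2)]) (rule that)
  have "l2inner (fourier_L1 (\<phi> k)) g = l2inner (\<phi> k) (\<lambda>s. fourier_L1 g (- s))" for k
    using fourier_L1_multiplication_formula[OF \<phi>(2), of "\<lambda>t. cnj (g t)" k] g
    by (simp add: l2inner_def fourier_L1_cnj)
  hence 1: "(\<lambda>k. l2inner (\<phi> k) (\<lambda>s. fourier_L1 g (- s))) \<longlonglongrightarrow> l2inner U g"
    using l2inner_tendsto[OF fourier_L1_in_L2[OF \<phi>(2,1)] is_fourier_L2[OF assms(1)] g(2) \<phi>(4)] by simp
  have 2: "(\<lambda>k. l2inner (\<phi> k) (\<lambda>s. fourier_L1 g (- s))) \<longlonglongrightarrow> l2inner u (\<lambda>s. fourier_L1 g (- s))"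
    by (rule l2inner_tendsto[OF \<phi>(1) assms(2) L2_reflect(1)[OF fourier_L1_in_L2[OF g]] \<phi>(3)])
  show ?thesis by (rule LIMSEQ_unique[OF 1 2])
qed

text \<open>
  Let \<open>u\<close> be the inverse transform of \<open>g\<close> and \<open>U\<close> its Fourier transform. By \<open>fourier_adjoint\<close> the inner product
  of \<open>U\<close> and \<open>g\<close> is \<open>(l2norm u)\<^sup>2\<close>, which equals \<open>(l2norm g)\<^sup>2\<close> by \<open>Plancherel_bounded\<close>. Expanding the square gives
  \<open>(l2norm (U - g))\<^sup>2 = (l2norm U)\<^sup>2 - (l2norm g)\<^sup>2\<close>, and \<open>l2norm U \<le> l2norm u\<close>.
\<close>

theorem fourier_inversion:
  assumes g: "integrable lebesgue g" and b: "\<And>t. cmod (g t) \<le> M"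
  shows "is_fourier (\<lambda>s. fourier_L1 g (- s)) g"
proof -
  have g2: "g \<in> L2 UNIV" by (rule bounded_L1_in_L2[OF g b])
  define u where "u = (\<lambda>s. fourier_L1 g (- s))"
  have u: "u \<in> L2 UNIV" "l2norm u = l2norm g"
    unfolding u_def using L2_reflect[OF fourier_L1_in_L2[OF g g2]] Plancherel_bounded[OF g b] by auto
  obtain U where U: "is_fourier u U" using is_fourier_exists[OF u(1)] by blast
  have U2: "U \<in> L2 UNIV" by (rule is_fourier_L2[OF U])
  have "l2inner U g = complex_of_real ((l2norm g)\<^sup>2)"
    using fourier_adjoint[OF U u(1) g g2] l2inner_self[of u] u(2) by (simp add: u_def)
  hence "(l2norm (\<lambda>t. U t - g t))\<^sup>2 = (l2norm U)\<^sup>2 - (l2norm g)\<^sup>2"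
    unfolding l2norm_diff_sq[OF U2 g2] by (simp del: of_real_power)
  also have "(l2norm U)\<^sup>2 \<le> (l2norm u)\<^sup>2"
    by (intro power_mono is_fourier_contractive[OF U u(1)]) simp
  finally have "l2norm (\<lambda>t. U t - g t) = 0" using u(2) by simp
  hence "AE t in lebesgue. U t = g t" using l2norm_eq_0_iff[OF L2_diff[OF U2 g2]] by simp
  thus ?thesis using is_fourier_cong_AE[OF U u(1) g2] by (simp add: u_def)
qed

section \<open>No function is concentrated on two sets of finite measure\<close>

text \<open>
  Functions with spectrum in \<open>B\<close> are handled through their Fourier transforms. Boundedness is part of
  the notion because it is preserved by every construction below and gives access to Plancherel and
  inversion. The function itself is \<open>\<lambda>s. fourier_L1 g (- s)\<close>.
\<close>

definition band_data :: "(real ^ 'n) set \<Rightarrow> (real ^ 'n \<Rightarrow> complex) \<Rightarrow> bool" where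
  "band_data B g \<longleftrightarrow> g \<in> borel_measurable lebesgue \<and> (\<exists>M. \<forall>\<xi>. cmod (g \<xi>) \<le> M) \<and> (\<forall>\<xi>. \<xi> \<notin> B \<longrightarrow> g \<xi> = 0)"

lemma band_data_integrable:
  assumes B: "B \<in> lmeasurable" and g: "band_data B g"
  shows "integrable lebesgue g" "g \<in> L2 UNIV" "\<exists>M. \<forall>\<xi>. cmod (g \<xi>) \<le> M"
proof -
  obtain M where M: "\<And>\<xi>. cmod (g \<xi>) \<le> M" using g unfolding band_data_def by blast
  thus "\<exists>M. \<forall>\<xi>. cmod (g \<xi>) \<le> M" by blast
  show i: "integrable lebesgue g"
  proof (rule Bochner_Integration.integrable_bound)
    show "integrable lebesgue (\<lambda>\<xi>. M * indicator B \<xi>)"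
      using B by (intro integrable_mult_right integrable_real_indicator) (auto simp: fmeasurable_def)
    show "g \<in> borel_measurable lebesgue" using g by (simp add: band_data_def)
    show "AE \<xi> in lebesgue. norm (g \<xi>) \<le> norm (M * indicator B \<xi>)"
    proof (rule AE_I2)
      fix \<xi> show "norm (g \<xi>) \<le> norm (M * indicator B \<xi>)"
        using g order_trans[OF M abs_ge_self] by (cases "\<xi> \<in> B") (auto simp: band_data_def)
    qed
  qed
  show "g \<in> L2 UNIV" by (rule bounded_L1_in_L2[OF i M])
qed

lemma band_data_Plancherel:
  assumes "B \<in> lmeasurable" "band_data B g"
  shows "(\<lambda>s. fourier_L1 g (- s)) \<in> L2 UNIV" "l2norm (\<lambda>s. fourier_L1 g (- s)) = l2norm g"
proof -
  obtain M where M: "\<And>\<xi>. cmod (g \<xi>) \<le> M" using band_data_integrable(3)[OF assms] by blast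
  note i = band_data_integrable(1,2)[OF assms]
  show "(\<lambda>s. fourier_L1 g (- s)) \<in> L2 UNIV" "l2norm (\<lambda>s. fourier_L1 g (- s)) = l2norm g"
    using L2_reflect[OF fourier_L1_in_L2[OF i]] Plancherel_bounded[OF i(1) M] by auto
qed

lemma band_data_add:
  assumes "band_data B f" "band_data B g" shows "band_data B (\<lambda>\<xi>. f \<xi> + g \<xi>)"
proof -
  obtain M N where M: "\<And>\<xi>. cmod (f \<xi>) \<le> M" and N: "\<And>\<xi>. cmod (g \<xi>) \<le> N"
    using assms unfolding band_data_def by blast
  have "cmod (f \<xi> + g \<xi>) \<le> M + N" for \<xi>
    using norm_triangle_le[OF add_mono[OF M N]] .
  thus ?thesis using assms unfolding band_data_def by (auto intro!: exI[of _ "M + N"])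
qed

lemma band_data_mult:
  assumes "band_data B f" "h \<in> borel_measurable lebesgue" "\<And>\<xi>. cmod (h \<xi>) \<le> C"
  shows "band_data B (\<lambda>\<xi>. h \<xi> * f \<xi>)"
proof -
  obtain M where M: "\<And>\<xi>. cmod (f \<xi>) \<le> M"
    using assms unfolding band_data_def by blast
  have "cmod (h \<xi> * f \<xi>) \<le> C * M" for \<xi>
    unfolding norm_mult by (intro mult_mono M assms(3) norm_ge_zero order_trans[OF norm_ge_zero assms(3)])
  thus ?thesis using assms(1,2) unfolding band_data_def by (auto intro!: exI[of _ "C * M"])
qed

lemma band_data_cmult: "band_data B f \<Longrightarrow> band_data B (\<lambda>\<xi>. c * f \<xi>)"
  by (rule band_data_mult[where C = "cmod c"]) auto

lemma band_data_diff: "band_data B f \<Longrightarrow> band_data B g \<Longrightarrow> band_data B (\<lambda>\<xi>. f \<xi> - g \<xi>)"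
  using band_data_add[of B f "\<lambda>\<xi>. (-1) * g \<xi>"] band_data_cmult[of B g "-1"] by simp

lemma band_data_zero: "band_data B (\<lambda>\<xi>. 0)"
  by (auto simp: band_data_def)

lemma band_data_sum: "(\<And>i. i \<in> I \<Longrightarrow> band_data B (f i)) \<Longrightarrow> band_data B (\<lambda>\<xi>. \<Sum>i\<in>I. f i \<xi>)"
  by (induction I rule: infinite_finite_induct) (auto intro: band_data_add band_data_zero)

lemma Bessel_l2:
  fixes e :: "nat \<Rightarrow> real ^ 'n \<Rightarrow> complex"
  assumes e: "\<And>i. i < n \<Longrightarrow> e i \<in> L2 UNIV"
    and orth: "\<And>i j. i < n \<Longrightarrow> j < n \<Longrightarrow> l2inner (e i) (e j) = (if i = j then 1 else 0)"
    and f: "f \<in> L2 UNIV"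
  shows "(\<Sum>i<n. (cmod (l2inner f (e i)))\<^sup>2) \<le> (l2norm f)\<^sup>2"
proof -
  define c where "c = (\<lambda>i. l2inner f (e i))"
  define P where "P = (\<lambda>t. \<Sum>i<n. c i * e i t)"
  have P: "P \<in> L2 UNIV" unfolding P_def using e by (intro L2_sum L2_cmult) auto
  have Pe: "l2inner P (e j) = c j" if "j < n" for j
  proof -
    have "l2inner P (e j) = (\<Sum>i<n. c i * l2inner (e i) (e j))"
      unfolding P_def using e that by (intro l2inner_sum_left) auto
    also have "\<dots> = (\<Sum>i<n. if i = j then c i else 0)"
      using orth that by (intro sum.cong) auto
    finally show ?thesis using that by simp
  qed
  define s where "s = (\<Sum>i<n. (cmod (c i))\<^sup>2)"
  have Ph: "l2inner P h = s" if h: "h \<in> L2 UNIV" "\<And>i. i < n \<Longrightarrow> l2inner h (e i) = c i" for h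
  proof -
    have "l2inner P h = (\<Sum>i<n. c i * l2inner (e i) h)"
      unfolding P_def using e h(1) by (intro l2inner_sum_left) auto
    also have "\<dots> = (\<Sum>i<n. c i * cnj (c i))"
      using h(2) by (intro sum.cong refl) (simp add: l2inner_commute[of "e _" h])
    also have "\<dots> = s" by (simp only: s_def complex_norm_square[symmetric] of_real_sum)
    finally show ?thesis .
  qed
  have 1: "l2inner f P = s" using Ph[OF f] l2inner_commute[of f P] by (simp add: c_def)
  have 2: "(l2norm P)\<^sup>2 = s"
    using Ph[OF P Pe] l2inner_self[of P] by (simp only: of_real_eq_iff)
  have "0 \<le> (l2norm (\<lambda>t. f t - P t))\<^sup>2" by simp
  thus ?thesis unfolding l2norm_diff_sq[OF f P] 1 2 by (simp add: s_def c_def)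
qed

text \<open>
  The inverse transform of \<open>e i\<close> at \<open>s\<close> is an inner product of \<open>e i\<close> with a wave restricted to \<open>B\<close>, whose squared
  norm is \<open>\<mu>(B)\<close>. By Bessel's inequality the squares of the moduli of the inverse transforms add up to at
  most \<open>\<mu>(B)\<close> at every point; integrate this over \<open>S\<close>.
\<close>

lemma orthonormal_concentrated_count:
  fixes e :: "nat \<Rightarrow> real ^ 'n \<Rightarrow> complex"
  assumes B: "B \<in> lmeasurable" and S: "S \<in> lmeasurable"
    and e: "\<And>i. i < n \<Longrightarrow> band_data B (e i)"
    and orth: "\<And>i j. i < n \<Longrightarrow> j < n \<Longrightarrow> l2inner (e i) (e j) = (if i = j then 1 else 0)"
    and supp: "\<And>i. i < n \<Longrightarrow> AE s in lebesgue. s \<notin> S \<longrightarrow> fourier_L1 (e i) (- s) = 0"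
  shows "real n \<le> measure lebesgue B * measure lebesgue S"
proof -
  have S_sets: "S \<in> sets lebesgue" using S by auto
  have e2: "e i \<in> L2 UNIV" if "i < n" for i using band_data_integrable(2)[OF B e[OF that]] .
  define z where "z = (\<lambda>i s. fourier_L1 (e i) (- s))"
  have z: "z i \<in> L2 UNIV" "l2norm (z i) = l2norm (e i)" if "i < n" for i
    unfolding z_def using band_data_Plancherel[OF B e[OF that]] by auto
  have pointwise: "(\<Sum>i<n. (cmod (z i s))\<^sup>2) \<le> measure lebesgue B" for s
  proof -
    define \<beta> where "\<beta> = (\<lambda>\<xi>. cis (- (2 * pi * (s \<bullet> \<xi>))) * indicator B \<xi>)"
    have c: "(\<lambda>\<xi>. cis (- (2 * pi * (s \<bullet> \<xi>)))) \<in> borel_measurable lebesgue"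
      by (rule borel_imp_lebesgue_measurable) measurable
    have \<beta>: "\<beta> \<in> L2 UNIV"
      unfolding \<beta>_def using c L2_measurable[OF indicator_in_L2[OF B]]
      by (intro L2_dominated[OF indicator_in_L2[OF B], where c = 1]) (auto simp: norm_mult)
    have "(l2norm \<beta>)\<^sup>2 = (\<integral>\<xi>. indicator B \<xi> \<partial>lebesgue)"
      unfolding l2norm_sq \<beta>_def
      by (intro Bochner_Integration.integral_cong refl) (auto simp: norm_mult indicator_def)
    hence \<beta>n: "(l2norm \<beta>)\<^sup>2 = measure lebesgue B" using B by simp
    have "cmod (z i s) = cmod (l2inner \<beta> (e i))" if "i < n" for i
    proof -
      have "z i s = l2inner (e i) \<beta>"
        unfolding z_def fourier_L1_cis l2inner_def \<beta>_def
        using e[OF that] by (intro Bochner_Integration.integral_cong refl)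
         (auto simp: band_data_def indicator_def cis_cnj)
      thus ?thesis using l2inner_commute[of "e i" \<beta>] by simp
    qed
    hence "(\<Sum>i<n. (cmod (z i s))\<^sup>2) = (\<Sum>i<n. (cmod (l2inner \<beta> (e i)))\<^sup>2)" by simp
    also have "\<dots> \<le> measure lebesgue B"
      using Bessel_l2[OF e2 orth \<beta>] unfolding \<beta>n .
    finally show ?thesis .
  qed
  have zi: "integrable lebesgue (\<lambda>s. (cmod (z i s))\<^sup>2)" if "i < n" for i
    by (rule L2_integrable[OF z(1)[OF that]])
  have "real n = (\<Sum>i<n. (l2norm (z i))\<^sup>2)"
  proof -
    have "(l2norm (z i))\<^sup>2 = 1" if "i < n" for i
    proof -
      have "complex_of_real ((l2norm (z i))\<^sup>2) = complex_of_real 1"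
        using orth[OF that that] l2inner_self[of "e i"] z(2)[OF that] by simp
      thus ?thesis by (simp only: of_real_eq_iff)
    qed
    thus ?thesis by simp
  qed
  also have "\<dots> = (\<integral>s. (\<Sum>i<n. (cmod (z i s))\<^sup>2) \<partial>lebesgue)"
    unfolding l2norm_sq using zi by (subst Bochner_Integration.integral_sum) auto
  also have "\<dots> \<le> (\<integral>s. measure lebesgue B * indicator S s \<partial>lebesgue)"
  proof (rule integral_mono_AE)
    show "integrable lebesgue (\<lambda>s. \<Sum>i<n. (cmod (z i s))\<^sup>2)" using zi by auto
    show "integrable lebesgue (\<lambda>s. measure lebesgue B * indicator S s)"
      using S by (intro integrable_mult_right integrable_real_indicator) (auto simp: fmeasurable_def)
    have "AE s in lebesgue. \<forall>i\<in>{..<n}. s \<notin> S \<longrightarrow> z i s = 0"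
      by (rule AE_finite_allI) (use supp in \<open>auto simp: z_def\<close>)
    thus "AE s in lebesgue. (\<Sum>i<n. (cmod (z i s))\<^sup>2) \<le> measure lebesgue B * indicator S s"
    proof eventually_elim
      case (elim s)
      thus ?case using pointwise[of s] by (cases "s \<in> S") auto
    qed
  qed
  also have "\<dots> = measure lebesgue B * measure lebesgue S"
    using S_sets by simp
  finally show ?thesis .
qed

lemma measure_outside_ball_tendsto_0:
  fixes S :: "'a::euclidean_space set"
  assumes S: "S \<in> lmeasurable"
  shows "(\<lambda>k. measure lebesgue (S - ball 0 (real k))) \<longlonglongrightarrow> 0"
proof -
  have "(\<lambda>k. measure lebesgue (S - ball 0 (real k))) \<longlonglongrightarrow> measure lebesgue (\<Inter>k. S - ball 0 (real k))"
  proof (rule Lim_measure_decseq)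
    show "range (\<lambda>k. S - ball 0 (real k)) \<subseteq> sets lebesgue"
      using S by (auto simp: fmeasurable_def)
    show "decseq (\<lambda>k. S - ball 0 (real k))"
      by (auto simp: decseq_def)
    show "emeasure lebesgue (S - ball 0 (real k)) \<noteq> \<infinity>" for k
      using fmeasurableD2[OF fmeasurable_Diff[OF S, of "ball 0 (real k)"]] by simp
  qed
  moreover have "(\<Inter>k. S - ball 0 (real k)) = {}"
    using reals_Archimedean2 by (fastforce simp: not_less[symmetric])
  ultimately show ?thesis by (simp only: measure_empty)
qed

text \<open>
  The measure of the part of the translate outside \<open>T\<close> depends continuously on the translation, is 0 for the zero
  translation and positive for a long one, so it takes all small positive values.
\<close>

lemma translate_partially_outside:
  fixes S T :: "'a::euclidean_space set"
  assumes S: "S \<in> lmeasurable" and T: "T \<in> lmeasurable" and "S \<subseteq> T" and pos: "measure lebesgue S > 0" and "e > 0"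
  obtains a where "measure lebesgue ((+) a ` S - T) > 0" "measure lebesgue ((+) a ` S - T) < e"
proof -
  define \<phi> where "\<phi> = (\<lambda>a. measure lebesgue ((+) a ` S - T))"
  have tS: "(+) a ` S \<in> lmeasurable" for a by (rule measurable_translation[OF S])
  have step: "\<phi> a \<le> \<phi> b + measure lebesgue ((+) (a - b) ` S - S)" for a b
  proof -
    have "(+) a ` S - T \<subseteq> ((+) b ` S - T) \<union> ((+) b ` ((+) (a - b) ` S - S))"
    proof
      fix x assume x: "x \<in> (+) a ` S - T"
      then obtain s where s: "s \<in> S" "x = a + s" by auto
      have "x \<in> (+) b ` ((+) (a - b) ` S - S)" if "x \<notin> (+) b ` S"
      proof (rule image_eqI)
        show "x = b + (x - b)" by simp
        have "x - b \<notin> S" using that by (metis add_diff_cancel_left' diff_add_cancel image_eqI add.commute)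
        moreover have "x - b = (a - b) + s" using s by simp
        ultimately show "x - b \<in> (+) (a - b) ` S - S" using s(1) by blast
      qed
      thus "x \<in> ((+) b ` S - T) \<union> ((+) b ` ((+) (a - b) ` S - S))" using x by blast
    qed
    hence "\<phi> a \<le> measure lebesgue (((+) b ` S - T) \<union> ((+) b ` ((+) (a - b) ` S - S)))"
      unfolding \<phi>_def by (rule measure_mono_fmeasurable)
        (intro fmeasurableD fmeasurable.Diff fmeasurable.Un measurable_translation S T)+
    also have "\<dots> \<le> \<phi> b + measure lebesgue ((+) b ` ((+) (a - b) ` S - S))"
      unfolding \<phi>_def by (intro measure_Un_le fmeasurableD fmeasurable.Diff measurable_translation S T)
    finally show ?thesis by (simp only: measure_translation)
  qed
  have cont: "continuous_on UNIV \<phi>"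
    unfolding continuous_on_iff
  proof (intro ballI allI impI)
    fix a and d :: real assume "d > 0"
    obtain r where r: "r > 0" "\<And>b. norm b < r \<Longrightarrow> measure lebesgue ((+) b ` S - S) < d"
      using translate_diff_small[OF S \<open>d > 0\<close>] by blast
    show "\<exists>r>0. \<forall>b\<in>UNIV. dist b a < r \<longrightarrow> dist (\<phi> b) (\<phi> a) < d"
    proof (intro exI[of _ r] conjI ballI impI r(1))
      fix b assume "dist b a < r"
      hence "norm (b - a) < r" "norm (a - b) < r" by (simp_all add: dist_norm norm_minus_commute)
      thus "dist (\<phi> b) (\<phi> a) < d"
        using step[of a b] step[of b a] r(2)[of "a - b"] r(2)[of "b - a"] by (simp add: dist_real_def)
    qed
  qed
  have \<phi>0: "\<phi> 0 = 0"
  proof -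
    have "(+) 0 ` S - T = {}" using \<open>S \<subseteq> T\<close> by auto
    thus ?thesis unfolding \<phi>_def by (simp only: measure_empty)
  qed
  obtain a where a: "\<phi> a > 0"
  proof -
    \<comment> \<open>Both sets are concentrated in a ball of radius \<open>R\<close>, which a translation by \<open>2 R\<close> moves off itself.\<close>
    define m where "m = measure lebesgue S"
    obtain K1 where K1: "\<And>k. k \<ge> K1 \<Longrightarrow> measure lebesgue (S - ball 0 (real k)) < m / 2"
      using LIMSEQ_D[OF measure_outside_ball_tendsto_0[OF S], of "m / 2"] pos by (auto simp: m_def)
    obtain K2 where K2: "\<And>k. k \<ge> K2 \<Longrightarrow> measure lebesgue (T - ball 0 (real k)) < m / 2"
      using LIMSEQ_D[OF measure_outside_ball_tendsto_0[OF T], of "m / 2"] pos by (auto simp: m_def)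
    define R where "R = max K1 K2"
    obtain a :: 'a where a: "norm a = 2 * real R"
      using vector_choose_size[of "2 * real R"] by auto
    define X where "X = (+) a ` S"
    have "X \<inter> T \<subseteq> (+) a ` (S - ball 0 (real R)) \<union> (T - ball 0 (real R))"
    proof
      fix x assume x: "x \<in> X \<inter> T"
      then obtain s where s: "s \<in> S" "x = a + s" by (auto simp: X_def)
      have "norm x \<ge> real R" if "norm s < real R"
        using norm_triangle_ineq4[of x s] a s(2) that by simp
      thus "x \<in> (+) a ` (S - ball 0 (real R)) \<union> (T - ball 0 (real R))"
        using s x by (auto simp: not_less)
    qed
    hence "measure lebesgue (X \<inter> T) \<le> measure lebesgue ((+) a ` (S - ball 0 (real R)) \<union> (T - ball 0 (real R)))"
      unfolding X_def by (rule measure_mono_fmeasurable)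
        (intro fmeasurableD fmeasurable.Diff fmeasurable.Un fmeasurable.Int measurable_translation S T lmeasurable_ball)+
    also have "\<dots> \<le> measure lebesgue ((+) a ` (S - ball 0 (real R))) + measure lebesgue (T - ball 0 (real R))"
      by (intro measure_Un_le fmeasurableD fmeasurable.Diff measurable_translation S T lmeasurable_ball)
    also have "\<dots> < m" using K1[of R] K2[of R] by (simp add: measure_translation R_def)
    finally have "measure lebesgue (X \<inter> T) < m" .
    moreover have "measure lebesgue (X - T) = measure lebesgue X - measure lebesgue (X \<inter> T)"
    proof -
      have "measure lebesgue (X - X \<inter> T) = measure lebesgue X - measure lebesgue (X \<inter> T)"
        using tS[of a] T by (intro measurable_measure_Diff) (auto simp: X_def)
      thus ?thesis by (simp add: Diff_Int_distrib Diff_Int)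
    qed
    moreover have "measure lebesgue X = m" unfolding X_def m_def by (rule measure_translation)
    ultimately have "\<phi> a > 0" by (simp add: \<phi>_def X_def)
    thus ?thesis by (rule that)
  qed
  define c where "c = min (\<phi> a) e / 2"
  have c: "c > 0" "c < e" "c \<le> \<phi> a" using a \<open>e > 0\<close> by (auto simp: c_def)
  have "\<exists>t\<ge>0. t \<le> 1 \<and> \<phi> (t *\<^sub>R a) = c"
  proof (rule IVT')
    show "\<phi> (0 *\<^sub>R a) \<le> c" "c \<le> \<phi> (1 *\<^sub>R a)" using c \<phi>0 by auto
    show "continuous_on {0..1} (\<lambda>t. \<phi> (t *\<^sub>R a))"
      by (rule continuous_on_compose2[OF cont]) (auto intro!: continuous_intros)
  qed simp
  then obtain t where "\<phi> (t *\<^sub>R a) = c" by blast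
  thus ?thesis using c that[of "t *\<^sub>R a"] by (simp add: \<phi>_def)
qed

text \<open>
  Otherwise let \<open>z\<close> be the nonzero function with transform \<open>g\<close>, and \<open>S0\<close> the set where it lives. Translations
  of \<open>z\<close> still have spectrum in \<open>B\<close>. Translating it so that it leaves the set \<open>T\<close> reached so far on a set of small
  positive measure gives a function independent of the previous ones, since those vanish outside
  \<open>T\<close>. Gram-Schmidt turns it into one more orthonormal function, and \<open>n\<close> of them, living on
  a set of measure at most \<open>\<mu>(S0) + 1\<close>, contradict the counting bound when \<open>n\<close> is large.
\<close>

theorem Amrein_Berthier:
  fixes g :: "real ^ 'n \<Rightarrow> complex"
  assumes B: "B \<in> lmeasurable" and S: "S \<in> lmeasurable" and g: "band_data B g"
    and supp: "AE s in lebesgue. s \<notin> S \<longrightarrow> fourier_L1 g (- s) = 0"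
  shows "l2norm g = 0"
proof (rule ccontr)
  assume g0: "l2norm g \<noteq> 0"
  define z where "z = (\<lambda>s. fourier_L1 g (- s))"
  have z: "z \<in> L2 UNIV" "l2norm z = l2norm g"
    unfolding z_def using band_data_Plancherel[OF B g] by auto
  note z_meas [measurable] = L2_measurable[OF z(1)]
  define S0 where "S0 = {s. z s \<noteq> 0}"
  have S0_sets: "S0 \<in> sets lebesgue"
    using measurable_sets[OF z_meas, of "- {0}"] by (simp add: S0_def vimage_def)
  have "emeasure lebesgue S0 \<le> emeasure lebesgue S"
    using supp S by (intro emeasure_mono_AE) (auto simp: S0_def z_def)
  hence S0: "S0 \<in> lmeasurable" using S S0_sets by (auto simp: fmeasurable_def intro: le_less_trans)
  have S0_pos: "measure lebesgue S0 > 0"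
  proof (rule ccontr)
    assume "\<not> measure lebesgue S0 > 0"
    hence "measure lebesgue S0 = 0" using measure_nonneg[of lebesgue S0] by linarith
    hence "S0 \<in> null_sets lebesgue"
      by (intro null_setsI S0_sets) (simp only: emeasure_eq_measure2[OF S0] ennreal_0)
    hence "AE s in lebesgue. z s = 0" by (rule AE_I') (simp add: S0_def)
    thus False using z g0 l2norm_eq_0_iff[OF z(1)] by simp
  qed
  define n where "n = Suc (nat \<lceil>measure lebesgue B * (measure lebesgue S0 + 1)\<rceil>)"
  \<comment> \<open>Each of the \<open>n\<close> steps may enlarge the set by \<open>\<epsilon>\<close>, which adds up to 1.\<close>
  define \<epsilon> where "\<epsilon> = 1 / real n"
  have n_pos: "n > 0" by (simp add: n_def)
  hence \<epsilon>: "\<epsilon> > 0" by (simp add: \<epsilon>_def)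
  have n_big: "measure lebesgue B * (measure lebesgue S0 + 1) < real n"
    unfolding n_def by linarith
  have "\<exists>T e. T \<in> lmeasurable \<and> S0 \<subseteq> T \<and> measure lebesgue T \<le> measure lebesgue S0 + real k * \<epsilon> \<and>
     (\<forall>i<k. band_data B (e i)) \<and> (\<forall>i<k. \<forall>j<k. l2inner (e i) (e j) = (if i = j then 1 else 0)) \<and>
     (\<forall>i<k. AE s in lebesgue. s \<notin> T \<longrightarrow> fourier_L1 (e i) (- s) = 0)" for k
  proof (induction k)
    case 0
    show ?case using S0 by (intro exI[of _ S0]) auto
  next
    case (Suc k)
    from Suc.IH obtain T e where T: "T \<in> lmeasurable" "S0 \<subseteq> T" "measure lebesgue T \<le> measure lebesgue S0 + real k * \<epsilon>"
      and e: "\<And>i. i < k \<Longrightarrow> band_data B (e i)"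
      and orth: "\<And>i j. i < k \<Longrightarrow> j < k \<Longrightarrow> l2inner (e i) (e j) = (if i = j then 1 else 0)"
      and e_supp: "\<And>i. i < k \<Longrightarrow> AE s in lebesgue. s \<notin> T \<longrightarrow> fourier_L1 (e i) (- s) = 0"
      by blast
    obtain a where a: "measure lebesgue ((+) a ` S0 - T) > 0" "measure lebesgue ((+) a ` S0 - T) < \<epsilon>"
      by (rule translate_partially_outside[OF S0 T(1,2) S0_pos \<epsilon>])
    define D where "D = (+) a ` S0 - T"
    have D: "D \<in> lmeasurable" unfolding D_def by (intro fmeasurable.Diff measurable_translation S0 T)
    define T' where "T' = T \<union> D"
    have T': "T' \<in> lmeasurable" "S0 \<subseteq> T'" unfolding T'_def using T D by auto
    have "measure lebesgue T' \<le> measure lebesgue T + measure lebesgue D"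
      unfolding T'_def using T D by (intro measure_Un_le) auto
    hence T'_meas: "measure lebesgue T' \<le> measure lebesgue S0 + real (Suc k) * \<epsilon>"
      using T(3) a(2) by (simp add: D_def algebra_simps)
    \<comment> \<open>A modulation in frequency is the translation of \<open>z\<close> by \<open>a\<close>.\<close>
    define f where "f = (\<lambda>\<xi>. cis (- (2 * pi * (a \<bullet> \<xi>))) * g \<xi>)"
    have f: "band_data B f"
      unfolding f_def by (rule band_data_mult[OF g, where C = 1], rule borel_imp_lebesgue_measurable) auto
    have f_hat: "fourier_L1 f (- s) = z (s - a)" for s
      unfolding f_def fourier_L1_modulate z_def by simp
    define p where "p = (\<lambda>\<xi>. f \<xi> - (\<Sum>i<k. l2inner f (e i) * e i \<xi>))"
    have p: "band_data B p"
      unfolding p_def using f e by (intro band_data_diff band_data_sum band_data_cmult) auto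
    have f2: "f \<in> L2 UNIV" and e2: "\<And>i. i < k \<Longrightarrow> e i \<in> L2 UNIV" and p2: "p \<in> L2 UNIV"
      using band_data_integrable(2)[OF B] f e p by auto
    have fi: "integrable lebesgue f" and ei: "\<And>i. i < k \<Longrightarrow> integrable lebesgue (e i)"
      using band_data_integrable(1)[OF B] f e by auto
    have p_hat: "fourier_L1 p (- s) = z (s - a) - (\<Sum>i<k. l2inner f (e i) * fourier_L1 (e i) (- s))" for s
    proof -
      have "fourier_L1 p (- s) = fourier_L1 f (- s) - fourier_L1 (\<lambda>\<xi>. \<Sum>i<k. l2inner f (e i) * e i \<xi>) (- s)"
        unfolding p_def using fi ei by (intro fourier_L1_diff Bochner_Integration.integrable_sum integrable_mult_right) auto
      also have "fourier_L1 (\<lambda>\<xi>. \<Sum>i<k. l2inner f (e i) * e i \<xi>) (- s) = (\<Sum>i<k. fourier_L1 (\<lambda>\<xi>. l2inner f (e i) * e i \<xi>) (- s))"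
        using ei by (intro fourier_L1_sum integrable_mult_right) auto
      finally show ?thesis by (simp only: f_hat fourier_L1_cmult)
    qed
    have all_e: "AE s in lebesgue. \<forall>i\<in>{..<k}. s \<notin> T \<longrightarrow> fourier_L1 (e i) (- s) = 0"
      by (rule AE_finite_allI) (use e_supp in auto)
    have p_nz: "l2norm p \<noteq> 0"
    proof
      assume "l2norm p = 0"
      hence p0: "AE \<xi> in lebesgue. p \<xi> = 0" using l2norm_eq_0_iff[OF p2] by simp
      have ph0: "fourier_L1 p (- s) = 0" for s
        using fourier_L1_cong_AE[OF L2_measurable[OF p2] _ p0, of "- s"] by (simp add: fourier_L1_cis)
      have "AE s in lebesgue. s \<notin> D"
        using all_e
      proof eventually_elim
        case (elim s)
        show ?case
        proof
          assume s: "s \<in> D"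
          hence "z (s - a) = 0" using elim p_hat[of s] ph0[of s] by (simp add: D_def)
          moreover have "s - a \<in> S0" using s by (auto simp: D_def)
          ultimately show False by (simp add: S0_def)
        qed
      qed
      hence "emeasure lebesgue D = 0"
        using AE_iff_measurable[of D lebesgue "\<lambda>s. s \<notin> D"] D by (auto simp: fmeasurable_def)
      thus False using a(1) by (simp add: D_def measure_def)
    qed
    define e' where "e' = e(k := (\<lambda>\<xi>. complex_of_real (1 / l2norm p) * p \<xi>))"
    have p_orth: "l2inner p (e j) = 0" if "j < k" for j
    proof -
      have "l2inner p (e j) = l2inner f (e j) - l2inner (\<lambda>\<xi>. \<Sum>i<k. l2inner f (e i) * e i \<xi>) (e j)"
        unfolding p_def using f2 e2 that by (intro l2inner_diff_left L2_sum L2_cmult) auto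
      also have "l2inner (\<lambda>\<xi>. \<Sum>i<k. l2inner f (e i) * e i \<xi>) (e j) = (\<Sum>i<k. l2inner f (e i) * l2inner (e i) (e j))"
        using e2 that by (intro l2inner_sum_left) auto
      also have "\<dots> = (\<Sum>i<k. if i = j then l2inner f (e i) else 0)"
        using orth that by (intro sum.cong) auto
      finally show ?thesis using that by simp
    qed
    have e'_k: "e' k = (\<lambda>\<xi>. complex_of_real (1 / l2norm p) * p \<xi>)" and e'_i: "\<And>i. i < k \<Longrightarrow> e' i = e i"
      by (simp_all add: e'_def)
    have n1: "l2inner (e' k) (e' i) = 0" if "i < k" for i
      unfolding e'_k e'_i[OF that] l2inner_cmult_left p_orth[OF that] by simp
    have n2: "l2inner (e' i) (e' k) = 0" if "i < k" for i
      using n1[OF that] l2inner_commute[of "e' i" "e' k"] by simp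
    have n3: "l2inner (e' k) (e' k) = 1"
    proof -
      have "l2norm (e' k) = 1"
        unfolding e'_k l2norm_cmult using p_nz by (simp add: norm_divide)
      thus ?thesis by (simp add: l2inner_self)
    qed
    have "l2inner (e' i) (e' j) = (if i = j then 1 else 0)" if "i < Suc k" "j < Suc k" for i j
    proof -
      have "i < k \<or> i = k" "j < k \<or> j = k" using that by auto
      thus ?thesis using orth n1 n2 n3 by (auto simp: e'_i)
    qed
    moreover have "band_data B (e' i)" if "i < Suc k" for i
    proof -
      have "i < k \<or> i = k" using that by auto
      moreover have "band_data B (e' k)" unfolding e'_k by (rule band_data_cmult[OF p])
      ultimately show ?thesis using e by (auto simp: e'_i)
    qed
    moreover have "AE s in lebesgue. s \<notin> T' \<longrightarrow> fourier_L1 (e' i) (- s) = 0" if "i < Suc k" for i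
      using all_e
    proof eventually_elim
      case (elim s)
      show ?case
      proof
        assume s: "s \<notin> T'"
        hence sT: "s \<notin> T" "s \<notin> D" by (auto simp: T'_def)
        have "s - a \<notin> S0"
        proof
          assume "s - a \<in> S0"
          hence "a + (s - a) \<in> (+) a ` S0" by (rule imageI)
          thus False using sT by (simp add: D_def)
        qed
        hence "fourier_L1 p (- s) = 0" using elim sT by (simp add: p_hat S0_def)
        hence "fourier_L1 (e' k) (- s) = 0" unfolding e'_k fourier_L1_cmult by simp
        moreover have "i < k \<or> i = k" using that by auto
        ultimately show "fourier_L1 (e' i) (- s) = 0"
          using elim sT by (auto simp: e'_i)
      qed
    qed
    ultimately show ?case using T' T'_meas by blast
  qed
  from this[of n] obtain T e where T: "T \<in> lmeasurable" "measure lebesgue T \<le> measure lebesgue S0 + real n * \<epsilon>"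
    and e: "\<forall>i<n. band_data B (e i)" "\<forall>i<n. \<forall>j<n. l2inner (e i) (e j) = (if i = j then 1 else 0)"
      "\<forall>i<n. AE s in lebesgue. s \<notin> T \<longrightarrow> fourier_L1 (e i) (- s) = 0"
    by blast
  have "real n \<le> measure lebesgue B * measure lebesgue T"
    using e by (intro orthonormal_concentrated_count[OF B T(1), where e = e]) auto
  also have "\<dots> \<le> measure lebesgue B * (measure lebesgue S0 + 1)"
    using T(2) n_pos by (intro mult_left_mono) (auto simp: \<epsilon>_def)
  finally show False using n_big by simp
qed

section \<open>Strong annihilation\<close>

lemma l2inner_diff_right: "f \<in> L2 UNIV \<Longrightarrow> g \<in> L2 UNIV \<Longrightarrow> h \<in> L2 UNIV \<Longrightarrow>
   l2inner h (\<lambda>t. f t - g t) = l2inner h f - l2inner h g"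
  using l2inner_diff_left[of f g h] by (metis complex_cnj_diff l2inner_commute)

lemma indicator_mult_eq_self: "(\<And>t. t \<notin> S \<Longrightarrow> f t = 0) \<Longrightarrow> (\<lambda>t. indicator S t * f t) = (f :: _ \<Rightarrow> complex)"
  by (rule ext) (auto simp: indicator_def)

lemma band_data_restrict_fourier:
  assumes B: "B \<in> lmeasurable" and y: "integrable lebesgue y"
  shows "band_data B (\<lambda>\<xi>. indicator B \<xi> * fourier_L1 y \<xi>)"
proof -
  have "cmod (indicator B \<xi> * fourier_L1 y \<xi>) \<le> (\<integral>t. cmod (y t) \<partial>lebesgue)" for \<xi>
    using fourier_L1_bound[of y \<xi>] by (auto simp: indicator_def)
  moreover have "B \<in> sets lebesgue" using B by auto
  ultimately show ?thesis
    using fourier_L1_measurable[OF y] unfolding band_data_def by auto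
qed

text \<open>
  Suppose that unit functions \<open>y k\<close> on \<open>S\<close> have norm more than \<open>1 - 1 / (k + 1)\<close> left after their spectrum is
  restricted to \<open>B\<close>. As \<open>S\<close> has finite measure, their transforms are inner products with the waves \<open>\<beta> \<xi>\<close>
  restricted to \<open>S\<close>, hence uniformly bounded and equicontinuous, and a subsequence converges everywhere; as \<open>B\<close> has
  finite measure, it converges in norm on \<open>B\<close>. Since \<open>y (r n)\<close> differs from its part \<open>Z n\<close> with spectrum in \<open>B\<close>
  by a vanishing amount, \<open>y (r n)\<close> itself converges, to a unit function \<open>z\<close> that lives on \<open>S\<close> and has spectrum in
  \<open>B\<close>, contrary to \<open>Amrein_Berthier\<close>.
\<close>

theorem strong_annihilation:
  fixes S B :: "(real ^ 'n) set"
  assumes S: "S \<in> lmeasurable" and B: "B \<in> lmeasurable"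
  shows "\<exists>\<rho>. 0 \<le> \<rho> \<and> \<rho> < 1 \<and> (\<forall>y\<in>L2 UNIV. (\<forall>t. t \<notin> S \<longrightarrow> y t = 0) \<longrightarrow>
      l2norm (\<lambda>\<xi>. indicator B \<xi> * fourier_L1 y \<xi>) \<le> \<rho> * l2norm y)"
proof (rule ccontr)
  assume contra: "\<not> ?thesis"
  have neg: "\<exists>y\<in>L2 UNIV. (\<forall>t. t \<notin> S \<longrightarrow> y t = 0) \<and>
      l2norm (\<lambda>\<xi>. indicator B \<xi> * fourier_L1 y \<xi>) > \<rho> * l2norm y" if "0 \<le> \<rho>" "\<rho> < 1" for \<rho>
    using contra that by (meson not_le)
  have S_sets: "S \<in> sets lebesgue" and B_sets: "B \<in> sets lebesgue" using S B by auto
  have y_int: "integrable lebesgue y" if "y \<in> L2 UNIV" "\<And>t. t \<notin> S \<Longrightarrow> y t = 0" for y :: "real ^ 'n \<Rightarrow> complex"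
  proof -
    have "(\<lambda>t. indicator S t * y t) = y" by (rule indicator_mult_eq_self) (rule that(2))
    thus ?thesis using L2_integrable_restrict[OF S that(1)] by simp
  qed
  have band_le: "l2norm (\<lambda>\<xi>. indicator B \<xi> * fourier_L1 y \<xi>) \<le> l2norm y"
    if "y \<in> L2 UNIV" "\<And>t. t \<notin> S \<Longrightarrow> y t = 0" for y :: "real ^ 'n \<Rightarrow> complex"
  proof -
    note yi = y_int[OF that]
    have "l2norm (\<lambda>\<xi>. indicator B \<xi> * fourier_L1 y \<xi>) \<le> l2norm (fourier_L1 y)"
      using band_data_restrict_fourier[OF B yi]
      by (intro l2norm_mono fourier_L1_in_L2 yi that) (auto simp: band_data_def indicator_def)
    also have "\<dots> \<le> l2norm y" by (rule fourier_L1_contractive[OF yi that(1)])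
    finally show ?thesis .
  qed
  have "\<exists>y. y \<in> L2 UNIV \<and> (\<forall>t. t \<notin> S \<longrightarrow> y t = 0) \<and> l2norm y = 1 \<and>
      l2norm (\<lambda>\<xi>. indicator B \<xi> * fourier_L1 y \<xi>) > 1 - 1 / real (Suc k)" for k
  proof -
    define \<rho> where "\<rho> = 1 - 1 / real (Suc k)"
    have "0 \<le> \<rho>" "\<rho> < 1" by (auto simp: \<rho>_def)
    then obtain y where y: "y \<in> L2 UNIV" "\<And>t. t \<notin> S \<Longrightarrow> y t = 0"
       "l2norm (\<lambda>\<xi>. indicator B \<xi> * fourier_L1 y \<xi>) > \<rho> * l2norm y"
      using neg by blast
    have y0: "l2norm y > 0"
    proof (rule ccontr)
      assume "\<not> l2norm y > 0"
      hence "l2norm y = 0" using l2norm_nonneg[of y] by linarith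
      thus False using y(3) band_le[OF y(1,2)] by simp
    qed
    define c where "c = complex_of_real (1 / l2norm y)"
    have c: "cmod c = 1 / l2norm y" using y0 by (simp add: c_def norm_divide)
    have "(\<lambda>\<xi>. indicator B \<xi> * fourier_L1 (\<lambda>t. c * y t) \<xi>) = (\<lambda>\<xi>. c * (indicator B \<xi> * fourier_L1 y \<xi>))"
      by (simp add: fourier_L1_cmult mult_ac)
    hence "l2norm (\<lambda>\<xi>. indicator B \<xi> * fourier_L1 (\<lambda>t. c * y t) \<xi>) > \<rho>"
      using y(3) y0 by (simp add: l2norm_cmult c field_simps)
    moreover have "l2norm (\<lambda>t. c * y t) = 1" using y0 by (simp add: l2norm_cmult c)
    ultimately show ?thesis
      using y(1,2) by (intro exI[of _ "\<lambda>t. c * y t"]) (auto simp: \<rho>_def)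
  qed
  then obtain y where y: "\<And>k. y k \<in> L2 UNIV" "\<And>k t. t \<notin> S \<Longrightarrow> y k t = 0" "\<And>k. l2norm (y k) = 1"
    "\<And>k::nat. l2norm (\<lambda>\<xi>. indicator B \<xi> * fourier_L1 (y k) \<xi>) > 1 - 1 / real (Suc k)"
    by metis
  note yi = y_int[OF y(1,2)]
  define \<beta> where "\<beta> = (\<lambda>(\<xi>::real^'n) t. indicator S t * cis (2 * pi * (\<xi> \<bullet> t)))"
  have cis_leb: "(\<lambda>t::real^'n. cis (2 * pi * (\<xi> \<bullet> t))) \<in> borel_measurable lebesgue" for \<xi>
    by (rule borel_imp_lebesgue_measurable) measurable
  have \<beta>_meas [measurable]: "\<beta> \<xi> \<in> borel_measurable lebesgue" for \<xi>
    unfolding \<beta>_def by (rule borel_measurable_times[OF L2_measurable[OF indicator_in_L2[OF S]] cis_leb])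
  have \<beta>: "\<beta> \<xi> \<in> L2 UNIV" for \<xi>
    by (rule L2_dominated[OF indicator_in_L2[OF S] \<beta>_meas, where c = 1]) (auto simp: \<beta>_def norm_mult)
  have F_inner: "fourier_L1 (y k) \<xi> = l2inner (y k) (\<beta> \<xi>)" for k \<xi>
    unfolding fourier_L1_cis l2inner_def \<beta>_def
    using y(2)[of _ k] by (intro Bochner_Integration.integral_cong refl) (auto simp: indicator_def cis_cnj)
  define C where "C = l2norm (\<lambda>t. indicator S t :: complex)"
  have \<beta>_norm: "l2norm (\<beta> \<xi>) \<le> C" for \<xi>
    unfolding C_def by (rule l2norm_mono[OF indicator_in_L2[OF S] \<beta>_meas]) (simp add: \<beta>_def norm_mult)
  have F_bound: "cmod (fourier_L1 (y k) \<xi>) \<le> C" for k \<xi>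
    using order_trans[OF Cauchy_Schwarz_l2[OF y(1) \<beta>, of k \<xi>]] \<beta>_norm[of \<xi>]
    unfolding F_inner y(3) by simp
  have F_diff: "cmod (fourier_L1 (y k) \<xi> - fourier_L1 (y k) \<xi>') \<le> l2norm (\<lambda>t. \<beta> \<xi> t - \<beta> \<xi>' t)" for k \<xi> \<xi>'
    using Cauchy_Schwarz_l2[OF y(1) L2_diff[OF \<beta> \<beta>], of k \<xi> \<xi>']
    unfolding F_inner y(3) l2inner_diff_right[OF \<beta> \<beta> y(1), symmetric] by simp
  have \<beta>_cont: "(\<lambda>j. l2norm (\<lambda>t. \<beta> (X j) t - \<beta> \<xi> t)) \<longlonglongrightarrow> 0" if X: "X \<longlonglongrightarrow> \<xi>" for X \<xi>
  proof (rule l2norm_tendsto_dominated[OF \<beta>_meas \<beta>_meas L2_cmult[OF indicator_in_L2[OF S], of 2]])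
    show "(\<lambda>j. \<beta> (X j) t) \<longlonglongrightarrow> \<beta> \<xi> t" for t
      unfolding \<beta>_def cis_conv_exp by (intro tendsto_intros X)
    show "cmod (\<beta> (X j) t - \<beta> \<xi> t) \<le> cmod (2 * indicator S t)" for j t
      using norm_triangle_ineq4[of "\<beta> (X j) t" "\<beta> \<xi> t"] by (cases "t \<in> S") (simp_all add: \<beta>_def norm_mult)
  qed
  \<comment> \<open>A diagonal subsequence converges on a countable dense set, and equicontinuity carries this to all points.\<close>
  obtain D :: "(real ^ 'n) set" where D: "countable D" "D \<subseteq> UNIV" "UNIV \<subseteq> closure D"
    by (rule separable[of "UNIV :: (real ^ 'n) set"]) (rule that)
  obtain r :: "nat \<Rightarrow> nat" where r: "strict_mono r" "\<And>x. x \<in> D \<Longrightarrow> \<exists>l. (\<lambda>n. fourier_L1 (y (r n)) x) \<longlonglongrightarrow> l"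
    by (rule function_convergent_subsequence[OF D(1), of "\<lambda>n. fourier_L1 (y n)" C]) (rule F_bound, rule that)
  have conv: "convergent (\<lambda>n. fourier_L1 (y (r n)) \<xi>)" for \<xi>
  proof (rule Cauchy_convergent, rule metric_CauchyI)
    fix e :: real assume "e > 0"
    have "\<xi> \<in> closure D" using D(3) by auto
    then obtain X where X: "\<And>j. X j \<in> D" "X \<longlonglongrightarrow> \<xi>"
      unfolding closure_sequential by blast
    obtain j where "l2norm (\<lambda>t. \<beta> (X j) t - \<beta> \<xi> t) < e / 3"
      using LIMSEQ_D[OF \<beta>_cont[OF X(2)], of "e / 3"] \<open>e > 0\<close> by auto
    hence j: "cmod (fourier_L1 (y k) (X j) - fourier_L1 (y k) \<xi>) < e / 3" for k
      using F_diff[of k "X j" \<xi>] by linarith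
    have "Cauchy (\<lambda>n. fourier_L1 (y (r n)) (X j))"
      using r(2)[OF X(1)] by (auto simp: convergent_def intro: convergent_Cauchy)
    then obtain N where N: "\<And>m n. m \<ge> N \<Longrightarrow> n \<ge> N \<Longrightarrow> dist (fourier_L1 (y (r m)) (X j)) (fourier_L1 (y (r n)) (X j)) < e / 3"
      using metric_CauchyD[OF _ , of "\<lambda>n. fourier_L1 (y (r n)) (X j)" "e / 3"] \<open>e > 0\<close> by auto
    show "\<exists>M. \<forall>m\<ge>M. \<forall>n\<ge>M. dist (fourier_L1 (y (r m)) \<xi>) (fourier_L1 (y (r n)) \<xi>) < e"
    proof (intro exI[of _ N] allI impI)
      fix m n assume "m \<ge> N" "n \<ge> N"
      have "dist (fourier_L1 (y (r m)) \<xi>) (fourier_L1 (y (r n)) \<xi>)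
        \<le> dist (fourier_L1 (y (r m)) \<xi>) (fourier_L1 (y (r m)) (X j)) + (dist (fourier_L1 (y (r m)) (X j)) (fourier_L1 (y (r n)) (X j))
           + dist (fourier_L1 (y (r n)) (X j)) (fourier_L1 (y (r n)) \<xi>))"
        by (intro order_trans[OF dist_triangle add_left_mono[OF dist_triangle]])
      also have "\<dots> < e / 3 + (e / 3 + e / 3)"
        using j[of "r m"] j[of "r n"] N[OF \<open>m \<ge> N\<close> \<open>n \<ge> N\<close>]
        by (intro add_strict_mono) (auto simp: dist_norm norm_minus_commute)
      finally show "dist (fourier_L1 (y (r m)) \<xi>) (fourier_L1 (y (r n)) \<xi>) < e" by simp
    qed
  qed
  define w where "w = (\<lambda>\<xi>. lim (\<lambda>n. fourier_L1 (y (r n)) \<xi>))"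
  have w: "(\<lambda>n. fourier_L1 (y (r n)) \<xi>) \<longlonglongrightarrow> w \<xi>" for \<xi>
    using conv[of \<xi>] by (simp add: w_def convergent_LIMSEQ_iff)
  have w_bound: "cmod (w \<xi>) \<le> C" for \<xi>
    by (rule LIMSEQ_le_const2[OF tendsto_norm[OF w]]) (use F_bound in auto)
  note [measurable] = fourier_L1_measurable[OF yi]
  have w_meas: "w \<in> borel_measurable lebesgue"
    unfolding w_def by measurable
  define g where "g = (\<lambda>\<xi>. indicator B \<xi> * w \<xi>)"
  define G where "G = (\<lambda>n \<xi>. indicator B \<xi> * fourier_L1 (y (r n)) \<xi>)"
  have G: "band_data B (G n)" for n unfolding G_def by (rule band_data_restrict_fourier[OF B yi])
  have C_nonneg: "C \<ge> 0" by (simp add: C_def)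
  have g: "band_data B g"
    using w_meas B_sets w_bound C_nonneg unfolding band_data_def g_def
    by (auto simp: norm_mult indicator_def intro!: exI[of _ C])
  have g2: "g \<in> L2 UNIV" and G2: "\<And>n. G n \<in> L2 UNIV" and gi: "integrable lebesgue g" and Gi: "\<And>n. integrable lebesgue (G n)"
    using band_data_integrable(1,2)[OF B] g G by auto
  note [measurable] = L2_measurable[OF g2] L2_measurable[OF G2]
  have Gg: "(\<lambda>n. l2norm (\<lambda>\<xi>. G n \<xi> - g \<xi>)) \<longlonglongrightarrow> 0"
  proof (rule l2norm_tendsto_dominated[OF _ _ L2_cmult[OF indicator_in_L2[OF B], of "complex_of_real (2 * C)"]])
    show "(\<lambda>n. G n \<xi>) \<longlonglongrightarrow> g \<xi>" for \<xi>
      unfolding G_def g_def by (intro tendsto_intros w)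
    have "cmod (fourier_L1 (y (r n)) \<xi> - w \<xi>) \<le> 2 * C" for n \<xi>
      using norm_triangle_ineq4[of "fourier_L1 (y (r n)) \<xi>" "w \<xi>"] F_bound[of "r n" \<xi>] w_bound[of \<xi>] by linarith
    thus "cmod (G n \<xi> - g \<xi>) \<le> cmod (complex_of_real (2 * C) * indicator B \<xi>)" for n \<xi>
      using C_nonneg by (cases "\<xi> \<in> B") (simp_all add: G_def g_def norm_mult)
  qed measurable
  define z where "z = (\<lambda>s. fourier_L1 g (- s))"
  define Z where "Z = (\<lambda>n s. fourier_L1 (G n) (- s))"
  have z2: "z \<in> L2 UNIV" "l2norm z = l2norm g" unfolding z_def using band_data_Plancherel[OF B g] by auto
  have Z2: "Z n \<in> L2 UNIV" "l2norm (Z n) = l2norm (G n)" for n unfolding Z_def using band_data_Plancherel[OF B G] by auto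
  have Zz: "l2norm (\<lambda>s. Z n s - z s) = l2norm (\<lambda>\<xi>. G n \<xi> - g \<xi>)" for n
    using band_data_Plancherel(2)[OF B band_data_diff[OF G g], of n]
    unfolding Z_def z_def by (simp only: fourier_L1_diff[OF Gi gi])
  \<comment> \<open>\<open>Z n\<close> is the orthogonal projection of \<open>y (r n)\<close>, so their inner product is the squared norm of \<open>Z n\<close>.\<close>
  have G_inner: "l2inner (y (r n)) (Z n) = complex_of_real ((l2norm (G n))\<^sup>2)" for n
  proof -
    have "l2inner (y (r n)) (Z n) = l2inner (fourier_L1 (y (r n))) (G n)"
      unfolding Z_def by (rule fourier_adjoint[OF is_fourier_L1[OF yi y(1)] y(1) Gi G2, symmetric])
    also have "\<dots> = l2inner (G n) (G n)"
      unfolding l2inner_def G_def by (intro Bochner_Integration.integral_cong refl) (auto simp: indicator_def)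
    finally show ?thesis unfolding l2inner_self .
  qed
  have yZ: "(l2norm (\<lambda>t. y (r n) t - Z n t))\<^sup>2 = 1 - (l2norm (G n))\<^sup>2" for n
    unfolding l2norm_diff_sq[OF y(1) Z2(1)] G_inner Z2(2) y(3) by (simp del: of_real_power)
  have G_lim: "(\<lambda>n. l2norm (G n)) \<longlonglongrightarrow> 1"
  proof (rule real_tendsto_sandwich)
    show "\<forall>\<^sub>F n in sequentially. 1 - 1 / real (Suc (r n)) \<le> l2norm (G n)"
      unfolding G_def using y(4) by (auto intro!: always_eventually less_imp_le)
    show "\<forall>\<^sub>F n in sequentially. l2norm (G n) \<le> 1"
      unfolding G_def using band_le[OF y(1,2)] y(3) by (auto intro!: always_eventually)
    have "(\<lambda>n. 1 - 1 / real (Suc n)) \<longlonglongrightarrow> 1 - 0"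
      by (intro tendsto_intros LIMSEQ_Suc[OF lim_1_over_n])
    hence "((\<lambda>n. 1 - 1 / real (Suc n)) \<circ> r) \<longlonglongrightarrow> 1 - 0"
      by (rule LIMSEQ_subseq_LIMSEQ[OF _ r(1)])
    thus "(\<lambda>n. 1 - 1 / real (Suc (r n))) \<longlonglongrightarrow> 1" by (simp add: comp_def)
  qed auto
  have "(\<lambda>n. (l2norm (\<lambda>t. y (r n) t - Z n t))\<^sup>2) \<longlonglongrightarrow> 1 - 1\<^sup>2"
    unfolding yZ by (intro tendsto_intros G_lim)
  hence "(\<lambda>n. sqrt ((l2norm (\<lambda>t. y (r n) t - Z n t))\<^sup>2)) \<longlonglongrightarrow> sqrt 0"
    by (intro tendsto_real_sqrt) simp
  hence yZ0: "(\<lambda>n. l2norm (\<lambda>t. y (r n) t - Z n t)) \<longlonglongrightarrow> 0" by simp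
  have yz: "(\<lambda>n. l2norm (\<lambda>t. y (r n) t - z t)) \<longlonglongrightarrow> 0"
  proof (rule Lim_null_comparison)
    show "(\<lambda>n. l2norm (\<lambda>t. y (r n) t - Z n t) + l2norm (\<lambda>\<xi>. G n \<xi> - g \<xi>)) \<longlonglongrightarrow> 0"
      using tendsto_add[OF yZ0 Gg] by simp
    show "\<forall>\<^sub>F n in sequentially. norm (l2norm (\<lambda>t. y (r n) t - z t)) \<le> l2norm (\<lambda>t. y (r n) t - Z n t) + l2norm (\<lambda>\<xi>. G n \<xi> - g \<xi>)"
      using l2norm_diff_triangle[OF y(1) Z2(1) z2(1)] unfolding Zz by (auto intro!: always_eventually)
  qed
  have "(\<lambda>n. l2norm (y (r n))) \<longlonglongrightarrow> l2norm z" by (rule l2norm_tendsto[OF y(1) z2(1) yz])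
  hence z1: "l2norm z = 1" unfolding y(3) by (simp add: LIMSEQ_const_iff)
  have "AE s in lebesgue. s \<notin> S \<longrightarrow> z s = 0"
  proof -
    define q where "q = (\<lambda>s. indicator (- S) s * z s)"
    have q: "q \<in> L2 UNIV" unfolding q_def using S_sets by (intro L2_restrict z2) (simp add: Compl_in_sets_lebesgue)
    have "l2norm q \<le> l2norm (\<lambda>t. y (r n) t - z t)" for n
      using L2_measurable[OF q] y(2)
      by (intro l2norm_mono L2_diff y(1) z2(1)) (auto simp: q_def indicator_def)
    hence "l2norm q \<le> 0" by (intro LIMSEQ_le_const[OF yz]) auto
    hence "l2norm q = 0" by (intro antisym l2norm_nonneg)
    hence "AE s in lebesgue. q s = 0" using l2norm_eq_0_iff[OF q] by simp
    thus ?thesis by eventually_elim (auto simp: q_def indicator_def)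
  qed
  hence "l2norm g = 0"
    unfolding z_def by (rule Amrein_Berthier[OF B S g])
  thus False using z1 z2 by simp
qed

section \<open>Prescribing a function on one set and its spectrum on another\<close>

text \<open>
  The iteration \<open>y \<mapsto> h0 + T y\<close> with \<open>h0 = 1\<^sub>S h\<close> and \<open>T = 1\<^sub>S Q\<close> converges because \<open>T\<close> contracts by \<open>\<rho> < 1\<close>. The limit \<open>Y\<close>
  satisfies \<open>Y - Q Y = h\<close> on \<open>S\<close>, and by inversion \<open>P Y\<close>, the restriction of the spectrum of \<open>Y\<close> to \<open>B\<close>,
  is the transform of \<open>Q Y\<close>.
\<close>

theorem prescribe_on_set_and_spectrum:
  fixes S B :: "(real ^ 'n) set"
  assumes S: "S \<in> lmeasurable" and B: "B \<in> lmeasurable" and h: "h \<in> L2 UNIV"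
  shows "\<exists>x G. x \<in> L2 UNIV \<and> is_fourier x G \<and> (\<forall>\<xi>\<in>B. G \<xi> = 0) \<and> (AE t in lebesgue. t \<in> S \<longrightarrow> x t = h t)"
proof -
  obtain \<rho> where \<rho>: "0 \<le> \<rho>" "\<rho> < 1"
    and \<rho>_le: "\<And>y. y \<in> L2 UNIV \<Longrightarrow> \<forall>t. t \<notin> S \<longrightarrow> y t = 0 \<Longrightarrow>
      l2norm (\<lambda>\<xi>. indicator B \<xi> * fourier_L1 y \<xi>) \<le> \<rho> * l2norm y"
    using strong_annihilation[OF S B] by blast
  have S_sets: "S \<in> sets lebesgue" using S by auto
  define D :: "(real ^ 'n \<Rightarrow> complex) set" where "D = {y \<in> L2 UNIV. \<forall>t. t \<notin> S \<longrightarrow> y t = 0}"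
  have D_L2: "y \<in> L2 UNIV" and D_int: "integrable lebesgue y" if "y \<in> D" for y
  proof -
    show 2: "y \<in> L2 UNIV" using that by (simp add: D_def)
    have "(\<lambda>t. indicator S t * y t) = y" using that by (intro indicator_mult_eq_self) (simp add: D_def)
    thus "integrable lebesgue y" using L2_integrable_restrict[OF S 2] by simp
  qed
  have D_restrict: "(\<lambda>t. indicator S t * y t) \<in> D" if "y \<in> L2 UNIV" for y
    using L2_restrict[OF that S_sets] by (simp add: D_def)
  have D_add: "(\<lambda>t. y t + y' t) \<in> D" and D_diff: "(\<lambda>t. y t - y' t) \<in> D" if "y \<in> D" "y' \<in> D" for y y'
    using that by (auto simp: D_def)
  define P where "P = (\<lambda>y \<xi>. indicator B \<xi> * fourier_L1 y \<xi>)"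
  define Q where "Q = (\<lambda>y s. fourier_L1 (P y) (- s))"
  define T where "T = (\<lambda>y s. indicator S s * Q y s)"
  have P: "band_data B (P y)" if "y \<in> D" for y
    unfolding P_def by (rule band_data_restrict_fourier[OF B D_int[OF that]])
  have Q: "Q y \<in> L2 UNIV" "l2norm (Q y) \<le> \<rho> * l2norm y" if "y \<in> D" for y
    using band_data_Plancherel[OF B P[OF that]] \<rho>_le[of y] that by (auto simp: Q_def P_def D_def)
  have T: "T y \<in> D" "l2norm (T y) \<le> \<rho> * l2norm y" if "y \<in> D" for y
  proof -
    show "T y \<in> D" unfolding T_def by (rule D_restrict[OF Q(1)[OF that]])
    have "l2norm (T y) \<le> l2norm (Q y)"
      using L2_measurable[OF D_L2[OF \<open>T y \<in> D\<close>]]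
      by (intro l2norm_mono Q(1) that) (auto simp: T_def indicator_def)
    thus "l2norm (T y) \<le> \<rho> * l2norm y" using Q(2)[OF that] by linarith
  qed
  have T_diff: "T (\<lambda>t. y t - y' t) = (\<lambda>t. T y t - T y' t)" if "y \<in> D" "y' \<in> D" for y y'
  proof -
    have "P (\<lambda>t. y t - y' t) = (\<lambda>\<xi>. P y \<xi> - P y' \<xi>)"
      unfolding P_def fourier_L1_diff[OF D_int[OF that(1)] D_int[OF that(2)]] right_diff_distrib ..
    hence "Q (\<lambda>t. y t - y' t) = (\<lambda>s. Q y s - Q y' s)"
      unfolding Q_def
      using fourier_L1_diff[OF band_data_integrable(1)[OF B P[OF that(1)]] band_data_integrable(1)[OF B P[OF that(2)]]]
      by simp
    thus ?thesis unfolding T_def by (simp add: right_diff_distrib)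
  qed
  define h0 where "h0 = (\<lambda>t. indicator S t * h t)"
  have h0: "h0 \<in> D" unfolding h0_def by (rule D_restrict[OF h])
  define y where "y = rec_nat h0 (\<lambda>_ f t. h0 t + T f t)"
  have y_Suc: "y (Suc k) = (\<lambda>t. h0 t + T (y k) t)" for k by (simp add: y_def)
  have y_D: "y k \<in> D" for k
  proof (induction k)
    case 0 show ?case using h0 by (simp add: y_def)
  next
    case (Suc k) show ?case unfolding y_Suc by (rule D_add[OF h0 T(1)[OF Suc]])
  qed
  define c where "c = l2norm (\<lambda>t. y 1 t - y 0 t)"
  have step: "l2norm (\<lambda>t. y (Suc k) t - y k t) \<le> c * \<rho> ^ k" for k
  proof (induction k)
    case 0 show ?case by (simp add: c_def)
  next
    case (Suc k)
    have "(\<lambda>t. y (Suc (Suc k)) t - y (Suc k) t) = T (\<lambda>t. y (Suc k) t - y k t)"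
      unfolding T_diff[OF y_D y_D] y_Suc[of "Suc k"] by (simp add: y_Suc[of k])
    hence "l2norm (\<lambda>t. y (Suc (Suc k)) t - y (Suc k) t) \<le> \<rho> * l2norm (\<lambda>t. y (Suc k) t - y k t)"
      using T(2)[OF D_diff[OF y_D y_D]] by simp
    also have "\<dots> \<le> \<rho> * (c * \<rho> ^ k)" by (rule mult_left_mono[OF Suc \<rho>(1)])
    finally show ?case by (simp add: mult_ac)
  qed
  have "c \<ge> 0" by (simp add: c_def)
  have tail: "l2norm (\<lambda>t. y (k + j) t - y k t) \<le> c / (1 - \<rho>) * \<rho> ^ k" for k j
  proof -
    have "l2norm (\<lambda>t. y (k + j) t - y k t) \<le> c / (1 - \<rho>) * (\<rho> ^ k - \<rho> ^ (k + j))"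
    proof (induction j)
      case 0 show ?case by (simp add: l2norm_def)
    next
      case (Suc j)
      have "l2norm (\<lambda>t. y (k + Suc j) t - y k t) \<le> l2norm (\<lambda>t. y (Suc (k + j)) t - y (k + j) t) + l2norm (\<lambda>t. y (k + j) t - y k t)"
        using l2norm_diff_triangle[OF D_L2[OF y_D] D_L2[OF y_D] D_L2[OF y_D], of "Suc (k + j)" k "k + j"] by simp
      also have "\<dots> \<le> c * \<rho> ^ (k + j) + c / (1 - \<rho>) * (\<rho> ^ k - \<rho> ^ (k + j))"
        by (rule add_mono[OF step Suc])
      also have "\<dots> = c / (1 - \<rho>) * ((1 - \<rho>) * \<rho> ^ (k + j) + (\<rho> ^ k - \<rho> ^ (k + j)))"
        using \<rho>(2) by (simp add: distrib_left)
      also have "(1 - \<rho>) * \<rho> ^ (k + j) + (\<rho> ^ k - \<rho> ^ (k + j)) = \<rho> ^ k - \<rho> ^ (k + Suc j)"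
        by (simp add: left_diff_distrib)
      finally show ?case .
    qed
    also have "\<dots> \<le> c / (1 - \<rho>) * \<rho> ^ k"
      using \<rho> \<open>c \<ge> 0\<close> by (intro mult_left_mono) auto
    finally show ?thesis .
  qed
  have Cauchy: "\<exists>N. \<forall>i\<ge>N. \<forall>j\<ge>N. l2norm (\<lambda>t. y i t - y j t) < e" if "e > 0" for e
  proof -
    have "(\<lambda>k. c / (1 - \<rho>) * \<rho> ^ k) \<longlonglongrightarrow> 0"
      using \<rho> by (intro tendsto_mult_right_zero LIMSEQ_realpow_zero) auto
    hence "\<forall>\<^sub>F k in sequentially. c / (1 - \<rho>) * \<rho> ^ k < e / 2"
      using \<open>e > 0\<close> by (intro order_tendstoD) auto
    then obtain N where N: "c / (1 - \<rho>) * \<rho> ^ N < e / 2"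
      by (auto simp: eventually_sequentially)
    hence *: "l2norm (\<lambda>t. y i t - y N t) < e / 2" if "i \<ge> N" for i
      using le_less_trans[OF tail[of N "i - N"] N] that by simp
    show ?thesis
    proof (intro exI[of _ N] allI impI)
      fix i j assume "i \<ge> N" "j \<ge> N"
      have "l2norm (\<lambda>t. y i t - y j t) \<le> l2norm (\<lambda>t. y i t - y N t) + l2norm (\<lambda>t. y N t - y j t)"
        by (rule l2norm_diff_triangle; rule D_L2[OF y_D])
      thus "l2norm (\<lambda>t. y i t - y j t) < e"
        using *[OF \<open>i \<ge> N\<close>] *[OF \<open>j \<ge> N\<close>] l2norm_minus_commute[of "y N" "y j"] by linarith
    qed
  qed
  obtain Y' where Y': "Y' \<in> L2 UNIV" "(\<lambda>k. l2norm (\<lambda>t. y k t - Y' t)) \<longlonglongrightarrow> 0"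
    by (rule Riesz_Fischer[OF D_L2[OF y_D] Cauchy])
  \<comment> \<open>The limit lives on \<open>S\<close> only almost everywhere; cutting it off makes this hold everywhere.\<close>
  define Y where "Y = (\<lambda>t. indicator S t * Y' t)"
  have Y: "Y \<in> D" unfolding Y_def by (rule D_restrict[OF Y'(1)])
  have yY: "(\<lambda>k. l2norm (\<lambda>t. y k t - Y t)) \<longlonglongrightarrow> 0"
  proof (rule Lim_null_comparison[OF _ Y'(2)], intro always_eventually allI)
    fix k
    have "l2norm (\<lambda>t. y k t - Y t) \<le> l2norm (\<lambda>t. y k t - Y' t)"
      using L2_measurable[OF D_L2[OF D_diff[OF y_D Y]]] y_D[of k]
      by (intro l2norm_mono L2_diff D_L2[OF y_D] Y'(1)) (auto simp: Y_def D_def indicator_def)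
    thus "norm (l2norm (\<lambda>t. y k t - Y t)) \<le> l2norm (\<lambda>t. y k t - Y' t)" by simp
  qed
  have TY: "(\<lambda>t. h0 t + T Y t) \<in> D" by (rule D_add[OF h0 T(1)[OF Y]])
  have "(\<lambda>k. l2norm (\<lambda>t. y (Suc k) t - Y t) + \<rho> * l2norm (\<lambda>t. y k t - Y t)) \<longlonglongrightarrow> 0 + \<rho> * 0"
    by (intro tendsto_intros LIMSEQ_Suc[OF yY] yY)
  moreover have "l2norm (\<lambda>t. Y t - (h0 t + T Y t)) \<le> l2norm (\<lambda>t. y (Suc k) t - Y t) + \<rho> * l2norm (\<lambda>t. y k t - Y t)" for k
  proof -
    have "l2norm (\<lambda>t. Y t - (h0 t + T Y t)) \<le> l2norm (\<lambda>t. Y t - y (Suc k) t) + l2norm (\<lambda>t. y (Suc k) t - (h0 t + T Y t))"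
      by (rule l2norm_diff_triangle; rule D_L2) (rule Y y_D TY)+
    also have "(\<lambda>t. y (Suc k) t - (h0 t + T Y t)) = T (\<lambda>t. y k t - Y t)"
      unfolding T_diff[OF y_D Y] y_Suc by simp
    also have "l2norm (T (\<lambda>t. y k t - Y t)) \<le> \<rho> * l2norm (\<lambda>t. y k t - Y t)"
      by (rule T(2)[OF D_diff[OF y_D Y]])
    finally show ?thesis using l2norm_minus_commute[of Y "y (Suc k)"] by simp
  qed
  ultimately have "l2norm (\<lambda>t. Y t - (h0 t + T Y t)) \<le> 0 + \<rho> * 0"
    by (intro LIMSEQ_le_const) auto
  hence "l2norm (\<lambda>t. Y t - (h0 t + T Y t)) = 0" by (intro antisym l2norm_nonneg) simp
  hence fixp: "AE t in lebesgue. Y t = h0 t + T Y t"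
    using l2norm_eq_0_iff[OF D_L2[OF D_diff[OF Y TY]]] by simp
  obtain M where M: "\<And>\<xi>. cmod (P Y \<xi>) \<le> M" using band_data_integrable(3)[OF B P[OF Y]] by blast
  have FQ: "is_fourier (Q Y) (P Y)"
    unfolding Q_def by (rule fourier_inversion[OF band_data_integrable(1)[OF B P[OF Y]] M])
  have FY: "is_fourier Y (fourier_L1 Y)" by (rule is_fourier_L1[OF D_int[OF Y] D_L2[OF Y]])
  have "is_fourier (\<lambda>t. Y t + (-1) * Q Y t) (\<lambda>\<xi>. fourier_L1 Y \<xi> + (-1) * P Y \<xi>)"
    by (rule is_fourier_add[OF FY D_L2[OF Y] is_fourier_cmult[OF FQ Q(1)[OF Y]] L2_cmult[OF Q(1)[OF Y]]])
  moreover have "(\<lambda>t. Y t + (-1) * Q Y t) \<in> L2 UNIV"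
    by (rule L2_add[OF D_L2[OF Y] L2_cmult[OF Q(1)[OF Y]]])
  moreover have "\<forall>\<xi>\<in>B. fourier_L1 Y \<xi> + (-1) * P Y \<xi> = 0" by (simp add: P_def)
  moreover have "AE t in lebesgue. t \<in> S \<longrightarrow> Y t + (-1) * Q Y t = h t"
    using fixp by eventually_elim (auto simp: T_def h0_def)
  ultimately show ?thesis by blast
qed

text \<open>
  For real \<open>h\<close> take the real part of a complex solution. Its transform at \<open>\<xi>\<close> involves the transform of the
  solution at \<open>\<xi>\<close> and at \<open>- \<xi>\<close>, so the complex problem is solved for the union of \<open>B\<close> and its reflection.
\<close>

corollary prescribe_on_set_and_spectrum_scalars:
  fixes S B :: "(real ^ 'n) set"
  assumes S: "S \<in> lmeasurable" and B: "B \<in> lmeasurable" and K: "K = UNIV \<or> K = \<real>" and h: "h \<in> L2 K"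
  shows "\<exists>x G. x \<in> L2 K \<and> is_fourier x G \<and> (\<forall>\<xi>\<in>B. G \<xi> = 0) \<and> (AE t in lebesgue. t \<in> S \<longrightarrow> x t = h t)"
proof (cases "K = UNIV")
  case True
  thus ?thesis using prescribe_on_set_and_spectrum[OF S B] h by blast
next
  case False
  hence K: "K = \<real>" using K by simp
  have h2: "h \<in> L2 UNIV" and h_real: "\<And>t. h t \<in> \<real>" using h L2_subset_UNIV[OF h] by (auto simp: L2_def K)
  have uB: "uminus ` B \<in> lmeasurable"
  proof -
    have 1: "uminus ` B = (\<lambda>x. 0 + (-1) *\<^sub>R x) -` B \<inter> space lebesgue"
      by (force simp: image_iff)
    have m: "(\<lambda>x::real^'n. 0 + (-1) *\<^sub>R x) \<in> lebesgue \<rightarrow>\<^sub>M lebesgue"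
      by (rule lebesgue_isometry_measurable) simp
    have B_sets: "B \<in> sets lebesgue" using B by auto
    have "emeasure lebesgue B = emeasure (distr lebesgue lebesgue (\<lambda>x::real^'n. 0 + (-1) *\<^sub>R x)) B"
      by (subst lebesgue_isometry) simp_all
    also have "\<dots> = emeasure lebesgue (uminus ` B)"
      unfolding 1 by (rule emeasure_distr[OF m B_sets])
    finally have eq: "emeasure lebesgue B = emeasure lebesgue (uminus ` B)" .
    show ?thesis
    proof (rule fmeasurableI)
      show "uminus ` B \<in> sets lebesgue" unfolding 1 by (rule measurable_sets[OF m B_sets])
      show "emeasure lebesgue (uminus ` B) < \<infinity>"
        unfolding eq[symmetric] using B by (simp only: fmeasurable_def mem_Collect_eq)
    qed
  qed
  obtain x G where x: "x \<in> L2 UNIV" "is_fourier x G" "\<forall>\<xi>\<in>B \<union> uminus ` B. G \<xi> = 0" "AE t in lebesgue. t \<in> S \<longrightarrow> x t = h t"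
    using prescribe_on_set_and_spectrum[OF S fmeasurable.Un[OF B uB] h2] by blast
  define x' where "x' = (\<lambda>t. (1/2) * (x t + cnj (x t)))"
  define G' where "G' = (\<lambda>\<xi>. (1/2) * (G \<xi> + cnj (G (- \<xi>))))"
  have "is_fourier x' G'"
    unfolding x'_def G'_def
    by (intro is_fourier_cmult is_fourier_add is_fourier_cnj L2_add L2_cnj x)
  moreover have x'_Re: "x' t = complex_of_real (Re (x t))" for t
    by (simp add: x'_def complex_eq_iff)
  have "x' \<in> L2 UNIV" unfolding x'_def by (intro L2_cmult L2_add L2_cnj x)
  hence "x' \<in> L2 K" by (auto simp: L2_def K x'_Re)
  moreover have "\<forall>\<xi>\<in>B. G' \<xi> = 0" using x(3) by (auto simp: G'_def)
  moreover have "AE t in lebesgue. t \<in> S \<longrightarrow> x' t = h t"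
    using x(4)
  proof eventually_elim
    case (elim t)
    thus ?case using h_real[of t] by (auto simp: x'_Re)
  qed
  ultimately show ?thesis by blast
qed

lemma L2_scalars_arith:
  assumes K: "K = UNIV \<or> K = \<real>" and "f \<in> L2 K" "g \<in> L2 K"
  shows "(\<lambda>t. f t + g t) \<in> L2 K" "(\<lambda>t. f t - g t) \<in> L2 K"
  using L2_add[of f g] L2_diff[of f g] assms by (auto simp: L2_def image_subset_iff)

lemma integral_in_Reals:
  fixes f :: "'a \<Rightarrow> complex"
  assumes "\<And>t. f t \<in> \<real>" shows "(\<integral>t. f t \<partial>M) \<in> \<real>"
proof -
  have "(\<integral>t. f t \<partial>M) = (\<integral>t. complex_of_real (Re (f t)) \<partial>M)"
    using assms by (intro Bochner_Integration.integral_cong refl) simp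
  thus ?thesis by (simp only: integral_complex_of_real Reals_of_real)
qed

theorem proposition4p10:
  fixes K :: "complex set"
    and A B :: "(real ^ 'n) set"
    and m :: nat
    and v :: "nat \<Rightarrow> real ^ 'n \<Rightarrow> complex"
    and C :: "nat \<Rightarrow> (real ^ 'n) set"
    and \<eta> :: "nat \<Rightarrow> real"
  assumes "K = UNIV \<or> K = \<real>"
    and "A \<in> sets lebesgue" and "emeasure lebesgue A < \<infinity>"
    and "B \<in> sets lebesgue" and "emeasure lebesgue B < \<infinity>"
    and "m \<ge> 3"
    and "\<And>i. i \<in> {1..m - 2} \<Longrightarrow> v i \<in> L2 K"
    and "\<And>i. i \<in> {1..m - 2} \<Longrightarrow> C i = support (v i)"
    and "\<And>i j. i \<in> {1..m - 2} \<Longrightarrow> j \<in> {1..m - 2} \<Longrightarrow> i \<noteq> j \<Longrightarrow> C i \<inter> C j \<in> null_sets lebesgue"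
    and "\<And>i. i \<in> {1..m - 2} \<Longrightarrow> emeasure lebesgue (C i) < \<infinity>"
    and "\<And>i. i \<in> {1..m - 2} \<Longrightarrow> emeasure lebesgue (C i \<inter> - A) > 0"
    and "v m \<in> L2 K" and "v (m - 1) \<in> L2 K"
  shows "\<exists>x \<in> L2 K.
           (\<forall>i \<in> {1..m - 2}. (LINT t:C i|lebesgue. x t * cnj (v i t)) = complex_of_real (\<eta> i)) \<and>
           (AE t in lebesgue. t \<in> A \<longrightarrow> x t = v (m - 1) t) \<and>
           (AE \<xi> in lebesgue. \<xi> \<in> B \<longrightarrow> fourier x \<xi> = fourier (v m) \<xi>)"
proof -
  let ?I = "{1..m - 2}"
  note K = assms(1) and A_sets = assms(2) and v = assms(7) and C = assms(8)
  have A: "A \<in> lmeasurable" and B: "B \<in> lmeasurable"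
    using assms(2-5) by (auto simp: fmeasurable_def)
  have v2: "v i \<in> L2 UNIV" if "i \<in> ?I" for i using L2_subset_UNIV[OF v[OF that]] .
  have u2: "v (m - 1) \<in> L2 UNIV" and w2: "v m \<in> L2 UNIV" using assms(12,13) L2_subset_UNIV by auto
  have C_sets: "C i \<in> sets lebesgue" if "i \<in> ?I" for i
    using measurable_sets[OF L2_measurable[OF v2[OF that]], of "- {0}"] C[OF that] by (simp add: support_def vimage_def)
  have C_mem: "t \<in> C i \<longleftrightarrow> v i t \<noteq> 0" if "i \<in> ?I" for i t
    using C[OF that] by (simp add: support_def)
  define S where "S = A \<union> (\<Union>i\<in>?I. C i)"
  have S: "S \<in> lmeasurable"
    unfolding S_def using A C_sets assms(10)
    by (intro fmeasurable.Un fmeasurable.finite_UN) (auto simp: fmeasurable_def)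
  define d where "d = (\<lambda>i. (l2norm (\<lambda>t. indicator (- A) t * v i t))\<^sup>2)"
  have nA_sets: "- A \<in> sets lebesgue" using A_sets by (simp add: Compl_in_sets_lebesgue)
  have r2: "(\<lambda>t. indicator (- A) t * v i t) \<in> L2 UNIV" if "i \<in> ?I" for i
    by (rule L2_restrict[OF v2[OF that] nA_sets])
  have d_nz: "d i \<noteq> 0" if i: "i \<in> ?I" for i
  proof
    assume "d i = 0"
    hence "AE t in lebesgue. indicator (- A) t * v i t = 0"
      using l2norm_eq_0_iff[OF r2[OF i]] by (simp add: d_def)
    hence "AE t in lebesgue. t \<notin> C i \<inter> - A"
      by eventually_elim (auto simp: C_mem[OF i] indicator_def)
    hence "emeasure lebesgue (C i \<inter> - A) = 0"
      using AE_iff_measurable[of "C i \<inter> - A" lebesgue "\<lambda>t. t \<notin> C i \<inter> - A"] sets.Int[OF C_sets[OF i] nA_sets] by auto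
    thus False using assms(11)[OF i] by simp
  qed
  \<comment> \<open>The constant that makes the inner product with \<open>v i\<close> equal to \<open>\<eta> i\<close>, given the contribution of \<open>A\<close>.\<close>
  define c where "c = (\<lambda>i. (complex_of_real (\<eta> i) - l2inner (\<lambda>t. indicator A t * v (m - 1) t) (v i)) / complex_of_real (d i))"
  define f where "f = (\<lambda>t. indicator A t * v (m - 1) t + indicator (- A) t * (\<Sum>i\<in>?I. c i * v i t))"
  have f2: "f \<in> L2 UNIV"
    unfolding f_def using A_sets nA_sets v2 u2 by (intro L2_add L2_restrict L2_sum L2_cmult) auto
  have fK: "f \<in> L2 K"
  proof (cases "K = UNIV")
    case False
    hence K': "K = \<real>" using K by simp
    have real: "v i t \<in> \<real>" if "i \<in> ?I" for i t using v[OF that] by (auto simp: L2_def K')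
    have real': "v (m - 1) t \<in> \<real>" for t using assms(13) by (auto simp: L2_def K')
    have ind: "indicator X t \<in> (\<real> :: complex set)" for X and t :: "real ^ 'n" by (simp add: indicator_def)
    have "c i \<in> \<real>" if "i \<in> ?I" for i
      unfolding c_def l2inner_def using real[OF that] real' ind
      by (intro Reals_divide Reals_diff Reals_of_real integral_in_Reals Reals_mult) (auto simp: Reals_cnj_iff)
    hence "f t \<in> \<real>" for t
      unfolding f_def using real real' ind by (intro Reals_add Reals_mult sum_in_Reals) auto
    thus ?thesis using f2 by (auto simp: L2_def K')
  qed (use f2 in simp)
  have f_inner: "l2inner f (v i) = complex_of_real (\<eta> i)" if i: "i \<in> ?I" for i
  proof -
    have "AE t in lebesgue. \<forall>j\<in>?I. j \<noteq> i \<longrightarrow> t \<notin> C i \<inter> C j"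
    proof (rule AE_finite_allI)
      fix j assume "j \<in> ?I"
      show "AE t in lebesgue. j \<noteq> i \<longrightarrow> t \<notin> C i \<inter> C j"
      proof (cases "j = i")
        case False
        hence "C i \<inter> C j \<in> null_sets lebesgue" using assms(9)[OF i \<open>j \<in> ?I\<close>] by simp
        thus ?thesis by (auto dest: AE_not_in)
      qed simp
    qed simp
    hence disj: "AE t in lebesgue. (\<Sum>j\<in>?I. c j * v j t) * cnj (v i t) = c i * v i t * cnj (v i t)"
    proof eventually_elim
      case (elim t)
      show ?case
      proof (cases "v i t = 0")
        case False
        have "c j * v j t = 0" if "j \<in> ?I" "j \<noteq> i" for j
          using elim that False C_mem[OF i, of t] C_mem[OF that(1), of t] by auto
        hence "(\<Sum>j\<in>?I. c j * v j t) = (\<Sum>j\<in>?I. if j = i then c i * v i t else 0)"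
          by (intro sum.cong) auto
        thus ?thesis using i by simp
      qed simp
    qed
    let ?q = "\<lambda>t. (indicator (- A) t * v i t) * cnj (indicator (- A) t * v i t)"
    let ?L = "\<lambda>t. indicator A t * v (m - 1) t"
    let ?R = "\<lambda>t. indicator (- A) t * (\<Sum>i\<in>?I. c i * v i t)"
    have R2: "?R \<in> L2 UNIV" using nA_sets v2 by (intro L2_restrict L2_sum L2_cmult) auto
    have "l2inner f (v i) = l2inner ?L (v i) + l2inner ?R (v i)"
      unfolding f_def by (rule l2inner_add_left[OF L2_restrict[OF u2 A_sets] R2 v2[OF i]])
    also have "l2inner ?R (v i) = (\<integral>t. c i * (?q t) \<partial>lebesgue)"
      unfolding l2inner_def
    proof (rule integral_cong_AE)
      show "(\<lambda>t. ?R t * cnj (v i t)) \<in> borel_measurable lebesgue"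
        using L2_inner_integrable[OF R2 v2[OF i]] by simp
      show "(\<lambda>t. c i * (?q t)) \<in> borel_measurable lebesgue"
        using L2_inner_integrable[OF r2[OF i] r2[OF i]] by (intro borel_measurable_times borel_measurable_const borel_measurable_integrable)
      show "AE t in lebesgue. ?R t * cnj (v i t) = c i * (?q t)"
        using disj by eventually_elim (auto simp: indicator_def)
    qed
    also have "\<dots> = c i * complex_of_real (d i)"
      unfolding integral_mult_right_zero l2inner_def[symmetric] l2inner_self d_def ..
    also have "l2inner ?L (v i) + c i * complex_of_real (d i) = complex_of_real (\<eta> i)"
      using d_nz[OF i] by (simp add: c_def)
    finally show ?thesis .
  qed
  obtain x0 G where x0: "x0 \<in> L2 K" "is_fourier x0 G" "\<forall>\<xi>\<in>B. G \<xi> = 0"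
      "AE t in lebesgue. t \<in> S \<longrightarrow> x0 t = f t - v m t"
    using prescribe_on_set_and_spectrum_scalars[OF S B K L2_scalars_arith(2)[OF K fK assms(12)]] by blast
  define x where "x = (\<lambda>t. x0 t + v m t)"
  have x: "x \<in> L2 K" unfolding x_def by (rule L2_scalars_arith(1)[OF K x0(1) assms(12)])
  have x2: "x \<in> L2 UNIV" by (rule L2_subset_UNIV[OF x])
  have xf: "AE t in lebesgue. t \<in> S \<longrightarrow> x t = f t"
    using x0(4) by eventually_elim (auto simp: x_def)
  have "(LINT t:C i|lebesgue. x t * cnj (v i t)) = complex_of_real (\<eta> i)" if i: "i \<in> ?I" for i
  proof -
    have "(LINT t:C i|lebesgue. x t * cnj (v i t)) = l2inner x (v i)"
      unfolding set_lebesgue_integral_def l2inner_def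
      by (intro Bochner_Integration.integral_cong refl) (auto simp: indicator_def C_mem[OF i])
    also have "\<dots> = l2inner f (v i)"
      unfolding l2inner_def
    proof (rule integral_cong_AE)
      show "AE t in lebesgue. x t * cnj (v i t) = f t * cnj (v i t)"
        using xf
      proof eventually_elim
        case (elim t)
        show ?case
        proof (cases "v i t = 0")
          case False
          hence "t \<in> S" using C_mem[OF i, of t] i by (auto simp: S_def)
          thus ?thesis using elim by simp
        qed simp
      qed
    qed (use L2_inner_integrable[OF x2 v2[OF i]] L2_inner_integrable[OF f2 v2[OF i]] in auto)
    finally show ?thesis using f_inner[OF i] by simp
  qed
  moreover have "AE t in lebesgue. t \<in> A \<longrightarrow> x t = v (m - 1) t"
    using xf by eventually_elim (auto simp: S_def f_def)
  moreover have "AE \<xi> in lebesgue. \<xi> \<in> B \<longrightarrow> fourier x \<xi> = fourier (v m) \<xi>"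
  proof -
    have "is_fourier x (\<lambda>\<xi>. G \<xi> + fourier (v m) \<xi>)"
      unfolding x_def by (rule is_fourier_add[OF x0(2) L2_subset_UNIV[OF x0(1)] fourier_is_fourier[OF w2] w2])
    hence "AE \<xi> in lebesgue. fourier x \<xi> = G \<xi> + fourier (v m) \<xi>"
      by (rule is_fourier_unique[OF fourier_is_fourier[OF x2] _ x2])
    thus ?thesis by eventually_elim (use x0(3) in auto)
  qed
  ultimately show ?thesis using x by blast
qed

end
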